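(* For every positive integer $h$ there are $\varepsilon_0=\varepsilon_0(h)>0$ and $d=d(h)$ with the following property. For every $2$-colorable oriented graph $H$ on $h$ vertices and every $0<\varepsilon<\varepsilon_0$ there is $n_0=n_0(\varepsilon)$ such that if a tournament $T$ on $n\ge n_0$ vertices is $\varepsilon$-far from being $H$-free, then $T$ contains at least $\varepsilon^d n^h$ copies of $H$.
   Context: An oriented graph is a directed graph without loops with at most one edge between any two distinct vertices. An oriented graph $H$ is $2$-colorable if $V(H)$ can be partitioned into $2$ sets each inducing an acyclic digraph. A tournament $T$ on $n$ vertices is $\varepsilon$-far from being $H$-free if one must reverse the direction of at least $\varepsilon n^2$ edges of $T$ to obtain a tournament containing no copy of $H$; a copy of $H$ in $T$ is a (not necessarily induced) subgraph of $T$ isomorphic to $H$. *)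

theory Defs
  imports Complex_Main
begin

definition oriented_graph :: "'a set \<Rightarrow> ('a \<times> 'a) set \<Rightarrow> bool" where
  "oriented_graph V E \<longleftrightarrow> E \<subseteq> V \<times> V \<and> (\<forall>x. (x, x) \<notin> E)
     \<and> (\<forall>x y. (x, y) \<in> E \<longrightarrow> (y, x) \<notin> E)"

definition tournament :: "'a set \<Rightarrow> ('a \<times> 'a) set \<Rightarrow> bool" where
  "tournament V E \<longleftrightarrow> oriented_graph V E
     \<and> (\<forall>x\<in>V. \<forall>y\<in>V. x \<noteq> y \<longrightarrow> (x, y) \<in> E \<or> (y, x) \<in> E)"

definition two_colorable :: "'a set \<Rightarrow> ('a \<times> 'a) set \<Rightarrow> bool" where
  "two_colorable V E \<longleftrightarrow> (\<exists>A B. A \<union> B = V \<and> A \<inter> B = {}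
     \<and> acyclic (E \<inter> (A \<times> A)) \<and> acyclic (E \<inter> (B \<times> B)))"

definition copies :: "'a set \<Rightarrow> ('a \<times> 'a) set \<Rightarrow> 'b set \<Rightarrow> ('b \<times> 'b) set
     \<Rightarrow> ('a set \<times> ('a \<times> 'a) set) set" where
  "copies V E VH EH = {(S, F). S \<subseteq> V \<and> F \<subseteq> E \<inter> (S \<times> S) \<and>
     (\<exists>f. bij_betw f VH S \<and> (\<forall>u\<in>VH. \<forall>v\<in>VH. (u, v) \<in> EH \<longleftrightarrow> (f u, f v) \<in> F))}"

definition H_free :: "'a set \<Rightarrow> ('a \<times> 'a) set \<Rightarrow> 'b set \<Rightarrow> ('b \<times> 'b) set \<Rightarrow> bool" where
  "H_free V E VH EH \<longleftrightarrow> copies V E VH EH = {}"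

text \<open>A tournament on n vertices (vertex set V, card V = n) is eps-far from H-free if every
  H-free tournament on V differs from it in at least eps n^2 arcs (reversed arcs).\<close>
definition eps_far :: "real \<Rightarrow> 'a set \<Rightarrow> ('a \<times> 'a) set \<Rightarrow> 'b set \<Rightarrow> ('b \<times> 'b) set \<Rightarrow> bool" where
  "eps_far eps V E VH EH \<longleftrightarrow> (\<forall>E'. tournament V E' \<and> H_free V E' VH EH
     \<longrightarrow> real (card (E - E')) \<ge> eps * real (card V) ^ 2)"

end

theory Submission
  imports Defs "HOL-Library.FuncSet"
begin

text \<open>
  Say that two vertices are close if their out-neighbourhoods differ in few vertices.
  If no small set of vertices is close to almost all others, then a random sample of polynomial size
  contains many pairwise far vertices, and a second, much smaller random sample tells them apart.
  By the Sauer-Shelah lemma the first sample then shatters a large subset of the second one, and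
  Ramsey-type arguments on both sides turn the shattered set into a copy of any 2-colorable \<open>H\<close>.
  Hence either there are polynomially many copies, or almost all vertices fall into polynomially
  few clusters of close vertices.

  In the second case apply this dichotomy twice, with a much smaller parameter the second time.
  The edge directions between two clusters are nearly constant on average, so one can choose a
  representative of every coarse cluster such that the fine clusters of the representatives are
  pairwise homogeneous, and such that orienting every pair of coarse clusters like its
  representatives, and every coarse cluster transitively, reverses fewer than \<open>\<epsilon> n\<^sup>2\<close> edges. The
  resulting tournament contains a copy of \<open>H\<close> in which the vertices of each cluster span an acyclic
  graph. As every large vertex set contains transitive subtournaments, each such copy yields many
  copies inside the fine clusters.
\<close>

section \<open>Transitive subtournaments and the Sauer-Shelah lemma\<close>

text \<open>A regularity lemma would also give clusters and a homogeneous pattern, but with bounds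
  far from polynomial. Here every loss is a power. A sum over all pairs of coarse clusters costs a
  factor 1 / \<open>\<gamma>1\<close> ^ 2, where \<open>\<gamma>1\<close> bounds the relative size
  of a coarse cluster from below, and the fine parameter \<open>\<tau> * \<gamma>1 ^ 2 / 16\<close>
  is chosen to pay for it; since \<open>\<gamma>1\<close> is polynomial in \<open>eps\<close>, so is
  everything derived from it. The 2-coloring enters through the shattered set: one color class goes
  among the shattering vertices, the other into the shattered set. In the modified tournament a copy
  of \<open>H\<close> may put many vertices into one cluster; they span an acyclic graph because
  clusters are oriented transitively, and an acyclic graph embeds in every large tournament.
  Probabilities appear as cardinalities of sets of lists, and injective homomorphisms are counted
  instead of copies, which costs a factor h ^ h.\<close>

lemma transitive_list_in_tournament:
  assumes "finite S" "2 ^ q \<le> card S"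
    and "\<And>x y. x \<in> S \<Longrightarrow> y \<in> S \<Longrightarrow> x \<noteq> y \<Longrightarrow> (x, y) \<in> E \<or> (y, x) \<in> E"
  shows "\<exists>xs. length xs = q \<and> distinct xs \<and> set xs \<subseteq> S \<and> sorted_wrt (\<lambda>x y. (x, y) \<in> E) xs"
  using assms
proof (induction q arbitrary: S)
  case 0
  show ?case by (rule exI[of _ "[]"]) auto
next
  case (Suc q)
  have "card S > 0" using Suc.prems(2) by (metis less_le_trans zero_less_numeral zero_less_power)
  then obtain v where v: "v \<in> S" by fastforce
  define P where "P = {x \<in> S - {v}. (v, x) \<in> E}"
  define Q where "Q = {x \<in> S - {v}. (x, v) \<in> E}"
  have "P \<union> Q = S - {v}" using Suc.prems(3) v by (auto simp: P_def Q_def)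
  then have "card (S - {v}) \<le> card P + card Q" by (metis card_Un_le)
  moreover have "card (S - {v}) = card S - 1" using v Suc.prems(1) by simp
  \<comment> \<open>If both parts had at most 2 ^ q - 1 elements, \<open>S\<close> would have at
    most 2 ^ (q + 1) - 1, counting \<open>v\<close>.\<close>
  ultimately have "2 ^ q \<le> card P \<or> 2 ^ q \<le> card Q" using Suc.prems(2) by auto
  then show ?case
  proof
    assume "2 ^ q \<le> card P"
    moreover have "finite P" using Suc.prems(1) by (simp add: P_def)
    ultimately obtain xs where "length xs = q" "distinct xs" "set xs \<subseteq> P"
      "sorted_wrt (\<lambda>x y. (x, y) \<in> E) xs"
      using Suc.IH[of P] Suc.prems(3) unfolding P_def by fastforce
    then show ?thesis using v by (intro exI[of _ "v # xs"]) (auto simp: P_def)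
  next
    assume "2 ^ q \<le> card Q"
    moreover have "finite Q" using Suc.prems(1) by (simp add: Q_def)
    ultimately obtain xs where "length xs = q" "distinct xs" "set xs \<subseteq> Q"
      "sorted_wrt (\<lambda>x y. (x, y) \<in> E) xs"
      using Suc.IH[of Q] Suc.prems(3) unfolding Q_def by fastforce
    then show ?thesis using v by (intro exI[of _ "xs @ [v]"]) (auto simp: Q_def sorted_wrt_append)
  qed
qed

text \<open>A finite acyclic relation is well-founded, so a nonempty \<open>A\<close> has a source;
  it receives 0 and the numbers of the rest are shifted up. Staying below \<open>card A\<close>
  makes the numbers usable as list indices or block indices.\<close>

lemma topological_numbering:
  assumes "finite A" "acyclic (D \<inter> A \<times> A)"
  shows "\<exists>pos. inj_on pos A \<and> pos ` A \<subseteq> {..<card A} \<and>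
    (\<forall>u\<in>A. \<forall>v\<in>A. (u, v) \<in> D \<longrightarrow> pos u < (pos v :: nat))"
  using assms
proof (induction A rule: finite_psubset_induct)
  case (psubset A)
  show ?case
  proof (cases "A = {}")
    case False
    have "finite (D \<inter> A \<times> A)" using psubset.hyps by simp
    then have "wf (D \<inter> A \<times> A)" using psubset.prems finite_acyclic_wf by blast
    then obtain a where a: "a \<in> A" "\<And>b. (b, a) \<in> D \<inter> A \<times> A \<Longrightarrow> b \<notin> A"
      using False by (meson ex_in_conv wfE_min)
    have nin: "(b, a) \<notin> D" if "b \<in> A" for b using a that by blast
    have "acyclic (D \<inter> (A - {a}) \<times> (A - {a}))"
      by (rule acyclic_subset[OF psubset.prems]) auto
    have "A - {a} \<subset> A" using a(1) by blast
    from psubset.IH[OF this \<open>acyclic (D \<inter> (A - {a}) \<times> (A - {a}))\<close>] obtain pos :: "'a \<Rightarrow> nat" where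
      pos: "inj_on pos (A - {a})" "pos ` (A - {a}) \<subseteq> {..<card (A - {a})}"
        "\<forall>u\<in>A - {a}. \<forall>v\<in>A - {a}. (u, v) \<in> D \<longrightarrow> pos u < pos v"
      by (elim exE conjE)
    have card: "card A = Suc (card (A - {a}))" using psubset.hyps a(1) by (rule card.remove)
    show ?thesis
    proof (intro exI[of _ "\<lambda>u. if u = a then 0 else Suc (pos u)"] conjI ballI impI)
      show "inj_on (\<lambda>u. if u = a then 0 else Suc (pos u)) A"
        using pos(1) by (auto simp: inj_on_def)
      show "(\<lambda>u. if u = a then 0 else Suc (pos u)) ` A \<subseteq> {..<card A}"
        using pos(2) unfolding card by auto
      show "(if u = a then 0 else Suc (pos u)) < (if v = a then 0 else Suc (pos v))"
        if "u \<in> A" "v \<in> A" "(u, v) \<in> D" for u v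
        using that nin[OF that(1)] pos(3)[rule_format, of u v] by auto
    qed
  qed simp
qed

lemma acyclic_embeds_in_transitive_list:
  assumes "finite A" "acyclic (D \<inter> A \<times> A)"
    and "distinct xs" "sorted_wrt (\<lambda>x y. (x, y) \<in> E) xs" "card A \<le> length xs"
  shows "\<exists>\<phi>. inj_on \<phi> A \<and> \<phi> ` A \<subseteq> set xs \<and> (\<forall>u\<in>A. \<forall>v\<in>A. (u, v) \<in> D \<longrightarrow> (\<phi> u, \<phi> v) \<in> E)"
proof -
  from topological_numbering[OF assms(1,2)] obtain pos :: "'a \<Rightarrow> nat" where
    pos: "inj_on pos A" "pos ` A \<subseteq> {..<card A}"
      "\<forall>u\<in>A. \<forall>v\<in>A. (u, v) \<in> D \<longrightarrow> pos u < pos v"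
    by (elim exE conjE)
  have len: "pos u < length xs" if "u \<in> A" for u using pos(2) that assms(5) by fastforce
  have "inj_on (\<lambda>u. xs ! pos u) A"
  proof (rule inj_onI)
    fix u v assume "u \<in> A" "v \<in> A" "xs ! pos u = xs ! pos v"
    then show "u = v" using nth_eq_iff_index_eq[OF assms(3)] len inj_onD[OF pos(1)] by blast
  qed
  moreover have "(xs ! pos u, xs ! pos v) \<in> E" if "u \<in> A" "v \<in> A" "(u, v) \<in> D" for u v
    using sorted_wrt_nth_less[OF assms(4) pos(3)[rule_format]] that len by blast
  ultimately show ?thesis using len by (intro exI[of _ "\<lambda>u. xs ! pos u"]) auto
qed

section \<open>Shattering and the Sauer-Shelah lemma\<close>

definition shatters :: "'a set set \<Rightarrow> 'a set \<Rightarrow> bool" where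
  "shatters F S \<longleftrightarrow> (\<forall>B\<subseteq>S. \<exists>A\<in>F. A \<inter> S = B)"

lemma shattersE:
  assumes "shatters F S" "B \<subseteq> S"
  obtains A where "A \<in> F" "A \<inter> S = B"
proof -
  have "\<exists>A\<in>F. A \<inter> S = B" using assms(1)[unfolded shatters_def, rule_format, OF assms(2)] .
  then show thesis using that by blast
qed

text \<open>Pajor's form of Sauer-Shelah, which needs no binomial identities. Removing
  \<open>a\<close> from the ground set splits \<open>F\<close> into \<open>F0\<close> and
  \<open>Fa\<close>, and card F = card (F0 \<union> Fa) + card (F0 \<inter> Fa). Sets shattered by
  the union are shattered by \<open>F\<close>; sets shattered by the intersection remain shattered
  by \<open>F\<close> after adding \<open>a\<close>, since each trace can be realized both with and
  without \<open>a\<close>.\<close>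

lemma card_le_card_shattered:
  assumes "finite Y" "F \<subseteq> Pow Y"
  shows "card F \<le> card {S. S \<subseteq> Y \<and> shatters F S}"
  using assms
proof (induction Y arbitrary: F rule: finite_induct)
  case empty
  then have F: "F = {} \<or> F = {{}}" by (simp add: subset_singleton_iff)
  show ?case
  proof (cases "F = {}")
    case False
    then have "F = {{}}" using F by simp
    then have "{S. S \<subseteq> {} \<and> shatters F S} = {{}}" by (auto simp: shatters_def)
    then show ?thesis using \<open>F = {{}}\<close> by (simp only: order_refl)
  qed simp
next
  case (insert a Y)
  define F0 where "F0 = {A \<in> F. a \<notin> A}"
  define Fa where "Fa = {A. a \<notin> A \<and> insert a A \<in> F}"
  have sub: "F0 \<subseteq> Pow Y" "Fa \<subseteq> Pow Y" using insert.prems unfolding F0_def Fa_def by blast+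
  have fin: "finite F0" "finite Fa"
    using sub[THEN finite_subset] insert.hyps by auto
  have "F = F0 \<union> insert a ` Fa"
  proof
    show "F \<subseteq> F0 \<union> insert a ` Fa"
    proof
      fix A assume "A \<in> F"
      show "A \<in> F0 \<union> insert a ` Fa"
      proof (cases "a \<in> A")
        case True
        then have "A = insert a (A - {a})" by auto
        moreover have "A - {a} \<in> Fa" using \<open>A \<in> F\<close> True by (simp add: Fa_def insert_absorb)
        ultimately show ?thesis by blast
      qed (simp add: F0_def \<open>A \<in> F\<close>)
    qed
  qed (auto simp: F0_def Fa_def)
  moreover have "F0 \<inter> insert a ` Fa = {}" by (auto simp: F0_def)
  moreover have "card (insert a ` Fa) = card Fa"
    by (rule card_image) (auto simp: inj_on_def Fa_def)
  ultimately have "card F = card F0 + card Fa"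
    using fin by (metis card_Un_disjoint finite_imageI)
  also have "\<dots> = card (F0 \<union> Fa) + card (F0 \<inter> Fa)" using fin by (rule card_Un_Int)
  also have "\<dots> \<le> card {S. S \<subseteq> Y \<and> shatters (F0 \<union> Fa) S} + card {S. S \<subseteq> Y \<and> shatters (F0 \<inter> Fa) S}"
    using insert.IH[of "F0 \<union> Fa"] insert.IH[of "F0 \<inter> Fa"] sub by (intro add_mono) auto
  also have "card {S. S \<subseteq> Y \<and> shatters (F0 \<inter> Fa) S}
      = card (insert a ` {S. S \<subseteq> Y \<and> shatters (F0 \<inter> Fa) S})"
    by (rule card_image[symmetric]) (use insert.hyps in \<open>auto simp: inj_on_def\<close>)
  also have "card {S. S \<subseteq> Y \<and> shatters (F0 \<union> Fa) S} + \<dots> = card ({S. S \<subseteq> Y \<and> shatters (F0 \<union> Fa) S} \<union>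
      insert a ` {S. S \<subseteq> Y \<and> shatters (F0 \<inter> Fa) S})"
    by (rule card_Un_disjoint[symmetric]) (use insert.hyps in auto)
  also have "\<dots> \<le> card {S. S \<subseteq> insert a Y \<and> shatters F S}"
  proof (rule card_mono)
    show "finite {S. S \<subseteq> insert a Y \<and> shatters F S}" using insert.hyps by simp
    have "shatters F S" if S: "S \<subseteq> Y" "shatters (F0 \<union> Fa) S" for S
      unfolding shatters_def
    proof (intro allI impI)
      fix B assume "B \<subseteq> S"
      then obtain A where A: "A \<in> F0 \<union> Fa" "A \<inter> S = B"
        using shattersE[OF S(2)] by metis
      have "insert a A \<inter> S = A \<inter> S" using S(1) insert.hyps(2) by auto
      moreover have "A \<in> F \<or> insert a A \<in> F" using A(1) unfolding F0_def Fa_def by blast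
      ultimately show "\<exists>A\<in>F. A \<inter> S = B" using A(2) by metis
    qed
    moreover have "shatters F (insert a S)" if S: "S \<subseteq> Y" "shatters (F0 \<inter> Fa) S" for S
      unfolding shatters_def
    proof (intro allI impI)
      fix B assume B: "B \<subseteq> insert a S"
      then have "B - {a} \<subseteq> S" by auto
      then obtain A where A: "A \<in> F0 \<inter> Fa" "A \<inter> S = B - {a}"
        using shattersE[OF S(2)] by metis
      show "\<exists>A\<in>F. A \<inter> insert a S = B"
      proof (cases "a \<in> B")
        case True
        then have "insert a A \<inter> insert a S = B" using A(2) by blast
        moreover have "insert a A \<in> F" using A(1) unfolding Fa_def by blast
        ultimately show ?thesis by blast
      next
        case False
        moreover have "A \<in> F" "a \<notin> A" using A(1) unfolding F0_def by blast+
        ultimately have "A \<inter> insert a S = B" using A(2) by blast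
        then show ?thesis using \<open>A \<in> F\<close> by blast
      qed
    qed
    ultimately show "{S. S \<subseteq> Y \<and> shatters (F0 \<union> Fa) S} \<union> insert a ` {S. S \<subseteq> Y \<and> shatters (F0 \<inter> Fa) S}
        \<subseteq> {S. S \<subseteq> insert a Y \<and> shatters F S}" by (simp only: Un_subset_iff) blast
  qed
  finally show ?case .
qed

lemma card_small_subsets_le:
  assumes "finite Y"
  shows "card {S. S \<subseteq> Y \<and> card S < K} \<le> (card Y + 1) ^ K"
proof (cases "Y = {}")
  case True
  have "{S. S \<subseteq> Y \<and> card S < K} \<subseteq> {{}}" using True by auto
  then show ?thesis using True by (metis (no_types, lifting) add_0 card.empty card_mono finite.emptyI finite.insertI is_singletonI is_singleton_altdef power_one)
next
  case False
  let ?L = "{xs. set xs \<subseteq> insert None (Some ` Y) \<and> length xs = K}"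
  have fin: "finite ?L" using assms by (intro finite_lists_length_eq) auto
  have "{S. S \<subseteq> Y \<and> card S < K} \<subseteq> (\<lambda>xs. {y. Some y \<in> set xs}) ` ?L"
  proof
    fix S assume S: "S \<in> {S. S \<subseteq> Y \<and> card S < K}"
    then have "finite S" using assms finite_subset by auto
    then obtain ys where ys: "set ys = S" "distinct ys" using finite_distinct_list by blast
    then have "length ys < K" using S distinct_card by fastforce
    then show "S \<in> (\<lambda>xs. {y. Some y \<in> set xs}) ` ?L"
      using ys S by (intro image_eqI[of _ _ "map Some ys @ replicate (K - length ys) None"]) auto
  qed
  then have "card {S. S \<subseteq> Y \<and> card S < K} \<le> card ?L" by (rule surj_card_le[OF fin])
  also have "\<dots> = card (insert None (Some ` Y)) ^ K" using assms by (intro card_lists_length_eq) auto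
  also have "card (insert None (Some ` Y)) = card Y + 1"
    using assms by (simp add: card_image)
  finally show ?thesis .
qed

text \<open>\<open>F\<close> shatters more sets than there are sets of size below \<open>K\<close>,
  so some shattered set has size at least \<open>K\<close>; subsets of shattered sets are shattered,
  which gives size exactly \<open>K\<close>.\<close>

lemma sauer_shelah:
  assumes "finite Y" "F \<subseteq> Pow Y" "(card Y + 1) ^ K < card F"
  shows "\<exists>S\<subseteq>Y. card S = K \<and> shatters F S"
proof -
  have "\<exists>S\<subseteq>Y. K \<le> card S \<and> shatters F S"
  proof (rule ccontr)
    assume "\<not> ?thesis"
    then have "{S. S \<subseteq> Y \<and> shatters F S} \<subseteq> {S. S \<subseteq> Y \<and> card S < K}" by (auto simp: not_le)
    then have "card {S. S \<subseteq> Y \<and> shatters F S} \<le> card {S. S \<subseteq> Y \<and> card S < K}"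
      using assms(1) by (intro card_mono) auto
    then show False
      using card_le_card_shattered[OF assms(1,2)] card_small_subsets_le[OF assms(1), of K] assms(3)
      by linarith
  qed
  then obtain S where S: "S \<subseteq> Y" "K \<le> card S" "shatters F S" by blast
  then obtain S' where S': "S' \<subseteq> S" "card S' = K" by (meson obtain_subset_with_card_n)
  have "shatters F S'" unfolding shatters_def
  proof (intro allI impI)
    fix B assume B: "B \<subseteq> S'"
    then obtain A where A: "A \<in> F" "A \<inter> S = B" 
      using shattersE[OF S(3) order_trans[OF B S'(1)]] by metis
    then have "A \<inter> S' = B" using S' B by auto
    then show "\<exists>A\<in>F. A \<inter> S' = B" using A by blast
  qed
  then show ?thesis using S S' by blast
qed

section \<open>Random lists of vertices\<close>

text \<open>Labelled, not necessarily induced copies. Extensionality outside \<open>VH\<close> makes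
  this a finite set in which no map is counted twice.\<close>

definition embeddings :: "'a set \<Rightarrow> ('a \<times> 'a) set \<Rightarrow> 'b set \<Rightarrow> ('b \<times> 'b) set \<Rightarrow> ('b \<Rightarrow> 'a) set" where
  "embeddings V E VH EH = {\<phi> \<in> VH \<rightarrow>\<^sub>E V. inj_on \<phi> VH \<and>
     (\<forall>u\<in>VH. \<forall>v\<in>VH. (u, v) \<in> EH \<longrightarrow> (\<phi> u, \<phi> v) \<in> E)}"

lemma finite_embeddings: "finite V \<Longrightarrow> finite VH \<Longrightarrow> finite (embeddings V E VH EH)"
  unfolding embeddings_def by (simp add: finite_PiE)

lemma finite_copies:
  assumes "finite V"
  shows "finite (copies V E VH EH)"
proof (rule finite_subset)
  show "copies V E VH EH \<subseteq> Pow V \<times> Pow (V \<times> V)" unfolding copies_def by auto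
qed (use assms in simp)

lemma copy_of_embedding:
  assumes "EH \<subseteq> VH \<times> VH" "\<phi> \<in> embeddings V E VH EH"
  shows "(\<phi> ` VH, map_prod \<phi> \<phi> ` EH) \<in> copies V E VH EH"
proof -
  have inj: "inj_on \<phi> VH" and V: "\<phi> ` VH \<subseteq> V"
    and E: "\<And>u v. (u, v) \<in> EH \<Longrightarrow> (\<phi> u, \<phi> v) \<in> E"
    using assms unfolding embeddings_def by (auto simp: PiE_def Pi_def)
  have "(u, v) \<in> EH \<longleftrightarrow> (\<phi> u, \<phi> v) \<in> map_prod \<phi> \<phi> ` EH" if "u \<in> VH" "v \<in> VH" for u v
  proof
    assume "(\<phi> u, \<phi> v) \<in> map_prod \<phi> \<phi> ` EH"
    then obtain u' v' where "(u', v') \<in> EH" "\<phi> u = \<phi> u'" "\<phi> v = \<phi> v'" by auto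
    then show "(u, v) \<in> EH" using inj_onD[OF inj] that assms(1) by blast
  qed (auto intro: map_prod_imageI)
  moreover have "map_prod \<phi> \<phi> ` EH \<subseteq> E \<inter> \<phi> ` VH \<times> \<phi> ` VH" using E assms(1) by auto
  moreover have "bij_betw \<phi> VH (\<phi> ` VH)" using inj by (rule inj_on_imp_bij_betw)
  ultimately have "\<exists>f. bij_betw f VH (\<phi> ` VH) \<and>
      (\<forall>u\<in>VH. \<forall>v\<in>VH. (u, v) \<in> EH \<longleftrightarrow> (f u, f v) \<in> map_prod \<phi> \<phi> ` EH)"
    by (intro exI[of _ \<phi>] conjI ballI)
  then show ?thesis using V \<open>map_prod \<phi> \<phi> ` EH \<subseteq> E \<inter> \<phi> ` VH \<times> \<phi> ` VH\<close>
    by (simp add: copies_def)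
qed

text \<open>Every embedding maps into the vertex set of the copy that it spans, and a set of h
  vertices admits at most h ^ h maps from \<open>VH\<close>. A cruder count than one by
  automorphisms, but h is a constant.\<close>

lemma card_embeddings_le:
  assumes "finite V" "finite VH" "EH \<subseteq> VH \<times> VH"
  shows "card (embeddings V E VH EH) \<le> card (copies V E VH EH) * card VH ^ card VH"
proof -
  have fin: "finite (VH \<rightarrow>\<^sub>E fst c)" if "c \<in> copies V E VH EH" for c
  proof -
    have "fst c \<subseteq> V" using that by (auto simp: copies_def)
    then show ?thesis using assms(1,2) by (intro finite_PiE) (auto intro: finite_subset)
  qed
  have "embeddings V E VH EH \<subseteq> (\<Union>c\<in>copies V E VH EH. VH \<rightarrow>\<^sub>E fst c)"
  proof
    fix \<phi> assume \<phi>: "\<phi> \<in> embeddings V E VH EH"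
    then have "\<phi> \<in> VH \<rightarrow>\<^sub>E \<phi> ` VH" unfolding embeddings_def by auto
    then show "\<phi> \<in> (\<Union>c\<in>copies V E VH EH. VH \<rightarrow>\<^sub>E fst c)"
      using copy_of_embedding[OF assms(3) \<phi>] by force
  qed
  then have "card (embeddings V E VH EH) \<le> card (\<Union>c\<in>copies V E VH EH. VH \<rightarrow>\<^sub>E fst c)"
    using finite_copies[OF assms(1)] fin by (intro card_mono finite_UN_I)
  also have "\<dots> \<le> (\<Sum>c\<in>copies V E VH EH. card (VH \<rightarrow>\<^sub>E fst c))"
    by (rule card_UN_le[OF finite_copies[OF assms(1)]])
  also have "\<dots> = (\<Sum>c\<in>copies V E VH EH. card VH ^ card VH)"
  proof (rule sum.cong)
    fix c assume "c \<in> copies V E VH EH"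
    then have "card (fst c) = card VH" unfolding copies_def by (auto dest: bij_betw_same_card)
    then show "card (VH \<rightarrow>\<^sub>E fst c) = card VH ^ card VH" using assms(2) by (simp add: card_PiE)
  qed simp
  finally show ?thesis by simp
qed

section \<open>Sampling with repetition\<close>

text \<open>The sample space for \<open>N\<close> independent uniform vertices. Its size is an exact
  power, and independent samples are combined by appending lists.\<close>

definition lists_over :: "'a set \<Rightarrow> nat \<Rightarrow> 'a list set" where
  "lists_over V N = {xs. set xs \<subseteq> V \<and> length xs = N}"

lemma finite_lists_over: "finite V \<Longrightarrow> finite (lists_over V N)"
  unfolding lists_over_def by (rule finite_lists_length_eq)

lemma card_lists_over: "finite V \<Longrightarrow> card (lists_over V N) = card V ^ N"
  unfolding lists_over_def by (rule card_lists_length_eq)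

text \<open>A random list contains all of \<open>S\<close> with probability at most (N / card V) ^
  card S, written without division. Cutting out one occurrence of \<open>a\<close> leaves a list
  that is shorter by one and still contains \<open>S\<close>, and there are at most \<open>N\<close>
  places where \<open>a\<close> may have been.\<close>

lemma card_lists_containing:
  assumes "finite V" "finite S"
  shows "card {xs \<in> lists_over V N. S \<subseteq> set xs} * card V ^ card S \<le> N ^ card S * card V ^ N"
  using assms(2)
proof (induction S arbitrary: N rule: finite_induct)
  case empty
  then show ?case using assms(1) by (simp add: card_lists_over)
next
  case (insert a S)
  show ?case
  proof (cases N)
    case 0
    then have "{xs \<in> lists_over V N. insert a S \<subseteq> set xs} = {}" by (auto simp: lists_over_def)
    then show ?thesis by (simp only: card.empty)
  next
    case (Suc N')
    define C where "C = {xs \<in> lists_over V N'. S \<subseteq> set xs}"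
    have finC: "finite C" using finite_lists_over[OF assms(1)] by (simp add: C_def)
    have "{xs \<in> lists_over V N. insert a S \<subseteq> set xs}
        \<subseteq> (\<lambda>(i, xs). take i xs @ a # drop i xs) ` ({..<N} \<times> C)"
    proof
      fix xs assume xs: "xs \<in> {xs \<in> lists_over V N. insert a S \<subseteq> set xs}"
      then obtain ys zs where yz: "xs = ys @ a # zs" by (auto dest: split_list)
      have "ys @ zs \<in> C" "length ys \<in> {..<N}"
        using xs yz insert.hyps(2) Suc by (auto simp: C_def lists_over_def)
      then show "xs \<in> (\<lambda>(i, xs). take i xs @ a # drop i xs) ` ({..<N} \<times> C)"
        using yz by (intro image_eqI[of _ _ "(length ys, ys @ zs)"]) auto
    qed
    then have "card {xs \<in> lists_over V N. insert a S \<subseteq> set xs} \<le> card ({..<N} \<times> C)"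
      using finC by (intro surj_card_le) auto
    then have "card {xs \<in> lists_over V N. insert a S \<subseteq> set xs} \<le> N * card C"
      by (simp only: card_cartesian_product card_lessThan)
    then have "card {xs \<in> lists_over V N. insert a S \<subseteq> set xs} * card V ^ card (insert a S)
        \<le> N * card C * card V ^ card (insert a S)" by (rule mult_right_mono) simp
    also have "\<dots> = N * (card C * card V ^ card S) * card V" using insert.hyps by simp
    also have "\<dots> \<le> N * (N' ^ card S * card V ^ N') * card V"
      using insert.IH[of N'] unfolding C_def by (intro mult_right_mono mult_left_mono) auto
    also have "\<dots> \<le> N * (N ^ card S * card V ^ N') * card V"
      using Suc by (intro mult_right_mono mult_left_mono power_mono) auto
    also have "\<dots> = N ^ card (insert a S) * card V ^ N" using insert.hyps Suc by (simp add: algebra_simps)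
    finally show ?thesis .
  qed
qed

text \<open>Double counting: each list of \<open>A\<close> contains the image of some embedding,
  while a fixed image lies in few lists by \<open>card_lists_containing\<close>. Hence a constant
  proportion of good lists forces a constant proportion of all maps to be embeddings.\<close>

lemma card_lists_with_embedding:
  assumes "finite V" "finite VH" "A \<subseteq> lists_over V N"
    and "\<And>xs. xs \<in> A \<Longrightarrow> \<exists>\<phi>\<in>embeddings V E VH EH. \<phi> ` VH \<subseteq> set xs"
  shows "card A * card V ^ card VH \<le> card (embeddings V E VH EH) * (N ^ card VH * card V ^ N)"
proof -
  let ?C = "\<lambda>\<phi>. {xs \<in> lists_over V N. \<phi> ` VH \<subseteq> set xs}"
  have finE: "finite (embeddings V E VH EH)" using assms finite_embeddings by blast
  have "A \<subseteq> (\<Union>\<phi>\<in>embeddings V E VH EH. ?C \<phi>)"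
  proof
    fix xs assume xs: "xs \<in> A"
    then obtain \<phi> where "\<phi> \<in> embeddings V E VH EH" "\<phi> ` VH \<subseteq> set xs" using assms(4) by metis
    then show "xs \<in> (\<Union>\<phi>\<in>embeddings V E VH EH. ?C \<phi>)" using xs assms(3) by auto
  qed
  then have "card A \<le> card (\<Union>\<phi>\<in>embeddings V E VH EH. ?C \<phi>)"
    using finE finite_lists_over[OF assms(1)] by (intro card_mono) auto
  also have "\<dots> \<le> (\<Sum>\<phi>\<in>embeddings V E VH EH. card (?C \<phi>))" by (rule card_UN_le[OF finE])
  finally have "card A * card V ^ card VH
      \<le> (\<Sum>\<phi>\<in>embeddings V E VH EH. card (?C \<phi>)) * card V ^ card VH"
    by (rule mult_right_mono) simp
  also have "\<dots> = (\<Sum>\<phi>\<in>embeddings V E VH EH. card (?C \<phi>) * card V ^ card VH)"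
    by (rule sum_distrib_right)
  also have "\<dots> \<le> (\<Sum>\<phi>\<in>embeddings V E VH EH. N ^ card VH * card V ^ N)"
  proof (rule sum_mono)
    fix \<phi> assume "\<phi> \<in> embeddings V E VH EH"
    then have "card (\<phi> ` VH) = card VH" unfolding embeddings_def by (auto intro: card_image)
    then show "card (?C \<phi>) * card V ^ card VH \<le> N ^ card VH * card V ^ N"
      using card_lists_containing[OF assms(1), of "\<phi> ` VH" N] assms(2) by simp
  qed
  finally show ?thesis by simp
qed

text \<open>Product rule for two samples where the requirement on the second may depend on the
  first. Appending is injective because all first parts have the same length.\<close>

lemma card_append_lists:
  assumes "finite V" "A \<subseteq> lists_over V a" "\<And>xs. xs \<in> A \<Longrightarrow> B xs \<subseteq> lists_over V b"
    and "\<And>xs. xs \<in> A \<Longrightarrow> q \<le> real (card (B xs))"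
    and "\<And>xs ys. xs \<in> A \<Longrightarrow> ys \<in> B xs \<Longrightarrow> xs @ ys \<in> C" "C \<subseteq> lists_over V (a + b)"
  shows "real (card A) * q \<le> real (card C)"
proof -
  have finA: "finite A" using assms(1,2) finite_lists_over finite_subset by blast
  have finB: "finite (B xs)" if "xs \<in> A" for xs
    using assms(1,3) that finite_lists_over finite_subset by blast
  have "real (card A) * q = (\<Sum>xs\<in>A. q)" by simp
  also have "\<dots> \<le> (\<Sum>xs\<in>A. real (card (B xs)))" by (intro sum_mono assms(4))
  also have "\<dots> = real (card (Sigma A B))" using finA finB by (simp add: card_SigmaI)
  also have "card (Sigma A B) \<le> card C"
  proof (rule card_inj_on_le)
    show "inj_on (\<lambda>(xs, ys). xs @ ys) (Sigma A B)"
    proof (rule inj_onI, clarify)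
      fix xs ys xs' ys'
      assume "xs \<in> A" "xs' \<in> A" "xs @ ys = xs' @ ys'"
      moreover from this have "length xs = length xs'" using assms(2) by (auto simp: lists_over_def)
      ultimately show "xs = xs' \<and> ys = ys'" by simp
    qed
    show "(\<lambda>(xs, ys). xs @ ys) ` Sigma A B \<subseteq> C" using assms(5) by auto
    show "finite C" using assms(1,6) finite_lists_over finite_subset by blast
  qed
  finally show ?thesis by simp
qed

lemma card_lists_hitting:
  assumes "finite V" "D \<subseteq> V" "\<eta> * real (card V) \<le> real (card D)" "\<eta> \<le> 1"
  shows "real (card {ys \<in> lists_over V L. set ys \<inter> D = {}}) \<le> (1 - \<eta>) ^ L * real (card V) ^ L"
proof -
  have "{ys \<in> lists_over V L. set ys \<inter> D = {}} = lists_over (V - D) L"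
    by (auto simp: lists_over_def)
  then have "real (card {ys \<in> lists_over V L. set ys \<inter> D = {}}) = real (card (V - D)) ^ L"
    using assms(1) by (simp add: card_lists_over)
  also have "\<dots> \<le> ((1 - \<eta>) * real (card V)) ^ L"
  proof (rule power_mono)
    have "real (card (V - D)) = real (card V) - real (card D)"
      using assms(1,2) by (simp add: card_Diff_subset finite_subset card_mono of_nat_diff)
    then show "real (card (V - D)) \<le> (1 - \<eta>) * real (card V)"
      using assms(3) by (simp add: algebra_simps)
  qed simp
  finally show ?thesis by (simp add: power_mult_distrib)
qed

definition pairwise_far :: "('a \<Rightarrow> 'a \<Rightarrow> bool) \<Rightarrow> 'a set \<Rightarrow> bool" where
  "pairwise_far far X \<longleftrightarrow> (\<forall>x\<in>X. \<forall>y\<in>X. x \<noteq> y \<longrightarrow> far x y)"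

text \<open>Greedy selection, one block of \<open>L\<close> samples per vertex. By
  \<open>large\<close>, a proportion \<eta> of all vertices is far from everything chosen so far, so
  a block misses them with probability at most (1 - \<eta>) ^ L; the failure probabilities of the
  \<open>j\<close> blocks add up.\<close>

lemma card_lists_with_separated_set:
  assumes "finite V" "\<And>x. \<not> far x x" "\<And>x y. far x y \<Longrightarrow> far y x" "0 \<le> \<eta>" "\<eta> \<le> 1"
    and large: "\<And>X. X \<subseteq> V \<Longrightarrow> card X < r \<Longrightarrow>
      \<eta> * real (card V) \<le> real (card {v \<in> V. \<forall>x\<in>X. far x v})"
    and "j \<le> r"
  shows "(1 - real j * (1 - \<eta>) ^ L) * real (card V) ^ (j * L)
    \<le> real (card {xs \<in> lists_over V (j * L). \<exists>X\<subseteq>set xs. card X = j \<and> pairwise_far far X})"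
  using \<open>j \<le> r\<close>
proof (induction j)
  case 0
  have "{xs \<in> lists_over V (0 * L). \<exists>X\<subseteq>set xs. card X = 0 \<and> pairwise_far far X} = lists_over V 0"
    by (auto simp: pairwise_far_def intro: exI[of _ "{}"])
  then show ?case using assms(1) by (simp add: card_lists_over)
next
  case (Suc j)
  let ?G = "\<lambda>j. {xs \<in> lists_over V (j * L). \<exists>X\<subseteq>set xs. card X = j \<and> pairwise_far far X}"
  define \<zeta> where "\<zeta> = (1 - \<eta>) ^ L"
  have \<zeta>: "0 \<le> \<zeta>" "\<zeta> \<le> 1" using assms(4,5) by (auto simp: \<zeta>_def power_le_one)
  define n where "n = real (card V)"
  have "\<forall>xs\<in>?G j. \<exists>X. X \<subseteq> set xs \<and> card X = j \<and> pairwise_far far X" by blast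
  from bchoice[OF this] obtain X
    where "\<forall>xs\<in>?G j. X xs \<subseteq> set xs \<and> card (X xs) = j \<and> pairwise_far far (X xs)" ..
  then have X: "X xs \<subseteq> set xs \<and> card (X xs) = j \<and> pairwise_far far (X xs)" if "xs \<in> ?G j" for xs
    using that by (rule bspec)
  define D where "D xs = {v \<in> V. \<forall>x\<in>X xs. far x v}" for xs
  define B where "B xs = lists_over V L - {ys \<in> lists_over V L. set ys \<inter> D xs = {}}" for xs
  have XV: "X xs \<subseteq> V" if "xs \<in> ?G j" for xs
    using X[OF that] that by (auto simp: lists_over_def)
  have cardB: "(1 - \<zeta>) * n ^ L \<le> real (card (B xs))" if xs: "xs \<in> ?G j" for xs
  proof -
    have "real (card {ys \<in> lists_over V L. set ys \<inter> D xs = {}}) \<le> \<zeta> * n ^ L"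
      unfolding \<zeta>_def n_def
    proof (rule card_lists_hitting[OF assms(1)])
      show "\<eta> * real (card V) \<le> real (card (D xs))"
        unfolding D_def using X[OF xs] XV[OF xs] Suc.prems by (intro large) auto
    qed (auto simp: D_def assms(5))
    moreover have "real (card (B xs)) =
        real (card (lists_over V L)) - real (card {ys \<in> lists_over V L. set ys \<inter> D xs = {}})"
      unfolding B_def using finite_lists_over[OF assms(1), of L]
      by (subst card_Diff_subset) (auto simp: of_nat_diff card_mono)
    ultimately show ?thesis using assms(1) by (simp add: card_lists_over n_def algebra_simps)
  qed
  have step: "real (card (?G j)) * ((1 - \<zeta>) * n ^ L) \<le> real (card (?G (Suc j)))"
  proof (rule card_append_lists[OF assms(1), of _ "j * L" B L])
    fix xs ys assume xs: "xs \<in> ?G j" and ys: "ys \<in> B xs"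
    then obtain v where v: "v \<in> set ys" "v \<in> D xs" by (auto simp: B_def)
    have "v \<notin> X xs" using v assms(2) by (auto simp: D_def)
    moreover have "finite (X xs)" using XV[OF xs] assms(1) finite_subset by blast
    ultimately have "card (insert v (X xs)) = Suc j" using X[OF xs] by simp
    moreover have "pairwise_far far (insert v (X xs))"
      using X[OF xs] v assms(3) unfolding pairwise_far_def D_def by blast
    moreover have "insert v (X xs) \<subseteq> set (xs @ ys)" using X[OF xs] v by auto
    ultimately have "\<exists>X\<subseteq>set (xs @ ys). card X = Suc j \<and> pairwise_far far X" by blast
    moreover have "xs @ ys \<in> lists_over V (Suc j * L)"
      using xs ys by (auto simp: lists_over_def B_def)
    ultimately show "xs @ ys \<in> ?G (Suc j)" by blast
  qed (use cardB in \<open>auto simp: B_def add.commute\<close>)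
  have IH: "(1 - real j * \<zeta>) * n ^ (j * L) \<le> real (card (?G j))"
    using Suc unfolding \<zeta>_def n_def by auto
  have "(1 - real (Suc j) * \<zeta>) * n ^ (Suc j * L)
      \<le> ((1 - real j * \<zeta>) * n ^ (j * L)) * ((1 - \<zeta>) * n ^ L)"
  proof -
    have "1 - real (Suc j) * \<zeta> \<le> (1 - real j * \<zeta>) * (1 - \<zeta>)"
      using \<zeta> by (simp add: algebra_simps)
    then have "(1 - real (Suc j) * \<zeta>) * n ^ (Suc j * L) \<le> (1 - real j * \<zeta>) * (1 - \<zeta>) * n ^ (Suc j * L)"
      by (rule mult_right_mono) (simp add: n_def)
    also have "\<dots> = ((1 - real j * \<zeta>) * n ^ (j * L)) * ((1 - \<zeta>) * n ^ L)"
      by (simp add: power_add algebra_simps)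
    finally show ?thesis .
  qed
  also have "\<dots> \<le> real (card (?G j)) * ((1 - \<zeta>) * n ^ L)"
    using IH \<zeta> by (intro mult_right_mono) (auto simp: n_def)
  also note step
  finally show ?case unfolding \<zeta>_def n_def .
qed

text \<open>Union bound over the ordered pairs of \<open>X\<close>. In the application
  \<open>D x y\<close> is the symmetric difference of two out-neighborhoods, so a list that meets
  all these sets sees different traces of all vertices of \<open>X\<close>.\<close>

lemma card_lists_distinguishing:
  assumes "finite V" "finite X" "\<delta> \<le> 1"
    and "\<And>x y. x \<in> X \<Longrightarrow> y \<in> X \<Longrightarrow> x \<noteq> y \<Longrightarrow> D x y \<subseteq> V \<and> \<delta> * real (card V) \<le> real (card (D x y))"
  shows "(1 - real (card X) ^ 2 * (1 - \<delta>) ^ m) * real (card V) ^ m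
    \<le> real (card {ys \<in> lists_over V m. \<forall>x\<in>X. \<forall>y\<in>X. x \<noteq> y \<longrightarrow> set ys \<inter> D x y \<noteq> {}})"
proof -
  let ?P = "{p \<in> X \<times> X. fst p \<noteq> snd p}"
  let ?B = "\<lambda>p. {ys \<in> lists_over V m. set ys \<inter> D (fst p) (snd p) = {}}"
  let ?G = "{ys \<in> lists_over V m. \<forall>x\<in>X. \<forall>y\<in>X. x \<noteq> y \<longrightarrow> set ys \<inter> D x y \<noteq> {}}"
  have fin: "finite (lists_over V m)" using finite_lists_over[OF assms(1)] .
  have finP: "finite ?P" using assms(2) by simp
  have "lists_over V m \<subseteq> ?G \<union> (\<Union>p\<in>?P. ?B p)"
  proof
    fix ys assume ys: "ys \<in> lists_over V m"
    show "ys \<in> ?G \<union> (\<Union>p\<in>?P. ?B p)"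
    proof (cases "\<forall>x\<in>X. \<forall>y\<in>X. x \<noteq> y \<longrightarrow> set ys \<inter> D x y \<noteq> {}")
      case False
      then obtain x y where "(x, y) \<in> ?P" "set ys \<inter> D x y = {}" by auto
      then show ?thesis using ys by force
    qed (use ys in simp)
  qed
  then have "card (lists_over V m) \<le> card (?G \<union> (\<Union>p\<in>?P. ?B p))"
    using fin finP by (intro card_mono) auto
  also have "\<dots> \<le> card ?G + card (\<Union>p\<in>?P. ?B p)" by (rule card_Un_le)
  finally have "real (card (lists_over V m)) \<le> real (card ?G) + real (card (\<Union>p\<in>?P. ?B p))"
    by linarith
  moreover have "real (card (\<Union>p\<in>?P. ?B p)) \<le> real (card X) ^ 2 * ((1 - \<delta>) ^ m * real (card V) ^ m)"
  proof -
    have "real (card (\<Union>p\<in>?P. ?B p)) \<le> (\<Sum>p\<in>?P. real (card (?B p)))"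
      using of_nat_mono[OF card_UN_le[OF finP, of ?B], where ?'a = real] by (simp only: of_nat_sum)
    also have "\<dots> \<le> (\<Sum>p\<in>?P. (1 - \<delta>) ^ m * real (card V) ^ m)"
    proof (rule sum_mono)
      fix p assume "p \<in> ?P"
      then show "real (card (?B p)) \<le> (1 - \<delta>) ^ m * real (card V) ^ m"
        using assms(4)[of "fst p" "snd p"] by (auto intro!: card_lists_hitting[OF assms(1) _ _ assms(3)])
    qed
    also have "\<dots> = real (card ?P) * ((1 - \<delta>) ^ m * real (card V) ^ m)" by simp
    also have "\<dots> \<le> real (card X) ^ 2 * ((1 - \<delta>) ^ m * real (card V) ^ m)"
    proof (rule mult_right_mono)
      have "card ?P \<le> card (X \<times> X)" using assms(2) by (intro card_mono) auto
      also have "\<dots> = card X ^ 2" by (simp add: card_cartesian_product power2_eq_square)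
      finally show "real (card ?P) \<le> real (card X) ^ 2" by (metis of_nat_mono of_nat_power)
    qed (use assms(3) in simp)
    finally show ?thesis .
  qed
  ultimately show ?thesis using assms(1) by (simp add: card_lists_over algebra_simps)
qed

section \<open>Copies of two-colorable graphs from shattered sets\<close>

text \<open>The vertices of \<open>X\<close> act as rows and those of \<open>Y\<close> as columns of
  a matrix in which shattering allows any row to be prescribed. Only the adjacency between rows and
  columns can be prescribed, so both sides need Ramsey: \<open>Y\<close> contains a transitive list,
  cut into h blocks, and any p = 2 ^ h rows contain h vertices forming a transitive list. Color
  class \<open>A\<close> is embedded among these rows. A vertex of color class \<open>B\<close> goes
  into the block given by its topological number, which takes care of the edges inside
  \<open>B\<close>, and to a column whose type is its set of in-neighbors in
  \<open>A\<close>.\<close>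

lemma embedding_of_shattered:
  assumes V: "tournament V E" "finite V" and H: "finite VH" "VH \<noteq> {}"
      "oriented_graph VH EH" "two_colorable VH EH"
    and p: "p = 2 ^ card VH" and M: "M = 2 ^ p * (p + 1)"
    and XY: "X \<subseteq> V" "Y \<subseteq> V" "2 ^ (card VH * M) \<le> card Y"
    and shattered: "\<And>B. B \<subseteq> Y \<Longrightarrow> \<exists>x\<in>X. E `` {x} \<inter> Y = B"
  shows "\<exists>\<phi>\<in>embeddings V E VH EH. \<phi> ` VH \<subseteq> X \<union> Y"
proof -
  define h where "h = card VH"
  have h: "h > 0" using H by (simp add: h_def card_gt_0_iff)
  have total: "(x, y) \<in> E \<or> (y, x) \<in> E" if "x \<in> V" "y \<in> V" "x \<noteq> y" for x y
    using V(1) that unfolding tournament_def by blast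
  obtain A B where AB: "A \<union> B = VH" "A \<inter> B = {}" "acyclic (EH \<inter> A \<times> A)" "acyclic (EH \<inter> B \<times> B)"
    using H(4) unfolding two_colorable_def by blast
  have finAB: "finite A" "finite B" using AB(1) H(1) by (auto intro: finite_subset)
  have cardAB: "card A \<le> h" "card B \<le> h" using AB(1) H(1) unfolding h_def by (auto intro: card_mono)
  have "finite Y" using XY(2) V(2) finite_subset by blast
  from transitive_list_in_tournament[OF this XY(3), of E] total XY(2)
  obtain ys where ys: "length ys = h * M" "distinct ys" "set ys \<subseteq> Y"
    "sorted_wrt (\<lambda>x y. (x, y) \<in> E) ys" unfolding h_def by blast
  have "card {..<M} = card (Pow {..<p} \<times> {..p})"
    by (simp add: M card_cartesian_product card_Pow)
  then obtain g0 where "bij_betw g0 (Pow {..<p} \<times> {..p}) {..<M}"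
    using finite_same_card_bij[of "Pow {..<p} \<times> {..p}" "{..<M}"] by auto
  \<comment> \<open>each column type, a subset of the rows, occurs \<open>p + 1\<close> times in every block of \<open>ys\<close>;
    the spare occurrences serve to avoid the rows themselves\<close>
  then have g0: "inj_on g0 (Pow {..<p} \<times> {..p})" "g0 ` (Pow {..<p} \<times> {..p}) = {..<M}"
    by (auto simp: bij_betw_def)
  define col where "col j c l = ys ! (j * M + g0 (c, l))" for j c l
  have idx: "j * M + g0 (c, l) < h * M" if "j < h" "c \<subseteq> {..<p}" "l \<le> p" for j c l
  proof -
    have "g0 (c, l) < M" using g0(2) that by auto
    then have "j * M + g0 (c, l) < Suc j * M" by simp
    also have "\<dots> \<le> h * M" using that(1) by (intro mult_right_mono) auto
    finally show ?thesis .
  qed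
  have idx_mod: "(j * M + g0 (c, l)) mod M = g0 (c, l)" if "c \<subseteq> {..<p}" "l \<le> p" for j c l
  proof -
    have "g0 (c, l) < M" using g0(2) that by auto
    then show ?thesis by simp
  qed
  have colY: "col j c l \<in> Y" if "j < h" "c \<subseteq> {..<p}" "l \<le> p" for j c l
    using idx[OF that] ys(1,3) unfolding col_def by auto
  \<comment> \<open>Row \<open>i\<close> is a vertex whose trace on \<open>Y\<close> consists of
    exactly the columns whose type contains \<open>i\<close>. This is consistent because the list
    \<open>ys\<close> is distinct and \<open>g0\<close> is injective, so a column determines its
    type.\<close>
  have "\<exists>x\<in>X. \<forall>j<h. \<forall>c\<subseteq>{..<p}. \<forall>l\<le>p. (x, col j c l) \<in> E \<longleftrightarrow> i \<in> c" for i
  proof -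
    let ?T = "{col j c l |j c l. j < h \<and> c \<subseteq> {..<p} \<and> l \<le> p \<and> i \<in> c}"
    have "?T \<subseteq> Y" using colY by auto
    then obtain x where x: "x \<in> X" "E `` {x} \<inter> Y = ?T" using shattered by meson
    have "(x, col j c l) \<in> E \<longleftrightarrow> i \<in> c" if jcl: "j < h" "c \<subseteq> {..<p}" "l \<le> p" for j c l
    proof
      assume "(x, col j c l) \<in> E"
      then have "col j c l \<in> ?T" using colY[OF jcl] x(2) by blast
      then obtain j' c' l' where *: "col j c l = col j' c' l'" "j' < h" "c' \<subseteq> {..<p}" "l' \<le> p" "i \<in> c'"
        by blast
      then have "j * M + g0 (c, l) = j' * M + g0 (c', l')"
        using nth_eq_iff_index_eq[OF ys(2)] idx jcl ys(1) unfolding col_def by metis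
      then have "g0 (c, l) = g0 (c', l')" using idx_mod jcl * by metis
      then have "(c, l) = (c', l')" using inj_onD[OF g0(1)] jcl * by blast
      then show "i \<in> c" using * by simp
    next
      assume "i \<in> c"
      then have "col j c l \<in> ?T" using jcl by blast
      then show "(x, col j c l) \<in> E" using x(2) by blast
    qed
    then show ?thesis using x(1) by blast
  qed
  then obtain x where x: "\<And>i. x i \<in> X"
    "\<And>i j c l. j < h \<Longrightarrow> c \<subseteq> {..<p} \<Longrightarrow> l \<le> p \<Longrightarrow> (x i, col j c l) \<in> E \<longleftrightarrow> i \<in> c"
    by metis
  have "inj_on x {..<p}"
  proof (rule inj_onI)
    fix i k assume ik: "i \<in> {..<p}" "k \<in> {..<p}" "x i = x k"
    have "(x i, col 0 {i} 0) \<in> E" using x(2)[of 0 "{i}" 0 i] h ik by simp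
    then show "i = k" using x(2)[of 0 "{i}" 0 k] h ik by simp
  qed
  define S where "S = x ` {..<p}"
  have S: "finite S" "card S = p" "S \<subseteq> V"
    using \<open>inj_on x {..<p}\<close> x(1) XY(1) by (auto simp: S_def card_image)
  have "2 ^ h \<le> card S" using S(2) p h_def by simp
  from transitive_list_in_tournament[OF S(1) this, of E] total S(3)
  obtain us where us: "length us = h" "distinct us" "set us \<subseteq> S" "sorted_wrt (\<lambda>x y. (x, y) \<in> E) us"
    by blast
  have "card A \<le> length us" using cardAB(1) us(1) by simp
  from acyclic_embeds_in_transitive_list[OF finAB(1) AB(3) us(2,4) this]
  obtain \<alpha> where \<alpha>: "inj_on \<alpha> A" "\<alpha> ` A \<subseteq> set us"
    "\<forall>u\<in>A. \<forall>v\<in>A. (u, v) \<in> EH \<longrightarrow> (\<alpha> u, \<alpha> v) \<in> E"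
    by (elim exE conjE)
  from topological_numbering[OF finAB(2) AB(4)] obtain pos :: "'b \<Rightarrow> nat" where
    pos: "inj_on pos B" "pos ` B \<subseteq> {..<card B}"
      "\<forall>u\<in>B. \<forall>v\<in>B. (u, v) \<in> EH \<longrightarrow> pos u < pos v"
    by (elim exE conjE)
  have posh: "pos b < h" if "b \<in> B" for b using pos(2) that cardAB(2) by fastforce
  \<comment> \<open>The column type is fixed only now, after the transitive rows are known; this is
    why every block has to offer all 2 ^ p types.\<close>
  define c where "c b = {i \<in> {..<p}. \<exists>a\<in>A. \<alpha> a = x i \<and> (a, b) \<in> EH}" for b
  have cp: "c b \<subseteq> {..<p}" for b by (auto simp: c_def)
  \<comment> \<open>Pigeonhole: the p + 1 columns of one type in a block are distinct, and there are
    only p rows.\<close>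
  have "\<exists>l\<le>p. col (pos b) (c b) l \<notin> S" if b: "b \<in> B" for b
  proof (rule ccontr)
    assume "\<not> ?thesis"
    then have "col (pos b) (c b) ` {..p} \<subseteq> S" by auto
    moreover have "inj_on (col (pos b) (c b)) {..p}"
    proof (rule inj_onI)
      fix l l' assume l: "l \<in> {..p}" "l' \<in> {..p}" "col (pos b) (c b) l = col (pos b) (c b) l'"
      then have "pos b * M + g0 (c b, l) = pos b * M + g0 (c b, l')"
        using nth_eq_iff_index_eq[OF ys(2)] idx[OF posh[OF b] cp] ys(1) unfolding col_def by auto
      then have "(c b, l) = (c b, l')" using inj_onD[OF g0(1)] l cp by auto
      then show "l = l'" by simp
    qed
    ultimately have "card {..p} \<le> card S" using S(1) by (metis card_image card_mono)
    then show False using S(2) by simp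
  qed
  then obtain l where l: "\<And>b. b \<in> B \<Longrightarrow> l b \<le> p \<and> col (pos b) (c b) (l b) \<notin> S" by metis
  define \<beta> where "\<beta> b = col (pos b) (c b) (l b)" for b
  have \<beta>Y: "\<beta> b \<in> Y" if "b \<in> B" for b unfolding \<beta>_def using colY posh cp l that by blast
  have \<beta>S: "\<beta> b \<notin> S" if "b \<in> B" for b unfolding \<beta>_def using l that by blast
  have \<beta>E: "(\<beta> b, \<beta> b') \<in> E" if b: "b \<in> B" "b' \<in> B" "pos b < pos b'" for b b'
  proof -
    have "g0 (c b, l b) < M" using g0(2) cp l[OF b(1)] by auto
    then have "pos b * M + g0 (c b, l b) < Suc (pos b) * M" by simp
    also have "\<dots> \<le> pos b' * M" using b(3) by (intro mult_right_mono) auto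
    finally have "pos b * M + g0 (c b, l b) < pos b' * M + g0 (c b', l b')" by simp
    then show ?thesis
      using sorted_wrt_nth_less[OF ys(4)] idx[OF posh[OF b(2)] cp] l[OF b(2)] ys(1)
      unfolding \<beta>_def col_def by auto
  qed
  have irrefl: "(v, v) \<notin> E" for v using V(1) by (auto simp: tournament_def oriented_graph_def)
  have \<beta>inj: "inj_on \<beta> B"
  proof (rule inj_onI, rule ccontr)
    fix b b' assume b: "b \<in> B" "b' \<in> B" "\<beta> b = \<beta> b'" "b \<noteq> b'"
    then have "pos b \<noteq> pos b'" using pos(1) by (meson inj_onD)
    then show False using \<beta>E[of b b'] \<beta>E[of b' b] b irrefl by (metis linorder_neqE_nat)
  qed
  have \<alpha>S: "\<alpha> a \<in> S" if "a \<in> A" for a using \<alpha>(2) us(3) that by auto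
  have AtoB: "(\<alpha> a, \<beta> b) \<in> E" if ab: "a \<in> A" "b \<in> B" "(a, b) \<in> EH" for a b
  proof -
    obtain i where i: "i < p" "\<alpha> a = x i" using \<alpha>S[OF ab(1)] by (auto simp: S_def)
    then have "i \<in> c b" using ab by (auto simp: c_def)
    then show ?thesis
      using x(2)[OF posh[OF ab(2)] cp, of "l b" i b] l[OF ab(2)] unfolding \<beta>_def i(2) by simp
  qed
  have BtoA: "(\<beta> b, \<alpha> a) \<in> E" if ab: "a \<in> A" "b \<in> B" "(b, a) \<in> EH" for a b
  proof -
    obtain i where i: "i < p" "\<alpha> a = x i" using \<alpha>S[OF ab(1)] by (auto simp: S_def)
    have "i \<notin> c b"
    proof
      assume "i \<in> c b"
      then obtain a' where "a' \<in> A" "\<alpha> a' = x i" "(a', b) \<in> EH" by (auto simp: c_def)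
      then have "(a, b) \<in> EH" using inj_onD[OF \<alpha>(1)] i(2) ab(1) by metis
      then show False using H(3) ab(3) by (auto simp: oriented_graph_def)
    qed
    \<comment> \<open>A missing arc means the reverse arc only between distinct vertices, hence the
      care taken to choose columns outside \<open>S\<close>.\<close>
    then have "(\<alpha> a, \<beta> b) \<notin> E"
      using x(2)[OF posh[OF ab(2)] cp, of "l b" i b] l[OF ab(2)] unfolding \<beta>_def i(2) by simp
    moreover have "\<alpha> a \<noteq> \<beta> b" using \<alpha>S \<beta>S ab by metis
    ultimately show ?thesis using total[of "\<alpha> a" "\<beta> b"] \<alpha>S \<beta>Y ab S(3) XY(2) by blast
  qed
  define \<phi> where "\<phi> = restrict (\<lambda>v. if v \<in> A then \<alpha> v else \<beta> v) VH"
  have \<phi>A: "\<phi> a = \<alpha> a" if "a \<in> A" for a using that AB(1) by (auto simp: \<phi>_def)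
  have \<phi>B: "\<phi> b = \<beta> b" if "b \<in> B" for b using that AB(1,2) by (auto simp: \<phi>_def)
  have range: "\<phi> ` VH \<subseteq> X \<union> Y"
  proof
    fix w assume "w \<in> \<phi> ` VH"
    then obtain v where v: "v \<in> VH" "w = \<phi> v" by blast
    show "w \<in> X \<union> Y"
    proof (cases "v \<in> A")
      case True
      then show ?thesis using \<phi>A \<alpha>S[of v] x(1) v by (auto simp: S_def)
    next
      case False
      then have "v \<in> B" using v(1) AB(1) by blast
      then show ?thesis using \<phi>B \<beta>Y v by simp
    qed
  qed
  have "inj_on \<phi> VH"
  proof (rule inj_onI)
    fix u v assume uv: "u \<in> VH" "v \<in> VH" "\<phi> u = \<phi> v"
    consider "u \<in> A" "v \<in> A" | "u \<in> B" "v \<in> B" | "u \<in> A" "v \<in> B" | "u \<in> B" "v \<in> A"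
      using uv AB(1) by blast
    then show "u = v"
    proof cases
      case 1
      then show ?thesis using uv(3) \<phi>A inj_onD[OF \<alpha>(1)] by simp
    next
      case 2
      then show ?thesis using uv(3) \<phi>B inj_onD[OF \<beta>inj] by simp
    next
      case 3
      then show ?thesis using uv(3) \<phi>A[of u] \<phi>B[of v] \<alpha>S[of u] \<beta>S[of v] by simp
    next
      case 4
      then show ?thesis using uv(3) \<phi>A[of v] \<phi>B[of u] \<alpha>S[of v] \<beta>S[of u] by simp
    qed
  qed
  moreover have "(\<phi> u, \<phi> v) \<in> E" if uv: "u \<in> VH" "v \<in> VH" "(u, v) \<in> EH" for u v
  proof -
    consider "u \<in> A" "v \<in> A" | "u \<in> B" "v \<in> B" | "u \<in> A" "v \<in> B" | "u \<in> B" "v \<in> A"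
      using uv AB(1) by blast
    then show ?thesis
      using uv(3) \<phi>A \<phi>B \<alpha>(3) \<beta>E pos(3) AtoB BtoA by cases simp_all
  qed
  moreover have "\<phi> \<in> VH \<rightarrow>\<^sub>E V"
  proof -
    have "\<phi> ` VH \<subseteq> V" using range XY by blast
    moreover have "\<phi> \<in> extensional VH" by (simp add: \<phi>_def)
    ultimately show ?thesis by (auto simp: PiE_def)
  qed
  ultimately have "\<phi> \<in> embeddings V E VH EH" unfolding embeddings_def by blast
  then show ?thesis using range by blast
qed

section \<open>Clusterings by neighbourhoods\<close>

definition nbhd_dist :: "('a \<times> 'a) set \<Rightarrow> 'a \<Rightarrow> 'a \<Rightarrow> nat" where
  "nbhd_dist E u v = card ((E `` {u} - E `` {v}) \<union> (E `` {v} - E `` {u}))"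

text \<open>The clusters are the fibers of \<open>c\<close> on \<open>C\<close>, and
  \<open>V - C\<close> is exceptional. The lower bound on their sizes limits their number and makes
  a random member of a cluster behave like a random vertex up to a factor 1 / \<gamma>. Labels are
  vertices because a cluster is labelled by its center.\<close>

definition clustering ::
  "'a set \<Rightarrow> ('a \<times> 'a) set \<Rightarrow> real \<Rightarrow> real \<Rightarrow> 'a set \<Rightarrow> ('a \<Rightarrow> 'a) \<Rightarrow> bool" where
  "clustering V E \<delta> \<gamma> C c \<longleftrightarrow> C \<subseteq> V \<and> real (card (V - C)) \<le> \<delta> * real (card V) \<and>
     (\<forall>v\<in>C. \<gamma> * real (card V) \<le> real (card {u \<in> C. c u = c v})) \<and>
     (\<forall>u\<in>C. \<forall>v\<in>C. c u = c v \<longrightarrow> real (nbhd_dist E u v) \<le> \<delta> * real (card V))"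

lemma clustering_mono: "clustering V E \<delta> \<gamma> C c \<Longrightarrow> \<gamma>' \<le> \<gamma> \<Longrightarrow> clustering V E \<delta> \<gamma>' C c"
  unfolding clustering_def by (meson mult_right_mono of_nat_0_le_iff order_trans)

lemma nbhd_dist_self [simp]: "nbhd_dist E u u = 0"
  by (simp add: nbhd_dist_def)

lemma nbhd_dist_sym: "nbhd_dist E u v = nbhd_dist E v u"
  by (simp add: nbhd_dist_def Un_commute)

lemma nbhd_dist_triangle:
  assumes "finite V" "E \<subseteq> V \<times> V"
  shows "nbhd_dist E u v \<le> nbhd_dist E u x + nbhd_dist E x v"
proof -
  let ?D = "\<lambda>u v. (E `` {u} - E `` {v}) \<union> (E `` {v} - E `` {u})"
  have fin: "finite (?D u v)" for u v
    using assms by (auto intro!: finite_subset[of _ V])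
  have "?D u v \<subseteq> ?D u x \<union> ?D x v" by blast
  then have "card (?D u v) \<le> card (?D u x \<union> ?D x v)" using fin by (intro card_mono) blast+
  also have "\<dots> \<le> card (?D u x) + card (?D x v)" by (rule card_Un_le)
  finally show ?thesis unfolding nbhd_dist_def .
qed

text \<open>Assign each vertex within \<delta> / 2 of the net to a nearby center; the triangle
  inequality through the center gives diameter \<delta>. Discarding the clusters below \<delta> / (2
  r), of which there are fewer than r, loses at most another \<delta> / 2 of the vertices.\<close>

lemma clustering_of_net:
  assumes V: "finite V" "E \<subseteq> V \<times> V" and X: "X \<subseteq> V" "card X < r" and "0 < \<delta>"
    and net: "real (card {v \<in> V. \<forall>x\<in>X. \<delta> / 2 * real (card V) \<le> real (nbhd_dist E x v)})
      \<le> \<delta> / 2 * real (card V)"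
  shows "\<exists>C c. clustering V E \<delta> (\<delta> / (2 * real r)) C c"
proof -
  define n where "n = real (card V)"
  define F where "F = {v \<in> V. \<forall>x\<in>X. \<delta> / 2 * n \<le> real (nbhd_dist E x v)}"
  define C0 where "C0 = V - F"
  have "\<forall>v\<in>C0. \<exists>x. x \<in> X \<and> real (nbhd_dist E x v) < \<delta> / 2 * n"
    by (auto simp: C0_def F_def not_le)
  from bchoice[OF this] obtain c
    where c: "\<forall>v\<in>C0. c v \<in> X \<and> real (nbhd_dist E (c v) v) < \<delta> / 2 * n" ..
  define \<gamma> where "\<gamma> = \<delta> / (2 * real r)"
  define C where "C = {v \<in> C0. \<gamma> * n \<le> real (card {u \<in> C0. c u = c v})}"
  have finC0: "finite C0" using V(1) by (simp add: C0_def)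
  have finX: "finite X" using X(1) V(1) finite_subset by blast
  have r: "r > 0" using X(2) by simp
  have \<gamma>: "0 \<le> \<gamma>" "real r * \<gamma> = \<delta> / 2" using \<open>0 < \<delta>\<close> r by (auto simp: \<gamma>_def)
  have n0: "0 \<le> n" by (simp add: n_def)
  have "real (card (C0 - C)) \<le> (\<Sum>x\<in>X. real (card {u \<in> C0 - C. c u = x}))"
  proof -
    have "C0 - C \<subseteq> (\<Union>x\<in>X. {u \<in> C0 - C. c u = x})" using c by auto
    then have "card (C0 - C) \<le> card (\<Union>x\<in>X. {u \<in> C0 - C. c u = x})"
      using finX finC0 by (intro card_mono finite_UN_I) auto
    also have "\<dots> \<le> (\<Sum>x\<in>X. card {u \<in> C0 - C. c u = x})" by (rule card_UN_le[OF finX])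
    finally show ?thesis by (metis of_nat_mono of_nat_sum)
  qed
  also have "\<dots> \<le> (\<Sum>x\<in>X. \<gamma> * n)"
  proof (rule sum_mono)
    fix x
    show "real (card {u \<in> C0 - C. c u = x}) \<le> \<gamma> * n"
    proof (cases "{u \<in> C0 - C. c u = x} = {}")
      case True
      then show ?thesis using \<gamma>(1) n0 by (simp only: card.empty) simp
    next
      case False
      then obtain v where v: "v \<in> C0" "v \<notin> C" "c v = x" by blast
      have "card {u \<in> C0 - C. c u = x} \<le> card {u \<in> C0. c u = c v}"
        using finC0 v by (intro card_mono) auto
      moreover have "real (card {u \<in> C0. c u = c v}) < \<gamma> * n" using v by (auto simp: C_def)
      ultimately show ?thesis by linarith
    qed
  qed
  also have "\<dots> = real (card X) * (\<gamma> * n)" by simp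
  also have "\<dots> \<le> real r * (\<gamma> * n)" using X(2) \<gamma>(1) n0 by (intro mult_right_mono) auto
  also have "\<dots> = \<delta> / 2 * n" using \<gamma>(2) by (metis mult.assoc)
  finally have small: "real (card (C0 - C)) \<le> \<delta> / 2 * n" .
  have "card (V - C) \<le> card F + card (C0 - C)"
  proof -
    have "V - C \<subseteq> F \<union> (C0 - C)" by (auto simp: C0_def)
    moreover have "finite F" using V(1) by (simp add: F_def)
    ultimately have "card (V - C) \<le> card (F \<union> (C0 - C))" using finC0 by (intro card_mono) auto
    also have "\<dots> \<le> card F + card (C0 - C)" by (rule card_Un_le)
    finally show ?thesis .
  qed
  moreover have "real (card F) \<le> \<delta> / 2 * n" using net unfolding F_def n_def .
  ultimately have rest: "real (card (V - C)) \<le> \<delta> * n" using small by (simp add: field_simps)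
  have fibers: "\<gamma> * n \<le> real (card {u \<in> C. c u = c v})" if "v \<in> C" for v
  proof -
    \<comment> \<open>Only whole clusters were discarded, so the surviving ones keep their
      size.\<close>
    have "{u \<in> C. c u = c v} = {u \<in> C0. c u = c v}" using that by (auto simp: C_def)
    then show ?thesis using that by (simp add: C_def)
  qed
  have close: "real (nbhd_dist E u v) \<le> \<delta> * n" if uv: "u \<in> C" "v \<in> C" "c u = c v" for u v
  proof -
    have "nbhd_dist E u v \<le> nbhd_dist E (c u) u + nbhd_dist E (c u) v"
      using nbhd_dist_triangle[OF V, of u v "c u"] by (simp add: nbhd_dist_sym)
    moreover have "real (nbhd_dist E (c u) u) < \<delta> / 2 * n" "real (nbhd_dist E (c u) v) < \<delta> / 2 * n"
      using c uv by (auto simp: C_def)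
    ultimately show ?thesis by (simp add: field_simps)
  qed
  have "C \<subseteq> V" by (auto simp: C_def C0_def)
  then have "clustering V E \<delta> \<gamma> C c"
    using rest fibers close unfolding clustering_def n_def by blast
  then show ?thesis unfolding \<gamma>_def by blast
qed

text \<open>Without a clustering there is no net of fewer than r vertices, so at least 3/4 of the
  lists of length r L contain r pairwise far vertices; given these, at least 3/4 of the lists of
  length m tell them apart. This gives r distinct traces on at most m vertices, and r > (m + 1) ^ K
  yields a shattered set of size \<open>K\<close>, which is the size that
  \<open>embedding_of_shattered\<close> asks for.\<close>

lemma clustering_or_many_embeddings:
  assumes V: "tournament V E" "finite V" "V \<noteq> {}" and H: "finite VH" "VH \<noteq> {}"
      "oriented_graph VH EH" "two_colorable VH EH"
    and K: "K = 2 ^ (card VH * (2 ^ 2 ^ card VH * (2 ^ card VH + 1)))"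
    and \<delta>: "0 < \<delta>" "\<delta> \<le> 1"
    and r: "(m + 1) ^ K < r" "real r ^ 2 * (1 - \<delta> / 2) ^ m \<le> 1 / 4" "real r * (1 - \<delta> / 2) ^ L \<le> 1 / 4"
  shows "(\<exists>C c. clustering V E \<delta> (\<delta> / (2 * real r)) C c) \<or>
    real (card V) ^ card VH \<le> 2 * real (r * L + m) ^ card VH * real (card (embeddings V E VH EH))"
proof (rule disjCI)
  assume no: "\<not> real (card V) ^ card VH
      \<le> 2 * real (r * L + m) ^ card VH * real (card (embeddings V E VH EH))"
  show "\<exists>C c. clustering V E \<delta> (\<delta> / (2 * real r)) C c"
  proof (rule ccontr)
    assume nocl: "\<not> ?thesis"
    have EV: "E \<subseteq> V \<times> V" using V(1) by (auto simp: tournament_def oriented_graph_def)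
    define n where "n = real (card V)"
    have n: "n > 0" using V(2,3) by (simp add: n_def card_gt_0_iff)
    define far where "far x v \<longleftrightarrow> \<delta> / 2 * n \<le> real (nbhd_dist E x v)" for x v
    have far_sym: "far y x" if "far x y" for x y using that unfolding far_def by (simp add: nbhd_dist_sym)
    have far_irrefl: "\<not> far x x" for x using n \<delta> unfolding far_def by (simp add: not_le)
    \<comment> \<open>A set violating this would be a net, and \<open>clustering_of_net\<close>
      would produce the excluded clustering.\<close>
    have large: "\<delta> / 2 * real (card V) \<le> real (card {v \<in> V. \<forall>x\<in>X. far x v})"
      if "X \<subseteq> V" "card X < r" for X
    proof (rule ccontr)
      assume "\<not> ?thesis"
      then have "real (card {v \<in> V. \<forall>x\<in>X. \<delta> / 2 * real (card V) \<le> real (nbhd_dist E x v)})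
          \<le> \<delta> / 2 * real (card V)"
        unfolding far_def n_def by linarith
      then show False using clustering_of_net[OF V(2) EV that \<delta>(1)] nocl by blast
    qed
    define A where "A = {xs \<in> lists_over V (r * L). \<exists>X\<subseteq>set xs. card X = r \<and> pairwise_far far X}"
    have "(1 - real r * (1 - \<delta> / 2) ^ L) * n ^ (r * L) \<le> real (card A)"
      unfolding n_def A_def
      by (rule card_lists_with_separated_set[OF V(2) far_irrefl far_sym _ _ large order_refl])
        (use \<delta> in auto)
    moreover have "3 / 4 * n ^ (r * L) \<le> (1 - real r * (1 - \<delta> / 2) ^ L) * n ^ (r * L)"
      using r(3) n by (intro mult_right_mono) auto
    ultimately have cardA: "3 / 4 * n ^ (r * L) \<le> real (card A)" by linarith
    have "\<forall>xs\<in>A. \<exists>X. X \<subseteq> set xs \<and> card X = r \<and> pairwise_far far X"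
      unfolding A_def by blast
    from bchoice[OF this] obtain X
      where X: "\<forall>xs\<in>A. X xs \<subseteq> set xs \<and> card (X xs) = r \<and> pairwise_far far (X xs)" ..
    define D where "D x y = (E `` {x} - E `` {y}) \<union> (E `` {y} - E `` {x})" for x y
    define B where "B xs = {ys \<in> lists_over V m. \<forall>x\<in>X xs. \<forall>y\<in>X xs. x \<noteq> y \<longrightarrow> set ys \<inter> D x y \<noteq> {}}" for xs
    define Z where "Z = {zs \<in> lists_over V (r * L + m). \<exists>\<phi>\<in>embeddings V E VH EH. \<phi> ` VH \<subseteq> set zs}"
    have XV: "X xs \<subseteq> V" if "xs \<in> A" for xs
      using X[rule_format, OF that] that by (auto simp: A_def lists_over_def)
    have cardB: "3 / 4 * n ^ m \<le> real (card (B xs))" if xs: "xs \<in> A" for xs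
    proof -
      have finX: "finite (X xs)" using XV[OF xs] V(2) finite_subset by blast
      have "(1 - real (card (X xs)) ^ 2 * (1 - \<delta> / 2) ^ m) * real (card V) ^ m \<le> real (card (B xs))"
        unfolding B_def
      proof (rule card_lists_distinguishing[OF V(2) finX])
        fix x y assume xy: "x \<in> X xs" "y \<in> X xs" "x \<noteq> y"
        then have "far x y" using X[rule_format, OF xs] unfolding pairwise_far_def by blast
        then show "D x y \<subseteq> V \<and> \<delta> / 2 * real (card V) \<le> real (card (D x y))"
          using EV unfolding far_def n_def D_def nbhd_dist_def by auto
      qed (use \<delta> in auto)
      moreover have "3 / 4 * n ^ m \<le> (1 - real r ^ 2 * (1 - \<delta> / 2) ^ m) * n ^ m"
        using r(2) n by (intro mult_right_mono) auto
      ultimately show ?thesis using X[rule_format, OF xs] unfolding n_def by simp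
    qed
    have AB_Z: "xs @ ys \<in> Z" if xs: "xs \<in> A" and ys: "ys \<in> B xs" for xs ys
    proof -
      let ?F = "(\<lambda>x. E `` {x} \<inter> set ys) ` X xs"
      have "inj_on (\<lambda>x. E `` {x} \<inter> set ys) (X xs)"
      proof (rule inj_onI, rule ccontr)
        fix x y assume xy: "x \<in> X xs" "y \<in> X xs" "E `` {x} \<inter> set ys = E `` {y} \<inter> set ys" "x \<noteq> y"
        then have "set ys \<inter> D x y \<noteq> {}" using ys by (auto simp: B_def)
        then show False using xy(3) unfolding D_def by blast
      qed
      then have "card ?F = r" using X[rule_format, OF xs] by (simp add: card_image)
      moreover have "length ys = m" "set ys \<subseteq> V" using ys by (auto simp: B_def lists_over_def)
      moreover have "(card (set ys) + 1) ^ K \<le> (m + 1) ^ K"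
        using card_length[of ys] \<open>length ys = m\<close> by (intro power_mono) auto
      ultimately have "(card (set ys) + 1) ^ K < card ?F" using r(1) by linarith
      from sauer_shelah[OF _ _ this] obtain Y where Y: "Y \<subseteq> set ys" "card Y = K" "shatters ?F Y" by auto
      have "\<exists>x\<in>X xs. E `` {x} \<inter> Y = T" if T: "T \<subseteq> Y" for T
      proof -
        obtain A where "A \<in> ?F" "A \<inter> Y = T" using shattersE[OF Y(3) T] by metis
        moreover have "E `` {x} \<inter> set ys \<inter> Y = E `` {x} \<inter> Y" for x using Y(1) by blast
        ultimately show ?thesis by auto
      qed
      moreover have "Y \<subseteq> V" using Y(1) \<open>set ys \<subseteq> V\<close> by blast
      ultimately obtain \<phi> where "\<phi> \<in> embeddings V E VH EH" "\<phi> ` VH \<subseteq> X xs \<union> Y"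
        using embedding_of_shattered[OF V(1,2) H refl refl XV[OF xs], of Y] Y(2) K by auto
      moreover have "X xs \<union> Y \<subseteq> set (xs @ ys)" using X[rule_format, OF xs] Y(1) by auto
      moreover have "xs @ ys \<in> lists_over V (r * L + m)"
        using xs ys by (auto simp: A_def B_def lists_over_def)
      ultimately show ?thesis unfolding Z_def by blast
    qed
    have "real (card A) * (3 / 4 * n ^ m) \<le> real (card Z)"
      by (rule card_append_lists[OF V(2), of A "r * L" B m])
        (use cardB AB_Z in \<open>auto simp: A_def B_def Z_def\<close>)
    moreover have "3 / 4 * n ^ (r * L) * (3 / 4 * n ^ m) \<le> real (card A) * (3 / 4 * n ^ m)"
      using cardA n by (intro mult_right_mono) auto
    \<comment> \<open>Both samples succeed with probability at least 9/16, rounded down to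
      1/2.\<close>
    moreover have "1 / 2 * n ^ (r * L + m) \<le> 3 / 4 * n ^ (r * L) * (3 / 4 * n ^ m)"
      using n by (simp add: power_add)
    ultimately have Zlow: "1 / 2 * n ^ (r * L + m) \<le> real (card Z)" by linarith
    have "card Z * card V ^ card VH
        \<le> card (embeddings V E VH EH) * ((r * L + m) ^ card VH * card V ^ (r * L + m))"
      by (rule card_lists_with_embedding[OF V(2) H(1)]) (auto simp: Z_def)
    then have "real (card Z * card V ^ card VH)
        \<le> real (card (embeddings V E VH EH) * ((r * L + m) ^ card VH * card V ^ (r * L + m)))"
      by (rule of_nat_mono)
    then have "real (card Z) * n ^ card VH
        \<le> real (card (embeddings V E VH EH)) * (real (r * L + m) ^ card VH * n ^ (r * L + m))"
      unfolding n_def by simp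
    moreover have "1 / 2 * n ^ (r * L + m) * n ^ card VH \<le> real (card Z) * n ^ card VH"
      using Zlow n by (intro mult_right_mono) auto
    ultimately have "n ^ (r * L + m) * n ^ card VH \<le> n ^ (r * L + m) *
        (2 * real (r * L + m) ^ card VH * real (card (embeddings V E VH EH)))"
      by (simp add: algebra_simps)
    then have "n ^ card VH \<le> 2 * real (r * L + m) ^ card VH * real (card (embeddings V E VH EH))"
      using n by (simp only: mult_le_cancel_left_pos zero_less_power)
    then show False using no unfolding n_def by blast
  qed
qed

section \<open>Polynomial bounds for the sample sizes\<close>

text \<open>With t = \<eta> m, the first factor is at most exp (- t), and t / k \<le> exp (t / k)
  bounds the second by exp t. It turns exponential decay into decay of any polynomial order k and so
  keeps logarithms out of the choice of parameters.\<close>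

lemma power_one_minus_le:
  fixes \<eta> :: real
  assumes "0 < \<eta>" "\<eta> \<le> 1" "0 < k"
  shows "(1 - \<eta>) ^ m * (\<eta> * real m / real k) ^ k \<le> 1"
proof -
  have "(1 - \<eta>) ^ m \<le> exp (- \<eta>) ^ m"
    using assms exp_ge_add_one_self[of "- \<eta>"] by (intro power_mono) auto
  also have "\<dots> = exp (- (\<eta> * real m))" by (simp flip: exp_of_nat_mult add: mult.commute)
  finally have 1: "(1 - \<eta>) ^ m \<le> exp (- (\<eta> * real m))" .
  have "(\<eta> * real m / real k) ^ k \<le> exp (\<eta> * real m / real k) ^ k"
    using assms order_trans[OF _ exp_ge_add_one_self[of "\<eta> * real m / real k"]]
    by (intro power_mono) auto
  also have "\<dots> = exp (\<eta> * real m)" using assms(3) by (simp flip: exp_of_nat_mult)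
  finally have "(1 - \<eta>) ^ m * (\<eta> * real m / real k) ^ k \<le> exp (- (\<eta> * real m)) * exp (\<eta> * real m)"
    using 1 assms by (intro mult_mono) auto
  then show ?thesis by (simp flip: exp_add)
qed

text \<open>The conditions look circular: \<open>r\<close> must exceed (m + 1) ^ K, while
  \<open>m\<close> must be large enough to separate \<open>r\<close> vertices. They are compatible
  because (1 - \<delta> / 2) ^ m beats every fixed power of m once m is a large multiple of 1 /
  \<delta> ^ 2.\<close>

lemma sampling_parameters:
  fixes \<delta> :: real
  assumes "0 < K" "0 < \<delta>" "\<delta> \<le> 1"
  defines "C \<equiv> 2 * (2048 * real K ^ 2) ^ K"
  shows "\<exists>m r L. (m + 1) ^ K < r \<and> real r ^ 2 * (1 - \<delta> / 2) ^ m \<le> 1 / 4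
    \<and> real r * (1 - \<delta> / 2) ^ L \<le> 1 / 4
    \<and> real r \<le> C / \<delta> ^ (2 * K) \<and> real (r * L + m) \<le> 11 * C ^ 2 / \<delta> ^ (4 * K + 1)"
proof -
  define \<eta> where "\<eta> = \<delta> / 2"
  have \<eta>: "0 < \<eta>" "\<eta> \<le> 1" using assms by (auto simp: \<eta>_def)
  \<comment> \<open>Decay of order 4 K is used. \<eta> ^ 2 m \<ge> 128 K ^ 2 is the condition for
    (\<eta> m / (4 K)) ^ 2 \<ge> 8 m, and (8 m) ^ (2 K) dominates 4 r ^ 2. The 2048 in
    \<open>C\<close> is 16 * 128, from 2 m \<le> 4 A / \<eta> ^ 2 and \<eta> = \<delta> / 2.\<close>
  define A where "A = 128 * real K ^ 2"
  have "1 \<le> real K ^ 2" using assms(1) by (intro one_le_power) simp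
  then have A: "A \<ge> 1" unfolding A_def by linarith
  define m where "m = nat \<lceil>A / \<eta> ^ 2\<rceil>"
  have "\<eta> ^ 2 \<le> 1" using \<eta> by (intro power_le_one) auto
  then have "A / \<eta> ^ 2 \<ge> 1" using A \<eta> by (simp add: field_simps)
  then have m: "A / \<eta> ^ 2 \<le> real m" "real m \<le> 2 * A / \<eta> ^ 2" unfolding m_def by linarith+
  have m1: "real m \<ge> 1" using m(1) \<open>A / \<eta> ^ 2 \<ge> 1\<close> by linarith
  define r where "r = (m + 1) ^ K + 1"
  have r1: "real r \<ge> 1" by (simp add: r_def)
  have r2: "real r \<le> 2 * (2 * real m) ^ K"
  proof -
    have "1 \<le> real (m + 1) ^ K" by (intro one_le_power) simp
    then have "real r \<le> 2 * real (m + 1) ^ K" by (simp add: r_def)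
    also have "\<dots> \<le> 2 * (2 * real m) ^ K" using m1 by (intro mult_left_mono power_mono) auto
    finally show ?thesis .
  qed
  \<comment> \<open>Decay of order 1 is enough here: (1 - \<eta>) ^ L \<le> 1 / (\<eta> L) \<le> 1 /
    (4 r).\<close>
  define L where "L = nat \<lceil>4 * real r / \<eta>\<rceil>"
  have "1 \<le> real r / \<eta>" using r1 \<eta> by (simp add: field_simps)
  then have L: "4 * real r / \<eta> \<le> real L" "real L \<le> 5 * (real r / \<eta>)"
    unfolding L_def times_divide_eq_right[symmetric] by linarith+
  have "real r * (1 - \<eta>) ^ L \<le> 1 / 4"
  proof -
    have "(1 - \<eta>) ^ L * (\<eta> * real L) \<le> 1" using power_one_minus_le[OF \<eta>, of 1 L] by simp
    moreover have "4 * real r \<le> \<eta> * real L" using L(1) \<eta> by (simp add: field_simps)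
    then have "(1 - \<eta>) ^ L * (4 * real r) \<le> (1 - \<eta>) ^ L * (\<eta> * real L)"
      using \<eta> by (intro mult_left_mono) auto
    ultimately show ?thesis by (simp add: algebra_simps)
  qed
  moreover have "real r ^ 2 * (1 - \<eta>) ^ m \<le> 1 / 4"
  proof -
    have "(1 - \<eta>) ^ m * (\<eta> * real m / real (4 * K)) ^ (4 * K) \<le> 1"
      using power_one_minus_le[OF \<eta>, of "4 * K" m] assms(1) by simp
    moreover have "(8 * real m) ^ (2 * K) \<le> (\<eta> * real m / real (4 * K)) ^ (4 * K)"
    proof -
      have "A \<le> \<eta> ^ 2 * real m" using m(1) \<eta> by (simp add: field_simps)
      then have "A * real m \<le> \<eta> ^ 2 * real m * real m" by (rule mult_right_mono) simp
      then have "8 * real m \<le> (\<eta> * real m / real (4 * K)) ^ 2"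
        using assms(1) by (simp add: A_def field_simps power2_eq_square)
      then have "(8 * real m) ^ (2 * K) \<le> ((\<eta> * real m / real (4 * K)) ^ 2) ^ (2 * K)"
        by (rule power_mono) simp
      then show ?thesis by (simp flip: power_mult)
    qed
    ultimately have "(1 - \<eta>) ^ m * (8 * real m) ^ (2 * K) \<le> 1"
      using \<eta> by (meson diff_ge_0_iff_ge mult_left_mono order_trans zero_le_power)
    moreover have "4 * real r ^ 2 \<le> (8 * real m) ^ (2 * K)"
    proof -
      have "real r ^ 2 \<le> (2 * (2 * real m) ^ K) ^ 2" using r2 by (rule power_mono) simp
      also have "\<dots> = 4 * (2 * real m) ^ (2 * K)" 
        by (simp only: power_mult_distrib[of 2 "_ ^ K"] power_even_eq) simp
      finally have "4 * real r ^ 2 \<le> 4 ^ 2 * (2 * real m) ^ (2 * K)" by (simp add: mult.commute)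
      also have "\<dots> \<le> 4 ^ (2 * K) * (2 * real m) ^ (2 * K)"
        using assms(1) by (intro mult_right_mono power_increasing) auto
      also have "\<dots> = (4 * (2 * real m)) ^ (2 * K)" by (simp only: power_mult_distrib)
      also have "4 * (2 * real m) = 8 * real m" by simp
      finally show ?thesis .
    qed
    then have "(1 - \<eta>) ^ m * (4 * real r ^ 2) \<le> (1 - \<eta>) ^ m * (8 * real m) ^ (2 * K)"
      using \<eta> by (intro mult_left_mono) auto
    ultimately show ?thesis by (simp add: algebra_simps)
  qed
  moreover have rC: "real r \<le> C / \<delta> ^ (2 * K)"
  proof -
    have "2 * real m \<le> 2048 * real K ^ 2 / \<delta> ^ 2" using m(2) by (simp add: A_def \<eta>_def power_divide)
    then have "(2 * real m) ^ K \<le> (2048 * real K ^ 2 / \<delta> ^ 2) ^ K" by (rule power_mono) simp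
    then show ?thesis using r2 by (simp add: C_def power_divide flip: power_mult)
  qed
  moreover have "real (r * L + m) \<le> 11 * C ^ 2 / \<delta> ^ (4 * K + 1)"
  proof -
    have "real m \<le> real r"
    proof -
      have "(m + 1) ^ 1 \<le> (m + 1) ^ K" using assms(1) by (intro power_increasing) auto
      then have "m \<le> r" by (simp add: r_def)
      then show ?thesis by simp
    qed
    also have "real r * 1 \<le> real r * (real r / \<delta>)"
      using r1 assms by (intro mult_left_mono) (auto simp: field_simps)
    finally have "real m \<le> real r ^ 2 / \<delta>" by (simp add: power2_eq_square)
    moreover have "real r * real L \<le> real r * (5 * (real r / \<eta>))" using L(2) by (rule mult_left_mono) simp
    then have "real r * real L \<le> 10 * real r ^ 2 / \<delta>" by (simp add: \<eta>_def power2_eq_square algebra_simps)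
    ultimately have "real (r * L + m) \<le> 11 * real r ^ 2 / \<delta>" by simp
    also have "\<dots> \<le> 11 * (C / \<delta> ^ (2 * K)) ^ 2 / \<delta>"
      using rC r1 assms by (intro divide_right_mono mult_left_mono power_mono) auto
    also have "\<dots> = 11 * C ^ 2 / \<delta> ^ (4 * K + 1)"
      by (simp add: power_divide flip: power_mult)
    finally show ?thesis .
  qed
  moreover have "(m + 1) ^ K < r" by (simp add: r_def)
  ultimately show ?thesis unfolding \<eta>_def by blast
qed

text \<open>The same bound c \<delta> ^ e serves as cluster size and as density of embeddings, and
  \<open>c\<close> and \<open>e\<close> are chosen before the graph, so they depend on h
  alone.\<close>

lemma clustering_or_many_embeddings_poly:
  assumes "0 < h"
  shows "\<exists>c e. 0 < c \<and> c \<le> 1 \<and> (\<forall>(V :: 'a set) E (VH :: 'b set) EH \<delta>.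
    tournament V E \<and> finite V \<and> V \<noteq> {} \<and> finite VH \<and> card VH = h \<and>
    oriented_graph VH EH \<and> two_colorable VH EH \<and> 0 < \<delta> \<and> \<delta> \<le> 1 \<longrightarrow>
    (\<exists>C cl. clustering V E \<delta> (c * \<delta> ^ e) C cl) \<or>
    c * \<delta> ^ e * real (card V) ^ h \<le> real (card (embeddings V E VH EH)))"
proof -
  define K :: nat where "K = 2 ^ (h * (2 ^ 2 ^ h * (2 ^ h + 1)))"
  have K: "K > 0" by (simp add: K_def)
  define C where "C = 2 * (2048 * real K ^ 2) ^ K"
  have "1 \<le> real K ^ 2" using K by (intro one_le_power) simp
  then have "1 \<le> (2048 * real K ^ 2) ^ K" by (intro one_le_power) linarith
  then have C: "C \<ge> 1" by (simp add: C_def)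
  \<comment> \<open>The density of embeddings dictates the exponent: it involves the h-th power of
    the total sample size, which is at most 11 C ^ 2 / \<delta> ^ (4 K + 1). The cluster size
    \<delta> / (2 r) would be content with 2 K + 1.\<close>
  define e where "e = (4 * K + 1) * h"
  define c where "c = 1 / (2 * (11 * C ^ 2) ^ h)"
  have C2: "C \<le> (11 * C ^ 2) ^ h"
  proof -
    have "C * 1 \<le> C * (11 * C)" using C by (intro mult_left_mono) auto
    then have "C \<le> 11 * C ^ 2" by (simp add: power2_eq_square)
    also have "\<dots> \<le> (11 * C ^ 2) ^ h" using C assms \<open>C \<le> 11 * C ^ 2\<close> by (intro self_le_power) auto
    finally show ?thesis .
  qed
  have c: "0 < c" "c \<le> 1" "c \<le> 1 / (2 * C)"
    using C C2 by (auto simp: c_def field_simps)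
  have "(\<exists>D cl. clustering V E \<delta> (c * \<delta> ^ e) D cl) \<or>
      c * \<delta> ^ e * real (card V) ^ h \<le> real (card (embeddings V E VH EH))"
    if V: "tournament V E" "finite V" "V \<noteq> {}" and H: "finite VH" "card VH = h"
      "oriented_graph VH EH" "two_colorable VH EH" and \<delta>: "0 < \<delta>" "\<delta> \<le> 1"
    for V :: "'a set" and E and VH :: "'b set" and EH \<delta>
  proof -
    obtain m r L where mrL: "(m + 1) ^ K < r" "real r ^ 2 * (1 - \<delta> / 2) ^ m \<le> 1 / 4"
      "real r * (1 - \<delta> / 2) ^ L \<le> 1 / 4"
      "real r \<le> C / \<delta> ^ (2 * K)" "real (r * L + m) \<le> 11 * C ^ 2 / \<delta> ^ (4 * K + 1)"
      using sampling_parameters[OF K \<delta>] unfolding C_def by (elim exE conjE)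
    have VH: "VH \<noteq> {}" using H(2) assms by auto
    have r: "real r > 0" using mrL(1) by linarith
    have "c * \<delta> ^ e \<le> \<delta> / (2 * real r)"
    proof -
      have "2 * K + 1 \<le> (4 * K + 1) * 1" by simp
      also have "\<dots> \<le> e" unfolding e_def using assms by (intro mult_left_mono) auto
      finally have "c * \<delta> ^ e \<le> 1 / (2 * C) * \<delta> ^ (2 * K + 1)"
        using c C \<delta> by (intro mult_mono power_decreasing) auto
      also have "\<dots> = \<delta> / (2 * (C / \<delta> ^ (2 * K)))" using \<delta> by (simp add: field_simps)
      also have "\<dots> \<le> \<delta> / (2 * real r)" using mrL(4) r \<delta> C by (intro divide_left_mono) auto
      finally show ?thesis .
    qed
    moreover have "c * \<delta> ^ e * real (card V) ^ h \<le> real (card (embeddings V E VH EH))"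
      if *: "real (card V) ^ h \<le> 2 * real (r * L + m) ^ h * real (card (embeddings V E VH EH))"
    proof -
      have "real (r * L + m) ^ h \<le> (11 * C ^ 2 / \<delta> ^ (4 * K + 1)) ^ h"
        using mrL(5) by (rule power_mono) simp
      also have "\<dots> = 1 / (2 * (c * \<delta> ^ e))"
        by (simp only: e_def power_mult power_divide) (simp add: c_def)
      finally have "2 * real (r * L + m) ^ h * real (card (embeddings V E VH EH))
          \<le> 2 * (1 / (2 * (c * \<delta> ^ e))) * real (card (embeddings V E VH EH))"
        by (intro mult_right_mono mult_left_mono) auto
      then have "real (card V) ^ h \<le> 1 / (c * \<delta> ^ e) * real (card (embeddings V E VH EH))"
        using * by simp
      then show ?thesis using c \<delta> by (simp add: field_simps)
    qed
    ultimately show ?thesis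
      using clustering_or_many_embeddings[OF V H(1) VH H(3,4) _ \<delta> mrL(1-3)] clustering_mono
      unfolding H(2) K_def by blast
  qed
  then show ?thesis using c(1,2) by blast
qed

section \<open>Disagreement within a clustering\<close>

text \<open>Resampling a vertex inside its own cluster preserves the uniform distribution: each
  \<open>u\<close> receives weight 1 / (size of its fiber) from every member of its fiber.\<close>

lemma sum_fiber_average:
  fixes g :: "'a \<Rightarrow> real"
  assumes "finite C"
  shows "(\<Sum>v\<in>C. \<Sum>u | u \<in> C \<and> c u = c v. g u / real (card {u \<in> C. c u = c v})) = (\<Sum>u\<in>C. g u)"
proof -
  have "(\<Sum>v\<in>C. \<Sum>u | u \<in> C \<and> c u = c v. g u / real (card {u \<in> C. c u = c v}))
      = (\<Sum>u\<in>C. \<Sum>v | v \<in> C \<and> c u = c v. g u / real (card {u \<in> C. c u = c v}))"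
    by (rule sum.swap_restrict[OF assms assms])
  also have "\<dots> = (\<Sum>u\<in>C. g u)"
  proof (rule sum.cong)
    fix u assume u: "u \<in> C"
    have eq: "{v. v \<in> C \<and> c u = c v} = {v \<in> C. c v = c u}" by auto
    have "(\<Sum>v | v \<in> C \<and> c u = c v. g u / real (card {u \<in> C. c u = c v}))
        = (\<Sum>v | v \<in> C \<and> c v = c u. g u / real (card {v \<in> C. c v = c u}))"
      unfolding eq by (rule sum.cong) auto
    also have "\<dots> = g u"
    proof -
      have "card {v \<in> C. c v = c u} > 0" using u assms by (auto simp: card_gt_0_iff)
      then show ?thesis by simp
    qed
    finally show "(\<Sum>v | v \<in> C \<and> c u = c v. g u / real (card {u \<in> C. c u = c v})) = g u" .
  qed simp
  finally show ?thesis .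
qed

text \<open>Closeness is defined by out-neighborhoods but is also needed for in-neighborhoods. In a
  tournament these are complementary apart from the vertex itself, so only \<open>w\<close> and
  \<open>w'\<close> can be additional exceptions.\<close>

lemma card_in_nbhd_dist:
  assumes "tournament V E" "finite V" "C \<subseteq> V" "w \<in> C" "w' \<in> C"
  shows "card {v \<in> C. (v, w) \<in> E \<longleftrightarrow> (v, w') \<notin> E} \<le> nbhd_dist E w w' + 2"
proof -
  let ?D = "(E `` {w} - E `` {w'}) \<union> (E `` {w'} - E `` {w})"
  have E: "E \<subseteq> V \<times> V" "\<And>x y. (x, y) \<in> E \<Longrightarrow> (y, x) \<notin> E"
    "\<And>x y. x \<in> V \<Longrightarrow> y \<in> V \<Longrightarrow> x \<noteq> y \<Longrightarrow> (x, y) \<in> E \<or> (y, x) \<in> E"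
    using assms(1) unfolding tournament_def oriented_graph_def by blast+
  have "?D \<subseteq> V" using E(1) by blast
  then have fin: "finite ?D" using assms(2) finite_subset by blast
  have "{v \<in> C. (v, w) \<in> E \<longleftrightarrow> (v, w') \<notin> E} \<subseteq> ?D \<union> {w, w'}"
  proof
    fix v assume v: "v \<in> {v \<in> C. (v, w) \<in> E \<longleftrightarrow> (v, w') \<notin> E}"
    show "v \<in> ?D \<union> {w, w'}"
    proof (cases "v = w \<or> v = w'")
      case False
      have "(v, w) \<in> E \<longleftrightarrow> (w, v) \<notin> E" using E(2,3)[of v w] False v assms(3,4) by blast
      moreover have "(v, w') \<in> E \<longleftrightarrow> (w', v) \<notin> E" using E(2,3)[of v w'] False v assms(3,5) by blast
      ultimately show ?thesis using v by blast
    qed auto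
  qed
  then have "card {v \<in> C. (v, w) \<in> E \<longleftrightarrow> (v, w') \<notin> E} \<le> card (?D \<union> {w, w'})"
    using fin by (intro card_mono) auto
  also have "\<dots> \<le> card ?D + card {w, w'}" by (rule card_Un_le)
  also have "\<dots> \<le> card ?D + 2" by (simp add: card_insert_if)
  finally show ?thesis unfolding nbhd_dist_def .
qed

definition fiber :: "'a set \<Rightarrow> ('a \<Rightarrow> 'b) \<Rightarrow> 'a \<Rightarrow> 'a set" where
  "fiber C c v = {u \<in> C. c u = c v}"

text \<open>Between disjoint \<open>P\<close> and \<open>Q\<close> in a tournament, this is the
  number of pairs to be reversed so that all point the way that \<open>(v, w)\<close> does. Inside a
  cluster the diagonal pairs count as non-arcs.\<close>

definition mismatches :: "('a \<times> 'a) set \<Rightarrow> 'a \<Rightarrow> 'a \<Rightarrow> 'a set \<Rightarrow> 'a set \<Rightarrow> nat" where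
  "mismatches E v w P Q = card {(a, b) \<in> P \<times> Q. (v, w) \<in> E \<longleftrightarrow> (a, b) \<notin> E}"

definition mismatch_density :: "('a \<times> 'a) set \<Rightarrow> 'a set \<Rightarrow> ('a \<Rightarrow> 'b) \<Rightarrow> 'a \<Rightarrow> 'a \<Rightarrow> real" where
  "mismatch_density E C c v w = real (mismatches E v w (fiber C c v) (fiber C c w)) /
     (real (card (fiber C c v)) * real (card (fiber C c w)))"

text \<open>Move the endpoints one at a time, from (v, w) to (a, w) to (a, b). The first move
  changes the source within its cluster and costs \<delta> n for each w; the second changes the
  target, which costs \<delta> n + 2 \<le> 2 \<delta> n for each source. Summation over the
  remaining endpoint gives 3 \<delta> n ^ 2.\<close>

lemma sum_mismatch_density_le:
  assumes V: "tournament V E" "finite V" and cl: "clustering V E \<delta> \<gamma> C c"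
    and n: "2 \<le> \<delta> * real (card V)"
  shows "(\<Sum>v\<in>C. \<Sum>w\<in>C. mismatch_density E C c v w) \<le> 3 * \<delta> * real (card V) ^ 2"
proof -
  define n where "n = real (card V)"
  have C: "C \<subseteq> V" "finite C" using cl V(2) finite_subset by (auto simp: clustering_def)
  have cardC: "real (card C) \<le> n" using C V(2) by (simp add: n_def card_mono)
  have \<delta>n: "0 \<le> \<delta> * n" using n unfolding n_def by linarith
  have EV: "E \<subseteq> V \<times> V" using V(1) by (auto simp: tournament_def oriented_graph_def)
  have close: "real (nbhd_dist E u v) \<le> \<delta> * n" if "u \<in> C" "v \<in> fiber C c u" for u v
    using cl that unfolding clustering_def fiber_def n_def by auto
  let ?F = "fiber C c"
  let ?k = "\<lambda>v. real (card (fiber C c v))"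
  define d where "d v w a b = (if (v, w) \<in> E \<longleftrightarrow> (a, b) \<notin> E then 1 else 0 :: real)" for v w a b
  have finF: "finite (?F v)" for v using C(2) by (simp add: fiber_def)
  have Fpos: "?k v > 0" if "v \<in> C" for v
    using that finF[of v] by (auto simp: card_gt_0_iff fiber_def)
  have dens: "mismatch_density E C c v w = (\<Sum>a\<in>?F v. \<Sum>b\<in>?F w. d v w a b / (?k v * ?k w))" for v w
  proof -
    have "real (mismatches E v w (?F v) (?F w)) = (\<Sum>p\<in>?F v \<times> ?F w. d v w (fst p) (snd p))"
    proof -
      have "{(a, b) \<in> ?F v \<times> ?F w. (v, w) \<in> E \<longleftrightarrow> (a, b) \<notin> E}
          = {p \<in> ?F v \<times> ?F w. (v, w) \<in> E \<longleftrightarrow> (fst p, snd p) \<notin> E}" by auto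
      then show ?thesis unfolding mismatches_def d_def
        using finF by (simp only: sum.If_cases finite_cartesian_product) (simp add: Int_def)
    qed
    also have "\<dots> = (\<Sum>a\<in>?F v. \<Sum>b\<in>?F w. d v w a b)" by (simp add: sum.cartesian_product case_prod_beta)
    finally show ?thesis unfolding mismatch_density_def by (simp add: sum_divide_distrib)
  qed
  have "d v w a b \<le> d v w a w + d a w a b" for v w a b by (auto simp: d_def)
  then have "d v w a b / (?k v * ?k w) \<le> d v w a w / (?k v * ?k w) + d a w a b / (?k v * ?k w)" for v w a b
    by (metis add_divide_distrib divide_right_mono mult_nonneg_nonneg of_nat_0_le_iff)
  then have "(\<Sum>v\<in>C. \<Sum>w\<in>C. mismatch_density E C c v w) \<le>
      (\<Sum>v\<in>C. \<Sum>w\<in>C. \<Sum>a\<in>?F v. \<Sum>b\<in>?F w. d v w a w / (?k v * ?k w) + d a w a b / (?k v * ?k w))"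
    unfolding dens by (intro sum_mono)
  also have "\<dots> = (\<Sum>v\<in>C. \<Sum>w\<in>C. \<Sum>a\<in>?F v. \<Sum>b\<in>?F w. d v w a w / (?k v * ?k w))
      + (\<Sum>v\<in>C. \<Sum>w\<in>C. \<Sum>a\<in>?F v. \<Sum>b\<in>?F w. d a w a b / (?k v * ?k w))"
    by (simp only: sum.distrib)
  also have "(\<Sum>v\<in>C. \<Sum>w\<in>C. \<Sum>a\<in>?F v. \<Sum>b\<in>?F w. d v w a w / (?k v * ?k w))
      = (\<Sum>v\<in>C. \<Sum>w\<in>C. \<Sum>a\<in>?F v. d v w a w / ?k v)"
  proof (intro sum.cong refl)
    fix v w a assume "w \<in> C"
    then show "(\<Sum>b\<in>?F w. d v w a w / (?k v * ?k w)) = d v w a w / ?k v" using Fpos[of w] by simp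
  qed
  also have "\<dots> = (\<Sum>v\<in>C. \<Sum>a\<in>?F v. \<Sum>w\<in>C. d v w a w / ?k v)"
    by (rule sum.cong[OF refl]) (rule sum.swap)
  also have "\<dots> \<le> (\<Sum>v\<in>C. \<Sum>a\<in>?F v. \<delta> * n / ?k v)"
  proof (intro sum_mono)
    fix v a assume va: "v \<in> C" "a \<in> ?F v"
    have "(\<Sum>w\<in>C. d v w a w) = real (card {w \<in> C. (v, w) \<in> E \<longleftrightarrow> (a, w) \<notin> E})"
      unfolding d_def using C(2) by (simp add: sum.If_cases Int_def)
    also have "card {w \<in> C. (v, w) \<in> E \<longleftrightarrow> (a, w) \<notin> E} \<le> nbhd_dist E v a"
      unfolding nbhd_dist_def
      using EV V(2) by (intro card_mono) (auto intro!: finite_subset[of _ V])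
    also have "real (nbhd_dist E v a) \<le> \<delta> * n" using close va by blast
    finally have "(\<Sum>w\<in>C. d v w a w) \<le> \<delta> * n" by simp
    then show "(\<Sum>w\<in>C. d v w a w / ?k v) \<le> \<delta> * n / ?k v"
      unfolding sum_divide_distrib[symmetric] by (rule divide_right_mono) simp
  qed
  also have "\<dots> = (\<Sum>v\<in>C. \<delta> * n)" unfolding fiber_def by (rule sum_fiber_average[OF C(2)])
  also have "\<dots> \<le> \<delta> * n * n" using mult_left_mono[OF cardC \<delta>n] by (simp add: mult.commute)
  \<comment> \<open>Here \<open>v\<close> occurs only in the weight, so summing over
    \<open>v\<close> and a random \<open>a\<close> in its fiber is just summing over
    \<open>a\<close>.\<close>
  also have "(\<Sum>v\<in>C. \<Sum>w\<in>C. \<Sum>a\<in>?F v. \<Sum>b\<in>?F w. d a w a b / (?k v * ?k w))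
      = (\<Sum>v\<in>C. \<Sum>a\<in>?F v. (\<Sum>w\<in>C. \<Sum>b\<in>?F w. d a w a b / ?k w) / ?k v)"
    by (subst sum.swap) (simp add: sum_divide_distrib mult.commute)
  also have "\<dots> = (\<Sum>a\<in>C. \<Sum>w\<in>C. \<Sum>b\<in>?F w. d a w a b / ?k w)"
    unfolding fiber_def by (rule sum_fiber_average[OF C(2)])
  also have "\<dots> = (\<Sum>w\<in>C. \<Sum>b\<in>?F w. \<Sum>a\<in>C. d a w a b / ?k w)"
    by (subst sum.swap) (rule sum.cong[OF refl], rule sum.swap)
  also have "\<dots> \<le> (\<Sum>w\<in>C. \<Sum>b\<in>?F w. 2 * \<delta> * n / ?k w)"
  proof (intro sum_mono)
    fix w b assume wb: "w \<in> C" "b \<in> ?F w"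
    have "(\<Sum>a\<in>C. d a w a b) = real (card {a \<in> C. (a, w) \<in> E \<longleftrightarrow> (a, b) \<notin> E})"
      unfolding d_def using C(2) by (simp add: sum.If_cases Int_def)
    also have "\<dots> \<le> real (nbhd_dist E w b) + 2"
      using card_in_nbhd_dist[OF V C(1), of w b] wb by (simp add: fiber_def)
    also have "\<dots> \<le> 2 * \<delta> * n" using close[OF wb] n unfolding n_def by simp
    finally show "(\<Sum>a\<in>C. d a w a b / ?k w) \<le> 2 * \<delta> * n / ?k w"
      unfolding sum_divide_distrib[symmetric] by (rule divide_right_mono) simp
  qed
  also have "\<dots> = (\<Sum>w\<in>C. 2 * \<delta> * n)" unfolding fiber_def by (rule sum_fiber_average[OF C(2)])
  also have "\<dots> \<le> 2 * \<delta> * n * n" using mult_left_mono[OF cardC \<delta>n] by (simp add: algebra_simps)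
  finally show ?thesis unfolding n_def[symmetric] by (simp add: power2_eq_square)
qed

text \<open>In a tournament, half of the pairs inside a cluster disagree with any given pair, so that
  same-cluster pairs are paid for by the mismatch density.\<close>
lemma card_same_fiber_pairs_le:
  assumes V: "tournament V E" "finite V" and cl: "clustering V E \<delta> \<gamma> C c"
    and n: "2 \<le> \<delta> * real (card V)" "2 \<le> \<gamma> * real (card V)"
  shows "real (card {(u, w) \<in> C \<times> C. c u = c w}) \<le> 12 * \<delta> * real (card V) ^ 2"
proof -
  have C: "C \<subseteq> V" "finite C" using cl V(2) finite_subset by (auto simp: clustering_def)
  let ?F = "fiber C c"
  have dens: "1 / 4 \<le> mismatch_density E C c v w" if vw: "v \<in> C" "w \<in> ?F v" for v w
  proof -
    let ?S = "?F v"
    have S: "?F w = ?S" using vw by (auto simp: fiber_def)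
    have finS: "finite ?S" using C(2) by (simp add: fiber_def)
    define s where "s = card ?S"
    have "2 \<le> real s" using cl vw(1) n(2) unfolding clustering_def s_def fiber_def by fastforce
    then have s: "2 \<le> s" by simp
    define P where "P = {(a, b) \<in> ?S \<times> ?S. (a, b) \<in> E}"
    define Q where "Q = {(a, b) \<in> ?S \<times> ?S. (a, b) \<notin> E}"
    have fin: "finite P" "finite Q" using finS by (auto simp: P_def Q_def intro: finite_subset[of _ "?S \<times> ?S"])
    have SV: "?S \<subseteq> V" using C(1) by (auto simp: fiber_def)
    have "card P + card Q = s * s"
    proof -
      have "card (P \<union> Q) = card P + card Q"
        using fin by (intro card_Un_disjoint) (auto simp: P_def Q_def)
      moreover have "P \<union> Q = ?S \<times> ?S" by (auto simp: P_def Q_def)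
      ultimately show ?thesis by (simp add: card_cartesian_product s_def)
    qed
    moreover have "card Q = card P + s"
    proof -
      have asym: "\<And>x y. (x, y) \<in> E \<Longrightarrow> (y, x) \<notin> E" and irr: "\<And>x. (x, x) \<notin> E"
        and total: "\<And>x y. x \<in> V \<Longrightarrow> y \<in> V \<Longrightarrow> x \<noteq> y \<Longrightarrow> (x, y) \<in> E \<or> (y, x) \<in> E"
        using V(1) unfolding tournament_def oriented_graph_def by blast+
      have "Q = prod.swap ` P \<union> (\<lambda>x. (x, x)) ` ?S"
      proof
        show "Q \<subseteq> prod.swap ` P \<union> (\<lambda>x. (x, x)) ` ?S"
        proof
          fix p assume p: "p \<in> Q"
          obtain a b where ab: "p = (a, b)" by (cases p)
          show "p \<in> prod.swap ` P \<union> (\<lambda>x. (x, x)) ` ?S"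
          proof (cases "a = b")
            case False
            then have "(b, a) \<in> P" using p ab total[of a b] SV by (auto simp: P_def Q_def)
            then show ?thesis using ab by (auto intro: image_eqI[of _ _ "(b, a)"])
          qed (use p ab in \<open>auto simp: Q_def\<close>)
        qed
      qed (use asym irr in \<open>auto simp: P_def Q_def\<close>)
      moreover have "prod.swap ` P \<inter> (\<lambda>x. (x, x)) ` ?S = {}" using irr by (auto simp: P_def)
      ultimately have "card Q = card (prod.swap ` P) + card ((\<lambda>x. (x, x)) ` ?S)"
        using fin finS by (simp add: card_Un_disjoint)
      moreover have "card (prod.swap ` P) = card P" by (rule card_image) (auto simp: inj_on_def)
      moreover have "card ((\<lambda>x. (x, x)) ` ?S) = s"
        unfolding s_def by (rule card_image) (auto simp: inj_on_def)
      ultimately show ?thesis by simp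
    qed
    \<comment> \<open>The smaller of the two sets is \<open>P\<close> with s (s - 1) / 2 pairs,
      which is at least s ^ 2 / 4 because s \<ge> 2.\<close>
    moreover have "2 * s \<le> s * s" using s by (rule mult_right_mono) simp
    ultimately have "s * s \<le> 4 * card P" "s * s \<le> 4 * card Q" by linarith+
    moreover have "mismatches E v w ?S ?S = (if (v, w) \<in> E then card Q else card P)"
      unfolding mismatches_def P_def Q_def by auto
    ultimately have "s * s \<le> 4 * mismatches E v w ?S ?S" by simp
    then have "real s * real s \<le> 4 * real (mismatches E v w ?S ?S)"
      by (metis of_nat_mono of_nat_mult of_nat_numeral)
    then show ?thesis unfolding mismatch_density_def S s_def[symmetric] using s by (simp add: field_simps)
  qed
  have "{(u, w) \<in> C \<times> C. c u = c w} = Sigma C ?F" by (auto simp: fiber_def)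
  then have "real (card {(u, w) \<in> C \<times> C. c u = c w}) = (\<Sum>v\<in>C. \<Sum>w\<in>?F v. 1)"
    using C(2) by (simp add: card_SigmaI fiber_def)
  also have "\<dots> \<le> (\<Sum>v\<in>C. \<Sum>w\<in>?F v. 4 * mismatch_density E C c v w)"
  proof (intro sum_mono)
    fix v w assume "v \<in> C" "w \<in> ?F v"
    then show "1 \<le> 4 * mismatch_density E C c v w" using dens[of v w] by simp
  qed
  also have "\<dots> \<le> (\<Sum>v\<in>C. \<Sum>w\<in>C. 4 * mismatch_density E C c v w)"
    using C(2) by (intro sum_mono sum_mono2) (auto simp: fiber_def mismatch_density_def)
  also have "\<dots> = 4 * (\<Sum>v\<in>C. \<Sum>w\<in>C. mismatch_density E C c v w)" by (simp add: sum_distrib_left)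
  also have "\<dots> \<le> 12 * \<delta> * real (card V) ^ 2" using sum_mismatch_density_le[OF V cl n(1)] by simp
  finally show ?thesis .
qed

section \<open>Choosing one element from each class\<close>

definition average :: "'a set \<Rightarrow> ('a \<Rightarrow> real) \<Rightarrow> real" where
  "average S f = (\<Sum>x\<in>S. f x) / real (card S)"

lemma average_add: "average S (\<lambda>x. f x + g x) = average S f + average S g"
  by (simp add: average_def sum.distrib add_divide_distrib)

lemma average_sum: "average S (\<lambda>x. \<Sum>i\<in>I. f i x) = (\<Sum>i\<in>I. average S (f i))"
  unfolding average_def by (subst sum.swap) (simp add: sum_divide_distrib)

lemma average_const: "finite S \<Longrightarrow> S \<noteq> {} \<Longrightarrow> average S (\<lambda>x. a) = a"
  by (simp add: average_def)

lemma average_swap: "average S (\<lambda>x. average T (f x)) = average T (\<lambda>y. average S (\<lambda>x. f x y))"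
  unfolding average_def
  by (simp add: sum_divide_distrib[symmetric], subst sum.swap) (simp add: mult.commute)

lemma exists_le_average:
  assumes "finite S" "S \<noteq> {}"
  shows "\<exists>x\<in>S. f x \<le> average S f"
proof (rule ccontr)
  assume "\<not> ?thesis"
  then have "(\<Sum>x\<in>S. average S f) < (\<Sum>x\<in>S. f x)" using assms by (intro sum_strict_mono) auto
  moreover have "(\<Sum>x\<in>S. average S f) = (\<Sum>x\<in>S. f x)" using assms by (simp add: average_def)
  ultimately show False by simp
qed

lemma sum_offdiag_insert:
  fixes G :: "'i \<Rightarrow> 'i \<Rightarrow> real"
  assumes "finite I" "k \<notin> I"
  shows "(\<Sum>i\<in>insert k I. \<Sum>j\<in>insert k I - {i}. G i j)
    = (\<Sum>i\<in>I. G i k + G k i) + (\<Sum>i\<in>I. \<Sum>j\<in>I - {i}. G i j)"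
proof -
  have "(\<Sum>i\<in>I. \<Sum>j\<in>insert k I - {i}. G i j) = (\<Sum>i\<in>I. G i k + (\<Sum>j\<in>I - {i}. G i j))"
  proof (rule sum.cong[OF refl])
    fix i assume "i \<in> I"
    then have "insert k I - {i} = insert k (I - {i})" using assms(2) by auto
    then show "(\<Sum>j\<in>insert k I - {i}. G i j) = G i k + (\<Sum>j\<in>I - {i}. G i j)"
      using assms by simp
  qed
  moreover have "insert k I - {k} = I" using assms(2) by auto
  ultimately show ?thesis using assms by (simp add: sum.distrib)
qed

text \<open>The method of conditional expectations. Once \<open>x\<close> is fixed in class
  \<open>k\<close>, its interactions with the undecided classes depend on one choice each and are
  moved into the unary costs; this is why the statement carries \<open>l\<close> and the induction
  generalizes it.\<close>

lemma exists_choice_le_average: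
  fixes l :: "'i \<Rightarrow> 'a \<Rightarrow> real" and g :: "'i \<Rightarrow> 'i \<Rightarrow> 'a \<Rightarrow> 'a \<Rightarrow> real"
  assumes "finite I" "\<And>i. i \<in> I \<Longrightarrow> finite (W i) \<and> W i \<noteq> {}"
  shows "\<exists>v. (\<forall>i\<in>I. v i \<in> W i) \<and>
    (\<Sum>i\<in>I. l i (v i)) + (\<Sum>i\<in>I. \<Sum>j\<in>I - {i}. g i j (v i) (v j))
    \<le> (\<Sum>i\<in>I. average (W i) (l i))
      + (\<Sum>i\<in>I. \<Sum>j\<in>I - {i}. average (W i) (\<lambda>a. average (W j) (g i j a)))"
  using assms
proof (induction I arbitrary: l rule: finite_induct)
  case (insert k I)
  let ?p = "\<Sum>i\<in>I. \<Sum>j\<in>I - {i}. average (W i) (\<lambda>a. average (W j) (g i j a))"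
  define l' where "l' x i a = l i a + (g i k a x + g k i x a)" for x i a
  define R where "R x = l k x + (\<Sum>i\<in>I. average (W i) (l' x i))" for x
  have Wk: "finite (W k)" "W k \<noteq> {}" using insert.prems by auto
  from exists_le_average[OF Wk] obtain x where x: "x \<in> W k" "R x \<le> average (W k) R" by blast
  have "average (W k) R = average (W k) (l k) + (\<Sum>i\<in>I. average (W i) (l i)
      + (average (W i) (\<lambda>a. average (W k) (g i k a)) + average (W k) (\<lambda>a. average (W i) (g k i a))))"
  proof -
    have "average (W k) (\<lambda>x. average (W i) (l' x i)) = average (W i) (l i)
      + (average (W i) (\<lambda>a. average (W k) (g i k a)) + average (W k) (\<lambda>a. average (W i) (g k i a)))"
      for i
      unfolding l'_def average_add average_const[OF Wk] average_swap[of "W k" "W i" "\<lambda>x a. g i k a x"]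
      by simp
    then show ?thesis unfolding R_def average_add average_sum by simp
  qed
  then have avgR: "average (W k) R + ?p = (\<Sum>i\<in>insert k I. average (W i) (l i))
      + (\<Sum>i\<in>insert k I. \<Sum>j\<in>insert k I - {i}. average (W i) (\<lambda>a. average (W j) (g i j a)))"
    unfolding sum_offdiag_insert[OF insert.hyps] using insert.hyps by (simp add: sum.distrib)
  obtain v where v: "\<forall>i\<in>I. v i \<in> W i"
    "(\<Sum>i\<in>I. l' x i (v i)) + (\<Sum>i\<in>I. \<Sum>j\<in>I - {i}. g i j (v i) (v j))
      \<le> (\<Sum>i\<in>I. average (W i) (l' x i)) + ?p"
    using insert.IH[of "l' x"] insert.prems by auto
  define v' where "v' = v(k := x)"
  have v'k: "v' k = x" and v'I: "\<And>i. i \<in> I \<Longrightarrow> v' i = v i" using insert.hyps by (auto simp: v'_def)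
  have "(\<Sum>i\<in>insert k I. l i (v' i)) + (\<Sum>i\<in>insert k I. \<Sum>j\<in>insert k I - {i}. g i j (v' i) (v' j))
      = l k x + (\<Sum>i\<in>I. l' x i (v i)) + (\<Sum>i\<in>I. \<Sum>j\<in>I - {i}. g i j (v i) (v j))"
    unfolding sum_offdiag_insert[OF insert.hyps] l'_def
    using insert.hyps by (simp add: v'k v'I sum.distrib)
  also have "\<dots> \<le> R x + ?p" using v(2) unfolding R_def by linarith
  also have "\<dots> \<le> average (W k) R + ?p" using x(2) by simp
  finally show ?case
    using v(1) x(1) unfolding avgR by (intro exI[of _ v']) (auto simp: v'k v'I)
qed simp

text \<open>In a product space, an event that depends on two coordinates has the probability that it
  has in the product of these two; stated as an inequality and cross-multiplied.\<close>

lemma card_PiE_pair_le: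
  assumes "finite J" "\<And>j. j \<in> J \<Longrightarrow> finite (W j)" "q \<in> J" "q' \<in> J" "q \<noteq> q'"
  shows "card {z \<in> Pi\<^sub>E J W. P (z q) (z q')} * (card (W q) * card (W q'))
    \<le> (\<Prod>j\<in>J. card (W j)) * card {(a, b) \<in> W q \<times> W q'. P a b}"
proof -
  let ?B = "{(a, b) \<in> W q \<times> W q'. P a b}"
  let ?U = "\<lambda>p. W(q := {fst p}, q' := {snd p})"
  let ?R = "\<Prod>j\<in>J - {q} - {q'}. card (W j)"
  have finB: "finite ?B" using assms by (auto intro: finite_subset[of _ "W q \<times> W q'"])
  have "{z \<in> Pi\<^sub>E J W. P (z q) (z q')} \<subseteq> (\<Union>p\<in>?B. Pi\<^sub>E J (?U p))"
  proof
    fix z assume z: "z \<in> {z \<in> Pi\<^sub>E J W. P (z q) (z q')}"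
    then have "(z q, z q') \<in> ?B" using assms(3,4) by auto
    moreover have "z \<in> Pi\<^sub>E J (?U (z q, z q'))" using z by (auto simp: PiE_iff)
    ultimately show "z \<in> (\<Union>p\<in>?B. Pi\<^sub>E J (?U p))" by (rule UN_I)
  qed
  moreover have "finite (Pi\<^sub>E J (?U p))" for p using assms by (intro finite_PiE) auto
  ultimately have "card {z \<in> Pi\<^sub>E J W. P (z q) (z q')} \<le> card (\<Union>p\<in>?B. Pi\<^sub>E J (?U p))"
    using finB by (intro card_mono finite_UN_I)
  also have "\<dots> \<le> (\<Sum>p\<in>?B. card (Pi\<^sub>E J (?U p)))" by (rule card_UN_le[OF finB])
  also have "\<dots> = (\<Sum>p\<in>?B. ?R)"
  proof (rule sum.cong[OF refl])
    fix p
    have "card (Pi\<^sub>E J (?U p)) = (\<Prod>j\<in>J. card (?U p j))" using assms(1) by (rule card_PiE)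
    also have "\<dots> = card (?U p q) * (card (?U p q') * (\<Prod>j\<in>J - {q} - {q'}. card (?U p j)))"
      using assms by (simp add: prod.remove[of J q] prod.remove[of "J - {q}" q'])
    also have "(\<Prod>j\<in>J - {q} - {q'}. card (?U p j)) = ?R" by (rule prod.cong) auto
    also have "card (?U p q) * (card (?U p q') * ?R) = ?R" using assms(5) by simp
    finally show "card (Pi\<^sub>E J (?U p)) = ?R" .
  qed
  finally have "card {z \<in> Pi\<^sub>E J W. P (z q) (z q')} \<le> card ?B * ?R" by simp
  then have "card {z \<in> Pi\<^sub>E J W. P (z q) (z q')} * (card (W q) * card (W q'))
      \<le> card ?B * ?R * (card (W q) * card (W q'))" by (rule mult_right_mono) simp
  also have "\<dots> = card (W q) * (card (W q') * ?R) * card ?B" by (simp add: algebra_simps)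
  also have "card (W q) * (card (W q') * ?R) = (\<Prod>j\<in>J. card (W j))"
    using assms prod.remove[of J q "\<lambda>j. card (W j)"] prod.remove[of "J - {q}" q' "\<lambda>j. card (W j)"] by simp
  finally show ?thesis .
qed

section \<open>Counting copies in a homogeneous pattern\<close>

text \<open>The sampled vertices of one class are distinct and number at least 2 ^ h, so they
  contain a transitive list that accommodates the acyclic part of \<open>H\<close> with that label.
  Edges between classes are oriented as the representatives prescribe, whichever samples are
  used.\<close>

lemma embedding_of_transversal:
  assumes V: "tournament V E" and H: "finite VH"
    and J: "finite J" "z ` J \<subseteq> V"
    and big: "\<And>u. u \<in> VH \<Longrightarrow> 2 ^ card VH \<le> card {q \<in> J. cls q = \<kappa> u}"
    and acyc: "\<And>i. acyclic (EH \<inter> {u \<in> VH. \<kappa> u = i} \<times> {u \<in> VH. \<kappa> u = i})"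
    and v: "v ` \<kappa> ` VH \<subseteq> V" "inj_on v (\<kappa> ` VH)"
    and edges: "\<And>u w. u \<in> VH \<Longrightarrow> w \<in> VH \<Longrightarrow> (u, w) \<in> EH \<Longrightarrow> \<kappa> u \<noteq> \<kappa> w \<Longrightarrow> (v (\<kappa> u), v (\<kappa> w)) \<in> E"
    and same: "\<And>q q'. q \<in> J \<Longrightarrow> q' \<in> J \<Longrightarrow> q \<noteq> q' \<Longrightarrow> cls q = cls q' \<Longrightarrow> z q \<noteq> z q'"
    and diff: "\<And>q q'. q \<in> J \<Longrightarrow> q' \<in> J \<Longrightarrow> cls q \<noteq> cls q' \<Longrightarrow>
      (z q, z q') \<in> E \<longleftrightarrow> (v (cls q), v (cls q')) \<in> E"
  shows "\<exists>\<phi>\<in>embeddings V E VH EH. \<phi> ` VH \<subseteq> z ` J"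
proof -
  have total: "(x, y) \<in> E \<or> (y, x) \<in> E" if "x \<in> V" "y \<in> V" "x \<noteq> y" for x y
    using V that unfolding tournament_def by blast
  have irrefl: "(x, x) \<notin> E" for x using V by (auto simp: tournament_def oriented_graph_def)
  let ?A = "\<lambda>i. {u \<in> VH. \<kappa> u = i}"
  let ?Z = "\<lambda>i. z ` {q \<in> J. cls q = i}"
  have "\<forall>i\<in>\<kappa> ` VH. \<exists>\<phi>. inj_on \<phi> (?A i) \<and> \<phi> ` ?A i \<subseteq> ?Z i \<and>
      (\<forall>u\<in>?A i. \<forall>w\<in>?A i. (u, w) \<in> EH \<longrightarrow> (\<phi> u, \<phi> w) \<in> E)"
  proof
    fix i assume i: "i \<in> \<kappa> ` VH"
    have "inj_on z {q \<in> J. cls q = i}"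
    proof (rule inj_onI, rule ccontr)
      fix q q' assume "q \<in> {q \<in> J. cls q = i}" "q' \<in> {q \<in> J. cls q = i}" "z q = z q'" "q \<noteq> q'"
      then show False using same[of q q'] by simp
    qed
    then have "card (?Z i) = card {q \<in> J. cls q = i}" by (rule card_image)
    then have "2 ^ card VH \<le> card (?Z i)" using big i by auto
    moreover have "?Z i \<subseteq> V" using J(2) by auto
    moreover have "finite (?Z i)" using J(1) by auto
    moreover have "\<And>x y. x \<in> ?Z i \<Longrightarrow> y \<in> ?Z i \<Longrightarrow> x \<noteq> y \<Longrightarrow> (x, y) \<in> E \<or> (y, x) \<in> E"
      using total \<open>?Z i \<subseteq> V\<close> by (meson subsetD)
    ultimately have "\<exists>xs. length xs = card VH \<and> distinct xs \<and> set xs \<subseteq> ?Z i \<and>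
        sorted_wrt (\<lambda>x y. (x, y) \<in> E) xs"
      by (intro transitive_list_in_tournament)
    then obtain xs where xs: "length xs = card VH" "distinct xs" "set xs \<subseteq> ?Z i"
      "sorted_wrt (\<lambda>x y. (x, y) \<in> E) xs"
      by (elim exE conjE)
    have "finite (?A i)" using H by simp
    moreover have "card (?A i) \<le> length xs" using H unfolding xs(1) by (intro card_mono) auto
    ultimately have "\<exists>\<phi>. inj_on \<phi> (?A i) \<and> \<phi> ` ?A i \<subseteq> set xs \<and>
        (\<forall>u\<in>?A i. \<forall>w\<in>?A i. (u, w) \<in> EH \<longrightarrow> (\<phi> u, \<phi> w) \<in> E)"
      using acyc xs(2,4) by (intro acyclic_embeds_in_transitive_list)
    then obtain \<phi> where "inj_on \<phi> (?A i)" "\<phi> ` ?A i \<subseteq> set xs"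
      "\<forall>u\<in>?A i. \<forall>w\<in>?A i. (u, w) \<in> EH \<longrightarrow> (\<phi> u, \<phi> w) \<in> E"
      by (elim exE conjE)
    then show "\<exists>\<phi>. inj_on \<phi> (?A i) \<and> \<phi> ` ?A i \<subseteq> ?Z i \<and>
      (\<forall>u\<in>?A i. \<forall>w\<in>?A i. (u, w) \<in> EH \<longrightarrow> (\<phi> u, \<phi> w) \<in> E)"
      using xs(3) by (intro exI[of _ \<phi>] conjI order_trans[of "\<phi> ` ?A i" "set xs" "?Z i"])
  qed
  from bchoice[OF this] obtain \<psi> where \<psi>: "\<forall>i\<in>\<kappa> ` VH. inj_on (\<psi> i) (?A i) \<and> \<psi> i ` ?A i \<subseteq> ?Z i \<and>
      (\<forall>u\<in>?A i. \<forall>w\<in>?A i. (u, w) \<in> EH \<longrightarrow> (\<psi> i u, \<psi> i w) \<in> E)" ..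
  define \<phi> where "\<phi> = restrict (\<lambda>u. \<psi> (\<kappa> u) u) VH"
  have \<phi>: "\<phi> u = \<psi> (\<kappa> u) u" if "u \<in> VH" for u using that by (simp add: \<phi>_def)
  have "\<exists>q. q \<in> J \<and> cls q = \<kappa> u \<and> \<phi> u = z q" if u: "u \<in> VH" for u
  proof -
    have "\<psi> (\<kappa> u) ` ?A (\<kappa> u) \<subseteq> ?Z (\<kappa> u)" using \<psi> u by auto
    then have "\<phi> u \<in> ?Z (\<kappa> u)" unfolding \<phi>[OF u] using u by auto
    then show ?thesis by auto
  qed
  then obtain pos where pos: "\<And>u. u \<in> VH \<Longrightarrow> pos u \<in> J" "\<And>u. u \<in> VH \<Longrightarrow> cls (pos u) = \<kappa> u"
    "\<And>u. u \<in> VH \<Longrightarrow> \<phi> u = z (pos u)"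
    by metis
  have cross: "(\<phi> u, \<phi> w) \<in> E \<longleftrightarrow> (v (\<kappa> u), v (\<kappa> w)) \<in> E"
    if "u \<in> VH" "w \<in> VH" "\<kappa> u \<noteq> \<kappa> w" for u w
    using diff[of "pos u" "pos w"] pos that by simp
  have "inj_on \<phi> VH"
  proof (rule inj_onI, rule ccontr)
    fix u w assume uw: "u \<in> VH" "w \<in> VH" "\<phi> u = \<phi> w" "u \<noteq> w"
    show False
    proof (cases "\<kappa> u = \<kappa> w")
      case True
      have "inj_on (\<psi> (\<kappa> u)) (?A (\<kappa> u))" using \<psi> uw(1) by auto
      moreover have "\<psi> (\<kappa> u) u = \<psi> (\<kappa> u) w" using uw \<phi> True by simp
      ultimately show False using uw True by (auto dest: inj_onD)
    next
      case False
      \<comment> \<open>Distinct representatives are joined by an arc, hence so are the images of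
        \<open>u\<close> and \<open>w\<close>; if these coincided, the arc would be a loop.\<close>
      then have "v (\<kappa> u) \<noteq> v (\<kappa> w)" using v(2) uw by (auto dest: inj_onD)
      then have "(v (\<kappa> u), v (\<kappa> w)) \<in> E \<or> (v (\<kappa> w), v (\<kappa> u)) \<in> E"
        using total v(1) uw by blast
      then show False using cross[of u w] cross[of w u] uw False irrefl by auto
    qed
  qed
  moreover have "(\<phi> u, \<phi> w) \<in> E" if uw: "u \<in> VH" "w \<in> VH" "(u, w) \<in> EH" for u w
  proof (cases "\<kappa> u = \<kappa> w")
    case True
    have "\<forall>u'\<in>?A (\<kappa> u). \<forall>w'\<in>?A (\<kappa> u). (u', w') \<in> EH \<longrightarrow> (\<psi> (\<kappa> u) u', \<psi> (\<kappa> u) w') \<in> E"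
      using \<psi> uw(1) by auto
    then show ?thesis using uw True \<phi> by simp
  next
    case False
    then show ?thesis using edges cross uw by simp
  qed
  moreover have range: "\<phi> ` VH \<subseteq> z ` J" using pos by auto
  then have "\<phi> \<in> VH \<rightarrow>\<^sub>E V" using J(2) by (auto simp: \<phi>_def PiE_def)
  ultimately show ?thesis using range unfolding embeddings_def by blast
qed

text \<open>Sample \<open>N\<close> vertices, 2 ^ h for each vertex of \<open>H\<close>, from the
  sets \<open>W\<close>. A pair of positions is bad, by collision or by wrong orientation, with
  probability at most 1 / (2 N ^ 2), and there are at most N ^ 2 ordered pairs. So at least half of
  the at least (\<gamma> n) ^ N samples satisfy \<open>embedding_of_transversal\<close>, and double
  counting converts this into embeddings.\<close>

lemma many_embeddings_of_pattern:
  fixes W :: "'i \<Rightarrow> 'a set"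
  assumes V: "tournament V E" "finite V" "V \<noteq> {}" and H: "finite VH" "VH \<noteq> {}"
    and N: "N = card VH * 2 ^ card VH"
    and acyc: "\<And>i. acyclic (EH \<inter> {u \<in> VH. \<kappa> u = i} \<times> {u \<in> VH. \<kappa> u = i})"
    and v: "v ` \<kappa> ` VH \<subseteq> V" "inj_on v (\<kappa> ` VH)"
    and edges: "\<And>u w. u \<in> VH \<Longrightarrow> w \<in> VH \<Longrightarrow> (u, w) \<in> EH \<Longrightarrow> \<kappa> u \<noteq> \<kappa> w \<Longrightarrow> (v (\<kappa> u), v (\<kappa> w)) \<in> E"
    and W: "\<And>i. i \<in> \<kappa> ` VH \<Longrightarrow> W i \<subseteq> V"
      "\<And>i. i \<in> \<kappa> ` VH \<Longrightarrow> \<gamma> * real (card V) \<le> real (card (W i))"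
    and large: "2 * real N ^ 2 \<le> \<gamma> * real (card V)"
    and hom: "\<And>i j. i \<in> \<kappa> ` VH \<Longrightarrow> j \<in> \<kappa> ` VH \<Longrightarrow> i \<noteq> j \<Longrightarrow>
      2 * real N ^ 2 * real (mismatches E (v i) (v j) (W i) (W j)) \<le> real (card (W i)) * real (card (W j))"
  shows "\<gamma> ^ N / (2 * real N ^ card VH) * real (card V) ^ card VH \<le> real (card (embeddings V E VH EH))"
proof -
  define h where "h = card VH"
  define M :: nat where "M = 2 ^ h"
  have h: "h > 0" using H by (simp add: h_def card_gt_0_iff)
  have NM: "N = h * M" by (simp add: N h_def M_def)
  have M: "M > 0" by (simp add: M_def)
  have N0: "N > 0" using h M by (simp add: NM)
  define n where "n = real (card V)"
  have n: "n > 0" using V by (simp add: n_def card_gt_0_iff)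
  have "\<gamma> * n \<ge> 0" using large unfolding n_def[symmetric] by (meson order_trans zero_le_mult_iff zero_le_numeral zero_le_power of_nat_0_le_iff)
  obtain en where en: "bij_betw en {..<h} VH"
    using ex_bij_betw_nat_finite[OF H(1)] unfolding h_def atLeast0LessThan by blast
  define cls where "cls q = \<kappa> (en (q div M))" for q
  have cls: "cls q \<in> \<kappa> ` VH" if "q < N" for q
  proof -
    have "q div M < h" using that M unfolding NM by (simp add: less_mult_imp_div_less)
    then show ?thesis using en unfolding cls_def bij_betw_def by auto
  qed
  have finW: "finite (W i)" if "i \<in> \<kappa> ` VH" for i using W(1)[OF that] V(2) finite_subset by blast
  define Z where "Z = Pi\<^sub>E {..<N} (\<lambda>q. W (cls q))"
  have cardZ: "card Z = (\<Prod>q<N. card (W (cls q)))" unfolding Z_def by (simp add: card_PiE)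
  have finZ: "finite Z" unfolding Z_def using finW cls by (intro finite_PiE) auto
  \<comment> \<open>Within one class a collision is the bad event, and the orientation is left to
    Ramsey; across classes it is a deviation from the representatives.\<close>
  define P where "P q q' a b \<longleftrightarrow> (if cls q = cls q' then a = b
    else (v (cls q), v (cls q')) \<in> E \<longleftrightarrow> (a, b) \<notin> E)" for q q' a b
  let ?Q = "{p \<in> {..<N} \<times> {..<N}. fst p \<noteq> snd p}"
  let ?bad = "\<lambda>p. {z \<in> Z. P (fst p) (snd p) (z (fst p)) (z (snd p))}"
  have bad: "2 * real N ^ 2 * real (card (?bad p)) \<le> real (card Z)" if p: "p \<in> ?Q" for p
  proof -
    obtain q q' where pq: "p = (q, q')" by (cases p)
    have q: "q < N" "q' < N" "q \<noteq> q'" using p pq by auto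
    let ?w = "real (card (W (cls q))) * real (card (W (cls q')))"
    let ?x = "{(a, b) \<in> W (cls q) \<times> W (cls q'). P q q' a b}"
    have "card (?bad p) * (card (W (cls q)) * card (W (cls q'))) \<le> card Z * card ?x"
      unfolding cardZ unfolding Z_def pq fst_conv snd_conv
      by (rule card_PiE_pair_le) (use finW cls q in auto)
    then have "real (card (?bad p) * (card (W (cls q)) * card (W (cls q')))) \<le> real (card Z * card ?x)"
      by (rule of_nat_mono)
    then have 1: "real (card (?bad p)) * ?w \<le> real (card Z) * real (card ?x)" by simp
    have 2: "2 * real N ^ 2 * real (card ?x) \<le> ?w"
    proof (cases "cls q = cls q'")
      case True
      then have "?x = (\<lambda>a. (a, a)) ` W (cls q)" by (auto simp: P_def)
      then have "card ?x = card (W (cls q))" by (simp add: card_image inj_on_def)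
      \<comment> \<open>Two samples from the same set collide with probability 1 / card W, which
        \<open>large\<close> makes small enough.\<close>
      moreover have "2 * real N ^ 2 \<le> real (card (W (cls q)))"
        using large W(2)[OF cls[OF q(1)]] by linarith
      ultimately show ?thesis using True by (simp add: mult_right_mono)
    next
      case False
      then have "card ?x = mismatches E (v (cls q)) (v (cls q')) (W (cls q)) (W (cls q'))"
        unfolding mismatches_def P_def by simp
      then show ?thesis using hom[OF cls[OF q(1)] cls[OF q(2)] False] by simp
    qed
    have "0 < 2 * real N ^ 2" using N0 by simp
    then have w: "?w > 0"
      using large W(2)[OF cls[OF q(1)]] W(2)[OF cls[OF q(2)]] by (intro mult_pos_pos) linarith+
    have "2 * real N ^ 2 * (real (card (?bad p)) * ?w) \<le> 2 * real N ^ 2 * (real (card Z) * real (card ?x))"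
      using 1 by (rule mult_left_mono) simp
    also have "\<dots> = real (card Z) * (2 * real N ^ 2 * real (card ?x))" by simp
    also have "\<dots> \<le> real (card Z) * ?w" using 2 by (rule mult_left_mono) simp
    finally have "2 * real N ^ 2 * real (card (?bad p)) * ?w \<le> real (card Z) * ?w" by simp
    then show ?thesis using w by (simp only: mult_le_cancel_right_pos)
  qed
  define G where "G = Z - (\<Union>p\<in>?Q. ?bad p)"
  have cardG: "real (card Z) \<le> 2 * real (card G)"
  proof -
    have finQ: "finite ?Q" by simp
    have "Z \<subseteq> G \<union> (\<Union>p\<in>?Q. ?bad p)" by (auto simp: G_def)
    then have "card Z \<le> card (G \<union> (\<Union>p\<in>?Q. ?bad p))"
      using finZ finQ by (intro card_mono) (auto simp: G_def)
    also have "\<dots> \<le> card G + card (\<Union>p\<in>?Q. ?bad p)" by (rule card_Un_le)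
    also have "card (\<Union>p\<in>?Q. ?bad p) \<le> (\<Sum>p\<in>?Q. card (?bad p))" by (rule card_UN_le[OF finQ])
    finally have "real (card Z) \<le> real (card G) + (\<Sum>p\<in>?Q. real (card (?bad p)))"
      by (simp flip: of_nat_sum of_nat_add)
    also have "(\<Sum>p\<in>?Q. real (card (?bad p))) \<le> (\<Sum>p\<in>?Q. real (card Z) / (2 * real N ^ 2))"
    proof (rule sum_mono)
      fix p assume "p \<in> ?Q"
      from bad[OF this] show "real (card (?bad p)) \<le> real (card Z) / (2 * real N ^ 2)"
        using N0 by (simp add: field_simps)
    qed
    also have "\<dots> = real (card ?Q) * (real (card Z) / (2 * real N ^ 2))" by simp
    also have "\<dots> \<le> real N ^ 2 * (real (card Z) / (2 * real N ^ 2))"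
    proof (rule mult_right_mono)
      have "card ?Q \<le> card ({..<N} \<times> {..<N})" by (intro card_mono) auto
      also have "\<dots> = N ^ 2" by (simp add: card_cartesian_product power2_eq_square)
      finally show "real (card ?Q) \<le> real N ^ 2" by (metis of_nat_mono of_nat_power)
    qed simp
    also have "\<dots> = real (card Z) / 2" using N0 by simp
    finally show ?thesis by simp
  qed
  have "(\<gamma> * n) ^ N \<le> real (card Z)"
  proof -
    have "(\<gamma> * n) ^ N = (\<Prod>q<N. \<gamma> * n)" by simp
    also have "\<dots> \<le> (\<Prod>q<N. real (card (W (cls q))))"
      using W(2)[OF cls] \<open>\<gamma> * n \<ge> 0\<close> unfolding n_def by (intro prod_mono) auto
    finally show ?thesis by (simp add: cardZ)
  qed
  then have lower: "(\<gamma> * n) ^ N \<le> 2 * real (card G)" using cardG by linarith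
  let ?L = "\<lambda>z. map z [0..<N]"
  have "inj_on ?L G"
  proof (rule inj_onI)
    fix z z' assume z: "z \<in> G" "z' \<in> G" "?L z = ?L z'"
    show "z = z'"
    proof (rule PiE_ext)
      show "z \<in> Pi\<^sub>E {..<N} (\<lambda>q. W (cls q))" "z' \<in> Pi\<^sub>E {..<N} (\<lambda>q. W (cls q))"
        using z by (auto simp: G_def Z_def)
      show "z q = z' q" if "q \<in> {..<N}" for q
        using z(3) that by (metis diff_zero lessThan_iff add_0 length_upt nth_map nth_upt)
    qed
  qed
  then have "card G = card (?L ` G)" by (simp add: card_image)
  moreover have "card (?L ` G) * card V ^ h \<le> card (embeddings V E VH EH) * (N ^ h * card V ^ N)"
    unfolding h_def
  proof (rule card_lists_with_embedding[OF V(2) H(1)])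
    have inV: "z ` {..<N} \<subseteq> V" if "z \<in> G" for z
      using that W(1)[OF cls] by (fastforce simp: G_def Z_def PiE_def Pi_def)
    then show "?L ` G \<subseteq> lists_over V N"
      by (fastforce simp: lists_over_def atLeast0LessThan)
    fix xs assume "xs \<in> ?L ` G"
    then obtain z where z: "z \<in> G" "xs = ?L z" by blast
    have zP: "\<not> P q q' (z q) (z q')" if "q < N" "q' < N" "q \<noteq> q'" for q q'
    proof
      assume "P q q' (z q) (z q')"
      then have "z \<in> ?bad (q, q')" using z(1) by (simp add: G_def)
      moreover have "(q, q') \<in> ?Q" using that by simp
      ultimately show False using z(1) unfolding G_def by blast
    qed
    have "\<exists>\<phi>\<in>embeddings V E VH EH. \<phi> ` VH \<subseteq> z ` {..<N}"
    proof (rule embedding_of_transversal[where cls = cls, OF V(1) H(1) finite_lessThan inV[OF z(1)] _ acyc v edges])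
      fix u assume "u \<in> VH"
      then obtain i where i: "i < h" "en i = u" using en unfolding bij_betw_def by auto
      have "(\<lambda>l. i * M + l) ` {..<M} \<subseteq> {q \<in> {..<N}. cls q = \<kappa> u}"
      proof
        fix q assume "q \<in> (\<lambda>l. i * M + l) ` {..<M}"
        then obtain l where l: "l < M" "q = i * M + l" by auto
        then have "q < Suc i * M" by simp
        also have "\<dots> \<le> N" using i unfolding NM by (intro mult_right_mono) auto
        finally show "q \<in> {q \<in> {..<N}. cls q = \<kappa> u}" using l i M by (simp add: cls_def)
      qed
      then have "card ((\<lambda>l. i * M + l) ` {..<M}) \<le> card {q \<in> {..<N}. cls q = \<kappa> u}"
        by (intro card_mono) auto
      moreover have "card ((\<lambda>l. i * M + l) ` {..<M}) = M" by (simp add: card_image)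
      ultimately show "2 ^ card VH \<le> card {q \<in> {..<N}. cls q = \<kappa> u}" by (simp add: M_def h_def)
    next
      fix q q' assume "q \<in> {..<N}" "q' \<in> {..<N}" "q \<noteq> q'" "cls q = cls q'"
      then show "z q \<noteq> z q'" using zP[of q q'] by (auto simp: P_def)
    next
      fix q q' assume "q \<in> {..<N}" "q' \<in> {..<N}" "cls q \<noteq> cls q'"
      then show "(z q, z q') \<in> E \<longleftrightarrow> (v (cls q), v (cls q')) \<in> E"
        using zP[of q q'] by (auto simp: P_def)
    qed
    then show "\<exists>\<phi>\<in>embeddings V E VH EH. \<phi> ` VH \<subseteq> set xs"
      unfolding z(2) by (simp add: atLeast0LessThan)
  qed
  ultimately have "real (card G * card V ^ h) \<le> real (card (embeddings V E VH EH) * (N ^ h * card V ^ N))"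
    by (metis of_nat_mono)
  then have "real (card G) * n ^ h \<le> real (card (embeddings V E VH EH)) * (real N ^ h * n ^ N)"
    by (simp add: n_def)
  moreover have "(\<gamma> * n) ^ N * n ^ h \<le> 2 * real (card G) * n ^ h"
    using lower n by (intro mult_right_mono) auto
  ultimately have "(\<gamma> ^ N * n ^ h) * n ^ N \<le> (2 * real N ^ h * real (card (embeddings V E VH EH))) * n ^ N"
    by (simp add: power_mult_distrib algebra_simps)
  then have "\<gamma> ^ N * n ^ h \<le> 2 * real N ^ h * real (card (embeddings V E VH EH))"
    using n by (simp only: mult_le_cancel_right_pos zero_less_power)
  then show ?thesis using N0 unfolding h_def[symmetric] n_def[symmetric] by (simp add: field_simps)
qed

section \<open>The removal argument\<close>

lemma sum_offdiag_classes_le: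
  fixes f :: "'a \<Rightarrow> 'a \<Rightarrow> real"
  assumes "finite C" "\<And>a b. a \<in> C \<Longrightarrow> b \<in> C \<Longrightarrow> 0 \<le> f a b"
  shows "(\<Sum>i\<in>c ` C. \<Sum>j\<in>c ` C - {i}. \<Sum>a\<in>{a \<in> C. c a = i}. \<Sum>b\<in>{b \<in> C. c b = j}. f a b)
    \<le> (\<Sum>a\<in>C. \<Sum>b\<in>C. f a b)"
proof -
  have "(\<Sum>i\<in>c ` C. \<Sum>j\<in>c ` C - {i}. \<Sum>a\<in>{a \<in> C. c a = i}. \<Sum>b\<in>{b \<in> C. c b = j}. f a b)
    \<le> (\<Sum>i\<in>c ` C. \<Sum>j\<in>c ` C. \<Sum>a\<in>{a \<in> C. c a = i}. \<Sum>b\<in>{b \<in> C. c b = j}. f a b)"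
    using assms by (intro sum_mono sum_mono2) (auto intro!: sum_nonneg)
  also have "\<dots> = (\<Sum>i\<in>c ` C. \<Sum>a\<in>{a \<in> C. c a = i}. \<Sum>j\<in>c ` C. \<Sum>b\<in>{b \<in> C. c b = j}. f a b)"
    by (rule sum.cong[OF refl]) (rule sum.swap)
  also have "\<dots> = (\<Sum>i\<in>c ` C. \<Sum>a\<in>{a \<in> C. c a = i}. \<Sum>b\<in>C. f a b)"
    by (simp only: sum.image_gen[OF assms(1), symmetric])
  also have "\<dots> = (\<Sum>a\<in>C. \<Sum>b\<in>C. f a b)"
    by (simp only: sum.image_gen[OF assms(1), symmetric])
  finally show ?thesis .
qed

text \<open>The representatives \<open>v i\<close> of the clusters play the role of a random choice: with positive
  probability they lie in large clusters of the finer clustering, all pairs of these finer clusters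
  are homogeneous, and orienting each pair of coarse clusters like its representatives reverses
  few edges.\<close>
lemma exists_representatives:
  assumes V: "tournament V E" "finite V" "V \<noteq> {}"
    and eps: "0 < eps" and \<tau>: "0 < \<tau>" "\<tau> \<le> 1"
    and \<gamma>: "0 < \<gamma>1" "\<gamma>1 \<le> 1"
    and cl1: "clustering V E (eps / 30) \<gamma>1 C c"
    and cl2: "clustering V E (\<tau> * \<gamma>1 ^ 2 / 16) \<gamma>2 C' c'"
    and large: "2 \<le> eps / 30 * real (card V)" "2 \<le> \<tau> * \<gamma>1 ^ 2 / 16 * real (card V)"
  shows "\<exists>v. (\<forall>i\<in>c ` C. v i \<in> C \<and> c (v i) = i \<and> v i \<in> C') \<and>
    (\<forall>i\<in>c ` C. \<forall>j\<in>c ` C. i \<noteq> j \<longrightarrow> mismatch_density E C' c' (v i) (v j) \<le> \<tau>) \<and>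
    (\<Sum>i\<in>c ` C. \<Sum>j\<in>c ` C - {i}. real (mismatches E (v i) (v j) {a \<in> C. c a = i} {a \<in> C. c a = j}))
      \<le> eps / 2 * real (card V) ^ 2"
proof -
  define n where "n = real (card V)"
  have n: "n > 0" using V by (simp add: n_def card_gt_0_iff)
  define I where "I = c ` C"
  define F where "F i = {a \<in> C. c a = i}" for i
  have C: "C \<subseteq> V" "finite C" using cl1 V(2) finite_subset by (auto simp: clustering_def)
  have C': "C' \<subseteq> V" "finite C'" using cl2 V(2) finite_subset by (auto simp: clustering_def)
  have finI: "finite I" using C(2) by (simp add: I_def)
  have F: "finite (F i)" "F i \<subseteq> C" for i using C(2) by (auto simp: F_def)
  have cardF: "\<gamma>1 * n \<le> real (card (F i))" if "i \<in> I" for i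
    using that cl1 unfolding clustering_def I_def F_def n_def by auto
  have \<gamma>n: "0 < \<gamma>1 * n" using \<gamma>(1) n by simp
  have Fne: "finite (F i) \<and> F i \<noteq> {}" if "i \<in> I" for i
    using F(1)[of i] cardF[OF that] \<gamma>n by auto
  define bad where "bad a b \<longleftrightarrow> a \<in> C' \<and> b \<in> C' \<and> \<tau> < mismatch_density E C' c' a b" for a b
  \<comment> \<open>The reversal cost is scaled by the permitted number of reversals, so that
    exceeding it contributes more than 1 to the total cost below, like any other failure.\<close>
  define s where "s = eps / 2 * n ^ 2"
  have s: "0 < s" using eps n by (simp add: s_def)
  define l where "l i a = (if a \<in> C' then 0 else 1 :: real)" for i :: 'a and a
  define g where "g i j a b = (if bad a b then 1 else 0) + real (mismatches E a b (F i) (F j)) / s" for i j a b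
  have avg_pair: "average (F i) (\<lambda>a. average (F j) (f a))
      = (\<Sum>a\<in>F i. \<Sum>b\<in>F j. f a b / (real (card (F i)) * real (card (F j))))" for f i j
    unfolding average_def by (simp add: sum_divide_distrib mult.commute)
  have "\<exists>v. (\<forall>i\<in>I. v i \<in> F i) \<and>
      (\<Sum>i\<in>I. l i (v i)) + (\<Sum>i\<in>I. \<Sum>j\<in>I - {i}. g i j (v i) (v j))
      \<le> (\<Sum>i\<in>I. average (F i) (l i)) + (\<Sum>i\<in>I. \<Sum>j\<in>I - {i}. average (F i) (\<lambda>a. average (F j) (g i j a)))"
    by (rule exists_choice_le_average[OF finI Fne])
  then obtain v where v: "\<forall>i\<in>I. v i \<in> F i"
    "(\<Sum>i\<in>I. l i (v i)) + (\<Sum>i\<in>I. \<Sum>j\<in>I - {i}. g i j (v i) (v j))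
      \<le> (\<Sum>i\<in>I. average (F i) (l i)) + (\<Sum>i\<in>I. \<Sum>j\<in>I - {i}. average (F i) (\<lambda>a. average (F j) (g i j a)))"
    by (elim exE conjE)
  have "(\<Sum>i\<in>I. average (F i) (l i)) \<le> 1 / 16"
  proof -
    have "(\<Sum>i\<in>I. average (F i) (l i)) \<le> (\<Sum>i\<in>I. (\<Sum>a\<in>F i. l i a) / (\<gamma>1 * n))"
      unfolding average_def using cardF \<gamma>n
      by (intro sum_mono frac_le) (auto simp: l_def intro!: sum_nonneg)
    also have "\<dots> = (\<Sum>a\<in>C. if a \<in> C' then 0 else 1) / (\<gamma>1 * n)"
      unfolding sum_divide_distrib[symmetric] l_def I_def F_def
      by (simp only: sum.image_gen[OF C(2), symmetric])
    also have "(\<Sum>a\<in>C. if a \<in> C' then 0 else 1 :: real) = real (card (C - C'))"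
      using C(2) by (simp add: sum.If_cases Diff_eq Compl_eq)
    also have "card (C - C') \<le> card (V - C')" using C(1) V(2) by (intro card_mono) auto
    also have "real (card (V - C')) \<le> \<tau> * \<gamma>1 ^ 2 / 16 * n" using cl2 by (simp add: clustering_def n_def)
    finally have "(\<Sum>i\<in>I. average (F i) (l i)) \<le> \<tau> * \<gamma>1 ^ 2 / 16 * n / (\<gamma>1 * n)"
      using \<gamma>n by (simp add: divide_right_mono)
    also have "\<dots> = \<tau> * \<gamma>1 / 16" using \<gamma> n by (simp add: field_simps power2_eq_square)
    also have "\<dots> \<le> 1 / 16" using \<tau> \<gamma> by (simp add: mult_le_one)
    finally show ?thesis .
  qed
  moreover have "(\<Sum>i\<in>I. \<Sum>j\<in>I - {i}. average (F i) (\<lambda>a. average (F j) (\<lambda>b. if bad a b then 1 else 0))) \<le> 3 / 16"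
  proof -
    \<comment> \<open>All pairs must be good simultaneously, so the failure probabilities of all
      pairs are added. A random member of a coarse cluster has any given value with probability at
      most 1 / (\<gamma>1 n), whence the loss of \<gamma>1 ^ 2 that the fine parameter
      compensates.\<close>
    have "(\<Sum>i\<in>I. \<Sum>j\<in>I - {i}. average (F i) (\<lambda>a. average (F j) (\<lambda>b. if bad a b then 1 else 0)))
        \<le> (\<Sum>i\<in>I. \<Sum>j\<in>I - {i}. \<Sum>a\<in>F i. \<Sum>b\<in>F j. (if bad a b then 1 else 0) / (\<gamma>1 * n) ^ 2)"
      unfolding avg_pair power2_eq_square
    proof (intro sum_mono)
      fix i j a b assume ij: "i \<in> I" "j \<in> I - {i}"
      have "(\<gamma>1 * n) * (\<gamma>1 * n) \<le> real (card (F i)) * real (card (F j))"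
        using ij cardF \<gamma>n by (intro mult_mono) auto
      then show "(if bad a b then 1 else 0) / (real (card (F i)) * real (card (F j)))
          \<le> (if bad a b then 1 else 0) / (\<gamma>1 * n * (\<gamma>1 * n))"
        using mult_pos_pos[OF \<gamma>n \<gamma>n] by (intro frac_le) auto
    qed
    also have "\<dots> \<le> (\<Sum>a\<in>C. \<Sum>b\<in>C. (if bad a b then 1 else 0) / (\<gamma>1 * n) ^ 2)"
      unfolding I_def F_def by (rule sum_offdiag_classes_le[OF C(2)]) simp
    also have "\<dots> \<le> (\<Sum>a\<in>C'. \<Sum>b\<in>C'. mismatch_density E C' c' a b / \<tau> / (\<gamma>1 * n) ^ 2)"
    proof -
      \<comment> \<open>The two clusterings have unrelated domains, so the sum is extended to
        \<open>V\<close> and cut down to \<open>C'\<close>, outside of which nothing is bad.\<close>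
      have "(\<Sum>a\<in>C. \<Sum>b\<in>C. (if bad a b then 1 else 0) / (\<gamma>1 * n) ^ 2)
          \<le> (\<Sum>a\<in>V. \<Sum>b\<in>V. (if bad a b then 1 else 0) / (\<gamma>1 * n) ^ 2)"
      proof (rule order_trans)
        show "(\<Sum>a\<in>C. \<Sum>b\<in>C. (if bad a b then 1 else 0) / (\<gamma>1 * n) ^ 2)
            \<le> (\<Sum>a\<in>C. \<Sum>b\<in>V. (if bad a b then 1 else 0) / (\<gamma>1 * n) ^ 2)"
          using C(1) V(2) by (intro sum_mono sum_mono2) auto
        show "(\<Sum>a\<in>C. \<Sum>b\<in>V. (if bad a b then 1 else 0) / (\<gamma>1 * n) ^ 2)
            \<le> (\<Sum>a\<in>V. \<Sum>b\<in>V. (if bad a b then 1 else 0) / (\<gamma>1 * n) ^ 2)"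
          using C(1) V(2) by (intro sum_mono2 sum_nonneg) auto
      qed
      also have "\<dots> = (\<Sum>a\<in>C'. \<Sum>b\<in>C'. (if bad a b then 1 else 0) / (\<gamma>1 * n) ^ 2)"
      proof (rule sum.mono_neutral_cong_right[OF V(2) C'(1)])
        show "\<forall>a\<in>V - C'. (\<Sum>b\<in>V. (if bad a b then 1 else 0) / (\<gamma>1 * n) ^ 2) = 0"
          by (simp add: bad_def)
        show "(\<Sum>b\<in>V. (if bad a b then 1 else 0) / (\<gamma>1 * n) ^ 2)
            = (\<Sum>b\<in>C'. (if bad a b then 1 else 0) / (\<gamma>1 * n) ^ 2)" for a
          by (rule sum.mono_neutral_cong_right[OF V(2) C'(1)]) (auto simp: bad_def)
      qed
      \<comment> \<open>Markov's inequality, termwise.\<close>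
      also have "\<dots> \<le> (\<Sum>a\<in>C'. \<Sum>b\<in>C'. mismatch_density E C' c' a b / \<tau> / (\<gamma>1 * n) ^ 2)"
      proof (intro sum_mono divide_right_mono)
        fix a b
        have "0 \<le> mismatch_density E C' c' a b" by (simp add: mismatch_density_def)
        then show "(if bad a b then 1 else 0) \<le> mismatch_density E C' c' a b / \<tau>"
          using \<tau>(1) by (simp add: bad_def pos_le_divide_eq)
      qed simp
      finally show ?thesis .
    qed
    also have "\<dots> = (\<Sum>a\<in>C'. \<Sum>b\<in>C'. mismatch_density E C' c' a b) / \<tau> / (\<gamma>1 * n) ^ 2"
      by (simp add: sum_divide_distrib)
    also have "\<dots> \<le> 3 * (\<tau> * \<gamma>1 ^ 2 / 16) * n ^ 2 / \<tau> / (\<gamma>1 * n) ^ 2"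
      using sum_mismatch_density_le[OF V(1,2) cl2 large(2)] \<tau> \<gamma> unfolding n_def
      by (intro divide_right_mono) auto
    also have "\<dots> = 3 / 16" using \<tau> \<gamma> n by (simp add: field_simps)
    finally show ?thesis .
  qed
  moreover have "(\<Sum>i\<in>I. \<Sum>j\<in>I - {i}. average (F i) (\<lambda>a. average (F j) (\<lambda>b.
      real (mismatches E a b (F i) (F j)) / s))) \<le> 1 / 5"
  proof -
    \<comment> \<open>The averaging weights turn the number of mismatches into the mismatch density,
      so no power of \<gamma>1 is lost. This lets the coarse parameter be a constant multiple of
      \<open>eps\<close>.\<close>
    have "(\<Sum>i\<in>I. \<Sum>j\<in>I - {i}. average (F i) (\<lambda>a. average (F j) (\<lambda>b. real (mismatches E a b (F i) (F j)) / s)))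
        = (\<Sum>i\<in>I. \<Sum>j\<in>I - {i}. \<Sum>a\<in>F i. \<Sum>b\<in>F j. mismatch_density E C c a b / s)"
      unfolding avg_pair mismatch_density_def
      by (intro sum.cong refl) (auto simp: F_def fiber_def mult.commute)
    also have "\<dots> \<le> (\<Sum>a\<in>C. \<Sum>b\<in>C. mismatch_density E C c a b / s)"
      unfolding I_def F_def using s by (intro sum_offdiag_classes_le C(2)) (simp add: mismatch_density_def)
    also have "\<dots> = (\<Sum>a\<in>C. \<Sum>b\<in>C. mismatch_density E C c a b) / s" by (simp add: sum_divide_distrib)
    also have "\<dots> \<le> 3 * (eps / 30) * n ^ 2 / s"
      using sum_mismatch_density_le[OF V(1,2) cl1 large(1)] s unfolding n_def
      by (intro divide_right_mono) auto
    also have "\<dots> = 1 / 5" using eps n by (simp add: s_def field_simps)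
    finally show ?thesis .
  qed
  moreover have "(\<Sum>i\<in>I. \<Sum>j\<in>I - {i}. average (F i) (\<lambda>a. average (F j) (g i j a)))
      = (\<Sum>i\<in>I. \<Sum>j\<in>I - {i}. average (F i) (\<lambda>a. average (F j) (\<lambda>b. if bad a b then 1 else 0)))
      + (\<Sum>i\<in>I. \<Sum>j\<in>I - {i}. average (F i) (\<lambda>a. average (F j) (\<lambda>b. real (mismatches E a b (F i) (F j)) / s)))"
    unfolding g_def average_add sum.distrib ..
  \<comment> \<open>The expected cost is at most 1/16 + 3/16 + 1/5 = 9/20, while a single failure
    costs at least 1.\<close>
  ultimately have total: "(\<Sum>i\<in>I. l i (v i)) + (\<Sum>i\<in>I. \<Sum>j\<in>I - {i}. g i j (v i) (v j)) < 1"
    using v(2) by linarith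
  have l0: "0 \<le> l i a" for i a by (simp add: l_def)
  have g0: "0 \<le> g i j a b" for i j a b using s by (simp add: g_def)
  have L: "(\<Sum>i\<in>I. l i (v i)) \<ge> 0" "(\<Sum>i\<in>I. \<Sum>j\<in>I - {i}. g i j (v i) (v j)) \<ge> 0"
    using l0 g0 by (auto intro!: sum_nonneg)
  have vC': "v i \<in> C'" if "i \<in> I" for i
  proof (rule ccontr)
    assume "v i \<notin> C'"
    then have "1 \<le> l i (v i)" by (simp add: l_def)
    also have "\<dots> \<le> (\<Sum>i\<in>I. l i (v i))" using l0 finI that by (intro member_le_sum) auto
    finally show False using total L by linarith
  qed
  have "mismatch_density E C' c' (v i) (v j) \<le> \<tau>" if ij: "i \<in> I" "j \<in> I" "i \<noteq> j" for i j
  proof (rule ccontr)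
    assume "\<not> ?thesis"
    then have "1 \<le> g i j (v i) (v j)" using vC' ij s by (simp add: g_def bad_def)
    also have "\<dots> \<le> (\<Sum>j\<in>I - {i}. g i j (v i) (v j))"
      using g0 finI ij by (intro member_le_sum[of j]) auto
    also have "\<dots> \<le> (\<Sum>i\<in>I. \<Sum>j\<in>I - {i}. g i j (v i) (v j))"
      using g0 finI ij by (intro member_le_sum[of i]) (auto intro!: sum_nonneg)
    finally show False using total L by linarith
  qed
  moreover have "(\<Sum>i\<in>I. \<Sum>j\<in>I - {i}. real (mismatches E (v i) (v j) (F i) (F j))) \<le> s"
  proof -
    have "(\<Sum>i\<in>I. \<Sum>j\<in>I - {i}. real (mismatches E (v i) (v j) (F i) (F j)) / s)
        \<le> (\<Sum>i\<in>I. \<Sum>j\<in>I - {i}. g i j (v i) (v j))"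
      by (intro sum_mono) (simp add: g_def)
    then have "(\<Sum>i\<in>I. \<Sum>j\<in>I - {i}. real (mismatches E (v i) (v j) (F i) (F j))) / s \<le> 1"
      using total L unfolding sum_divide_distrib by linarith
    then show ?thesis using s by (simp add: field_simps)
  qed
  ultimately show ?thesis using v(1) vC' unfolding I_def F_def s_def n_def
    by (intro exI[of _ v]) auto
qed

text \<open>The tournament rebuilt from the representatives is too close to \<open>E\<close> to be
  free of \<open>H\<close>. Its copy is used only as a pattern: which coarse cluster each vertex of
  \<open>H\<close> lies in. That pattern is realized many times in \<open>E\<close> itself, inside
  the fine clusters around the representatives, and \<tau> = 1 / (2 N ^ 2) is the homogeneity that
  \<open>many_embeddings_of_pattern\<close> demands.\<close>

lemma embeddings_of_clusterings:
  fixes V :: "nat set"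
  assumes V: "tournament V E" "finite V" "V \<noteq> {}" and H: "finite VH" "VH \<noteq> {}"
    and eps: "0 < eps" "eps \<le> 1" and far: "eps_far eps V E VH EH"
    and N: "N = card VH * 2 ^ card VH" and \<tau>: "\<tau> = 1 / (2 * real N ^ 2)"
    and \<gamma>: "0 < \<gamma>1" "\<gamma>1 \<le> 1"
    and cl1: "clustering V E (eps / 30) \<gamma>1 C c"
    and cl2: "clustering V E (\<tau> * \<gamma>1 ^ 2 / 16) \<gamma>2 C' c'"
    and large: "2 \<le> eps / 30 * real (card V)" "2 \<le> \<tau> * \<gamma>1 ^ 2 / 16 * real (card V)"
      "2 \<le> \<gamma>1 * real (card V)" "2 * real N ^ 2 \<le> \<gamma>2 * real (card V)"
  shows "\<gamma>2 ^ N / (2 * real N ^ card VH) * real (card V) ^ card VH \<le> real (card (embeddings V E VH EH))"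
proof -
  define n where "n = real (card V)"
  have n: "n > 0" using V by (simp add: n_def card_gt_0_iff)
  have "card VH > 0" using H by (simp add: card_gt_0_iff)
  then have "1 \<le> N" unfolding N by simp
  then have N1: "1 \<le> real N ^ 2" by simp
  then have "0 < 2 * real N ^ 2" "1 \<le> 2 * real N ^ 2" by linarith+
  then have \<tau>1: "0 < \<tau>" "\<tau> \<le> 1"
    unfolding \<tau> by (simp_all only: zero_less_divide_1_iff divide_le_eq_1_pos)
  have C: "C \<subseteq> V" "finite C" using cl1 V(2) finite_subset by (auto simp: clustering_def)
  have rest: "real (card (V - C)) \<le> eps / 30 * n" using cl1 by (simp add: clustering_def n_def)
  have total: "(x, y) \<in> E \<or> (y, x) \<in> E" if "x \<in> V" "y \<in> V" "x \<noteq> y" for x y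
    using V(1) that unfolding tournament_def by blast
  have asym: "(y, x) \<notin> E" if "(x, y) \<in> E" for x y
    using V(1) that unfolding tournament_def oriented_graph_def by blast
  define I where "I = c ` C"
  define F where "F i = {a \<in> C. c a = i}" for i
  from exists_representatives[OF V eps(1) \<tau>1 \<gamma> cl1 cl2 large(1,2)]
  obtain v where v: "\<forall>i\<in>I. v i \<in> C \<and> c (v i) = i \<and> v i \<in> C'"
    "\<forall>i\<in>I. \<forall>j\<in>I. i \<noteq> j \<longrightarrow> mismatch_density E C' c' (v i) (v j) \<le> \<tau>"
    "(\<Sum>i\<in>I. \<Sum>j\<in>I - {i}. real (mismatches E (v i) (v j) (F i) (F j))) \<le> eps / 2 * n ^ 2"
    unfolding I_def[symmetric] F_def[symmetric] n_def[symmetric] by (elim exE conjE)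
  have "C \<noteq> {}"
  proof
    assume "C = {}"
    then have "n \<le> eps / 30 * n" using rest by (simp add: n_def)
    then show False using n eps by (simp add: field_simps)
  qed
  then obtain x0 where x0: "x0 \<in> C" by blast
  \<comment> \<open>Exceptional vertices join an arbitrary cluster; all arcs at them are charged to
    the error.\<close>
  define k where "k u = (if u \<in> C then c u else c x0)" for u
  have kI: "k u \<in> I" for u using x0 by (simp add: k_def I_def)
  have vV: "v i \<in> V" if "i \<in> I" for i using v(1) that C(1) by blast
  have v_inj: "inj_on v I" using v(1) by (metis inj_onI)
  \<comment> \<open>The vertices being numbers, their order supplies the transitive orientation
    inside a cluster.\<close>
  define E' where "E' = {(u, w). u \<in> V \<and> w \<in> V \<and>
    (if k u = k w then u < w else (v (k u), v (k w)) \<in> E)}"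
  have "tournament V E'"
    unfolding tournament_def oriented_graph_def
  proof (intro conjI allI ballI impI)
    show "E' \<subseteq> V \<times> V" by (auto simp: E'_def)
    show "(x, x) \<notin> E'" for x by (auto simp: E'_def)
    show "(y, x) \<notin> E'" if "(x, y) \<in> E'" for x y
      using that asym by (auto simp: E'_def split: if_splits)
    show "(x, y) \<in> E' \<or> (y, x) \<in> E'" if "x \<in> V" "y \<in> V" "x \<noteq> y" for x y
    proof (cases "k x = k y")
      case False
      then have "v (k x) \<noteq> v (k y)" using v_inj kI by (meson inj_onD)
      then show ?thesis using total[OF vV[OF kI] vV[OF kI]] that False by (auto simp: E'_def)
    qed (use that in \<open>auto simp: E'_def\<close>)
  qed
  define T where "T i j = {(a, b) \<in> F i \<times> F j. (v i, v j) \<in> E \<longleftrightarrow> (a, b) \<notin> E}" for i j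
  have finI: "finite I" using C(2) by (simp add: I_def)
  have finF: "finite (F i)" for i using C(2) by (simp add: F_def)
  have finT: "finite (T i j)" for i j
    unfolding T_def using finF by (auto intro: finite_subset[of _ "F i \<times> F j"])
  have "real (card (E - E')) < eps * n ^ 2"
  proof -
    let ?S = "{(u, w) \<in> C \<times> C. c u = c w}"
    let ?X = "(V - C) \<times> V \<union> V \<times> (V - C)"
    let ?U = "\<Union>i\<in>I. \<Union>j\<in>I - {i}. T i j"
    have "E - E' \<subseteq> ?X \<union> (?S \<union> ?U)"
    proof
      fix p assume p: "p \<in> E - E'"
      obtain a b where ab: "p = (a, b)" by (cases p)
      have abV: "a \<in> V" "b \<in> V" using p ab V(1) by (auto simp: tournament_def oriented_graph_def)
      show "p \<in> ?X \<union> (?S \<union> ?U)"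
      proof (cases "a \<in> C \<and> b \<in> C \<and> c a \<noteq> c b")
        case True
        then have "(a, b) \<in> T (c a) (c b)" using p ab abV by (auto simp: T_def F_def E'_def k_def)
        moreover have "c a \<in> I" "c b \<in> I - {c a}" using True by (auto simp: I_def)
        ultimately show ?thesis unfolding ab by blast
      qed (use ab abV in auto)
    qed
    moreover have fin: "finite ?X" "finite ?S" "finite ?U"
      using V(2) C(2) finI finT by (auto intro: finite_subset[of _ "C \<times> C"])
    ultimately have "card (E - E') \<le> card (?X \<union> (?S \<union> ?U))" by (intro card_mono) auto
    also have "\<dots> \<le> card ?X + (card ?S + card ?U)"
      by (intro order_trans[OF card_Un_le] add_mono order_refl card_Un_le)
    finally have "real (card (E - E')) \<le> real (card ?X) + (real (card ?S) + real (card ?U))"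
      by (simp flip: of_nat_add)
    moreover have "real (card ?X) \<le> 2 * (eps / 30 * n * n)"
    proof -
      have "card ?X \<le> card ((V - C) \<times> V) + card (V \<times> (V - C))" by (rule card_Un_le)
      also have "\<dots> = 2 * (card (V - C) * card V)" by (simp add: card_cartesian_product mult.commute)
      finally have "real (card ?X) \<le> 2 * (real (card (V - C)) * n)"
        unfolding n_def by (metis of_nat_mono of_nat_mult of_nat_numeral)
      also have "\<dots> \<le> 2 * (eps / 30 * n * n)" using rest n by (intro mult_left_mono mult_right_mono) auto
      finally show ?thesis .
    qed
    moreover have "real (card ?S) \<le> 12 * (eps / 30) * n ^ 2"
      using card_same_fiber_pairs_le[OF V(1,2) cl1 large(1,3)] by (simp add: n_def)
    moreover have "real (card ?U) \<le> eps / 2 * n ^ 2"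
    proof -
      have "card ?U \<le> (\<Sum>i\<in>I. card (\<Union>j\<in>I - {i}. T i j))" by (rule card_UN_le[OF finI])
      also have "\<dots> \<le> (\<Sum>i\<in>I. \<Sum>j\<in>I - {i}. card (T i j))"
        using finI by (intro sum_mono card_UN_le) auto
      finally have "real (card ?U) \<le> real (\<Sum>i\<in>I. \<Sum>j\<in>I - {i}. card (T i j))" by (rule of_nat_mono)
      also have "\<dots> = (\<Sum>i\<in>I. \<Sum>j\<in>I - {i}. real (mismatches E (v i) (v j) (F i) (F j)))"
        by (simp add: T_def mismatches_def)
      also note v(3)
      finally show ?thesis .
    qed
    \<comment> \<open>In units of eps n ^ 2 / 30: at most 2 for arcs at exceptional vertices, 12
      inside coarse clusters and 15 between them. This is where the 30 comes from.\<close>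
    ultimately have "real (card (E - E')) \<le> 29 / 30 * (eps * n ^ 2)" by (simp add: power2_eq_square)
    moreover have "0 < eps * n ^ 2" using eps n by simp
    ultimately show ?thesis by linarith
  qed
  then have "\<not> H_free V E' VH EH"
    using far \<open>tournament V E'\<close> unfolding eps_far_def n_def by (meson not_le)
  then obtain S G where "(S, G) \<in> copies V E' VH EH" unfolding H_free_def by auto
  then have "G \<subseteq> E'" and "\<exists>f. bij_betw f VH S \<and> (\<forall>u\<in>VH. \<forall>w\<in>VH. (u, w) \<in> EH \<longleftrightarrow> (f u, f w) \<in> G)"
    unfolding copies_def by simp_all
  then obtain f where f: "G \<subseteq> E'" "\<forall>u\<in>VH. \<forall>w\<in>VH. (u, w) \<in> EH \<longleftrightarrow> (f u, f w) \<in> G"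
    by (elim exE conjE)
  have fE': "(f u, f w) \<in> E'" if "u \<in> VH" "w \<in> VH" "(u, w) \<in> EH" for u w using f that by blast
  define \<kappa> where "\<kappa> u = k (f u)" for u
  have \<kappa>I: "\<kappa> ` VH \<subseteq> I" using kI by (auto simp: \<kappa>_def)
  show ?thesis
  proof (rule many_embeddings_of_pattern[where \<kappa> = \<kappa> and v = v and W = "\<lambda>i. fiber C' c' (v i)", OF V H N])
    show "acyclic (EH \<inter> {u \<in> VH. \<kappa> u = i} \<times> {u \<in> VH. \<kappa> u = i})" for i
    \<comment> \<open>Inside one cluster the arcs of \<open>E'\<close> go upwards, so
      \<open>f\<close> increases along the edges of \<open>H\<close>.\<close>
    proof (rule acyclic_subset[OF wf_acyclic[OF wf_measure[of f]]])
      show "EH \<inter> {u \<in> VH. \<kappa> u = i} \<times> {u \<in> VH. \<kappa> u = i} \<subseteq> measure f"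
      proof
        fix p assume p: "p \<in> EH \<inter> {u \<in> VH. \<kappa> u = i} \<times> {u \<in> VH. \<kappa> u = i}"
        obtain u w where uw: "p = (u, w)" by (cases p)
        then have "(f u, f w) \<in> E'" "k (f u) = k (f w)" using p fE' by (auto simp: \<kappa>_def)
        then show "p \<in> measure f" unfolding uw by (simp add: E'_def)
      qed
    qed
    show "v ` \<kappa> ` VH \<subseteq> V" using \<kappa>I vV by blast
    show "inj_on v (\<kappa> ` VH)" using v_inj \<kappa>I by (rule inj_on_subset)
    show "(v (\<kappa> u), v (\<kappa> w)) \<in> E" if "u \<in> VH" "w \<in> VH" "(u, w) \<in> EH" "\<kappa> u \<noteq> \<kappa> w" for u w
      using fE'[OF that(1-3)] that(4) by (simp add: E'_def \<kappa>_def)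
    show "fiber C' c' (v i) \<subseteq> V" for i using cl2 by (auto simp: fiber_def clustering_def)
    show "\<gamma>2 * real (card V) \<le> real (card (fiber C' c' (v i)))" if "i \<in> \<kappa> ` VH" for i
    proof -
      have "v i \<in> C'" using v(1) \<kappa>I that by blast
      then show ?thesis using cl2 unfolding clustering_def fiber_def by blast
    qed
    show "2 * real N ^ 2 \<le> \<gamma>2 * real (card V)" by (rule large(4))
    fix i j assume ij: "i \<in> \<kappa> ` VH" "j \<in> \<kappa> ` VH" "i \<noteq> j"
    let ?w = "real (card (fiber C' c' (v i))) * real (card (fiber C' c' (v j)))"
    have pos: "card (fiber C' c' (v i)) > 0" if "i \<in> I" for i
    proof -
      have "v i \<in> fiber C' c' (v i)" using v(1) that by (simp add: fiber_def)
      moreover have "finite (fiber C' c' (v i))"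
        using cl2 V(2) by (auto simp: fiber_def clustering_def intro: finite_subset)
      ultimately show ?thesis by (auto simp: card_gt_0_iff)
    qed
    have "i \<in> I" "j \<in> I" using ij \<kappa>I by auto
    then have w: "?w > 0" using pos by simp
    have "mismatch_density E C' c' (v i) (v j) \<le> \<tau>" using v(2) ij \<kappa>I by blast
    then have "real (mismatches E (v i) (v j) (fiber C' c' (v i)) (fiber C' c' (v j))) \<le> \<tau> * ?w"
      using w unfolding mismatch_density_def by (simp only: pos_divide_le_eq)
    then have "2 * real N ^ 2 * real (mismatches E (v i) (v j) (fiber C' c' (v i)) (fiber C' c' (v j)))
        \<le> 2 * real N ^ 2 * (\<tau> * ?w)" by (rule mult_left_mono) simp
    also have "\<dots> = ?w" using \<open>1 \<le> N\<close> by (simp add: \<tau>)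
    finally show "2 * real N ^ 2 * real (mismatches E (v i) (v j) (fiber C' c' (v i)) (fiber C' c' (v j))) \<le> ?w" .
  qed
qed

section \<open>Choice of the constants\<close>

theorem theorem3p1:
  fixes h :: nat
  assumes "h > 0"
  shows "\<exists>eps0 > 0. \<exists>d :: real.
    \<forall>EH :: (nat \<times> nat) set. oriented_graph {0..<h} EH \<and> two_colorable {0..<h} EH \<longrightarrow>
    (\<forall>eps :: real. 0 < eps \<and> eps < eps0 \<longrightarrow>
      (\<exists>n0 :: nat. \<forall>n \<ge> n0. \<forall>E :: (nat \<times> nat) set.
        tournament {0..<n} E \<and> eps_far eps {0..<n} E {0..<h} EH \<longrightarrow>
        real (card (copies {0..<n} E {0..<h} EH)) \<ge> eps powr d * real n ^ h))"
proof -
  obtain c e where c: "0 < c" "c \<le> 1" and dichotomy: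
    "\<forall>(V :: nat set) E (VH :: nat set) EH \<delta>.
      tournament V E \<and> finite V \<and> V \<noteq> {} \<and> finite VH \<and> card VH = h \<and>
      oriented_graph VH EH \<and> two_colorable VH EH \<and> 0 < \<delta> \<and> \<delta> \<le> 1 \<longrightarrow>
      (\<exists>C cl. clustering V E \<delta> (c * \<delta> ^ e) C cl) \<or>
      c * \<delta> ^ e * real (card V) ^ h \<le> real (card (embeddings V E VH EH))"
    using clustering_or_many_embeddings_poly[OF assms] by (elim exE conjE)
  define N where "N = h * 2 ^ h"
  have N1: "1 \<le> N" using assms by (simp add: N_def)
  then have N2: "1 \<le> real N ^ 2" "1 \<le> real N ^ h" by simp_all
  define \<tau> where "\<tau> = 1 / (2 * real N ^ 2)"
  have "0 < 2 * real N ^ 2" "1 \<le> 2 * real N ^ 2" using N2(1) by linarith+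
  then have \<tau>: "0 < \<tau>" "\<tau> \<le> 1"
    unfolding \<tau>_def by (simp_all only: zero_less_divide_1_iff divide_le_eq_1_pos)
  \<comment> \<open>\<open>a1\<close> and \<open>a2\<close> are the constants in \<gamma>1 = a1 eps
    ^ e and \<gamma>2 = a2 eps ^ (2 e ^ 2), obtained by substituting the coarse cluster size into
    the fine parameter.\<close>
  define a1 where "a1 = c / 30 ^ e"
  define a2 where "a2 = c * (\<tau> * a1 ^ 2 / 16) ^ e"
  have a: "0 < a1" "0 < a2" using c \<tau> by (auto simp: a1_def a2_def)
  \<comment> \<open>A sum in place of a maximum: eps < 1, so this exponent is weaker than both e,
    from a failed coarse clustering, and 2 e ^ 2 N, from \<gamma>2 ^ N.\<close>
  define b where "b = e + 2 * e ^ 2 * N"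
  \<comment> \<open>The least constant over all outcomes; division by h ^ h passes from embeddings
    to copies.\<close>
  define A where "A = min a1 (a2 ^ N / (2 * real N ^ h)) / real h ^ h"
  have A: "0 < A" using a N1 assms by (simp add: A_def)
  have main: "eps powr real (Suc b) * real n ^ h \<le> real (card (copies {0..<n} E {0..<h} EH))"
    if H: "oriented_graph {0..<h} EH" "two_colorable {0..<h} EH"
      and eps: "0 < eps" "eps < min 1 A"
      and \<gamma>1: "\<gamma>1 = c * (eps / 30) ^ e" and \<delta>2: "\<delta>2 = \<tau> * \<gamma>1 ^ 2 / 16" and \<gamma>2: "\<gamma>2 = c * \<delta>2 ^ e"
      and n: "60 / eps + 2 / \<gamma>1 + 2 / \<delta>2 + 2 * real N ^ 2 / \<gamma>2 + 1 \<le> real n"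
      and E: "tournament {0..<n} E" "eps_far eps {0..<n} E {0..<h} EH"
    for EH :: "(nat \<times> nat) set" and eps \<gamma>1 \<delta>2 \<gamma>2 n and E :: "(nat \<times> nat) set"
  proof -
    let ?emb = "embeddings {0..<n} E {0..<h} EH"
    have \<gamma>1_eq: "\<gamma>1 = a1 * eps ^ e" by (simp add: \<gamma>1 a1_def power_divide)
    have \<gamma>2_eq: "\<gamma>2 = a2 * eps ^ (2 * e ^ 2)"
    proof -
      have "(eps ^ e) ^ 2 = eps ^ (2 * e)" by (simp add: mult.commute flip: power_mult)
      then have "\<delta>2 = \<tau> * a1 ^ 2 / 16 * eps ^ (2 * e)"
        by (simp add: \<delta>2 \<gamma>1_eq power_mult_distrib)
      moreover have "(eps ^ (2 * e)) ^ e = eps ^ (2 * e ^ 2)"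
        by (simp add: power2_eq_square mult.assoc flip: power_mult)
      ultimately show ?thesis by (simp only: \<gamma>2 a2_def power_mult_distrib mult.assoc)
    qed
    have pos: "0 < \<gamma>1" "0 < \<gamma>2" using a eps by (auto simp: \<gamma>1_eq \<gamma>2_eq)
    then have \<delta>2_pos: "0 < \<delta>2" using \<tau> by (simp add: \<delta>2)
    have \<gamma>1_le: "\<gamma>1 \<le> 1" unfolding \<gamma>1 using c eps by (intro mult_le_one power_le_one) auto
    have "\<gamma>1 ^ 2 \<le> 1" using pos \<gamma>1_le by (intro power_le_one) auto
    then have "\<tau> * \<gamma>1 ^ 2 \<le> 1" using \<tau> by (intro mult_le_one) auto
    then have \<delta>2_le: "\<delta>2 \<le> 1" by (simp add: \<delta>2)
    have \<gamma>2_le: "\<gamma>2 \<le> 1" unfolding \<gamma>2 using c \<delta>2_pos \<delta>2_le by (intro mult_le_one power_le_one) auto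
    have quot: "0 < 60 / eps" "0 < 2 / \<gamma>1" "0 < 2 / \<delta>2" "0 < 2 * real N ^ 2 / \<gamma>2"
      using eps pos \<delta>2_pos N1 by (auto intro!: divide_pos_pos)
    have n1: "1 \<le> real n" using n quot by linarith
    have large: "2 \<le> eps / 30 * real n" "2 \<le> \<gamma>1 * real n" "2 \<le> \<delta>2 * real n" "2 * real N ^ 2 \<le> \<gamma>2 * real n"
    proof -
      have "60 / eps \<le> real n" "2 / \<gamma>1 \<le> real n" "2 / \<delta>2 \<le> real n" "2 * real N ^ 2 / \<gamma>2 \<le> real n"
        using n quot by linarith+
      then show "2 \<le> eps / 30 * real n" "2 \<le> \<gamma>1 * real n" "2 \<le> \<delta>2 * real n" "2 * real N ^ 2 \<le> \<gamma>2 * real n"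
        using eps pos \<delta>2_pos by (auto simp: field_simps)
    qed
    have V: "finite {0..<n}" "{0..<n} \<noteq> {}" using n1 by auto
    have VH: "finite {0..<h}" "{0..<h} \<noteq> {}" "card {0..<h} = h" using assms by auto
    have dich: "(\<exists>C cl. clustering {0..<n} E \<delta> (c * \<delta> ^ e) C cl) \<or> c * \<delta> ^ e * real n ^ h \<le> real (card ?emb)"
      if "0 < \<delta>" "\<delta> \<le> 1" for \<delta>
      using dichotomy[rule_format, of "{0..<n}" E "{0..<h}" EH \<delta>] E(1) V VH H that by simp
    have low: "a2 ^ N / (2 * real N ^ h) * eps ^ b \<le> \<gamma>2 ^ N / (2 * real N ^ h)"
    proof -
      have "eps ^ b \<le> eps ^ (2 * e ^ 2 * N)" using eps by (intro power_decreasing) (auto simp: b_def)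
      then have "a2 ^ N * eps ^ b \<le> a2 ^ N * eps ^ (2 * e ^ 2 * N)" using a by (intro mult_left_mono) auto
      also have "\<dots> = \<gamma>2 ^ N" by (simp add: \<gamma>2_eq power_mult_distrib power_mult)
      finally show ?thesis using N2 by (simp add: divide_right_mono)
    qed
    \<comment> \<open>The bound from a failed fine clustering is thereby at least the one from a
      successful one, so both can be treated as one alternative.\<close>
    have low2: "\<gamma>2 ^ N / (2 * real N ^ h) \<le> \<gamma>2"
    proof -
      have "\<gamma>2 ^ N \<le> \<gamma>2 ^ 1" using pos \<gamma>2_le N1 by (intro power_decreasing) auto
      moreover have "\<gamma>2 * 1 \<le> \<gamma>2 * (2 * real N ^ h)" using pos N2 by (intro mult_left_mono) auto
      ultimately have "\<gamma>2 ^ N \<le> \<gamma>2 * (2 * real N ^ h)" by simp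
      moreover have "0 < 2 * real N ^ h" using N2 by linarith
      ultimately show ?thesis by (simp only: pos_divide_le_eq)
    qed
    have min_le: "min a1 (a2 ^ N / (2 * real N ^ h)) * eps ^ b \<le> x"
      if "a1 * eps ^ e \<le> x \<or> \<gamma>2 ^ N / (2 * real N ^ h) \<le> x" for x
      using that
    proof
      assume "a1 * eps ^ e \<le> x"
      moreover have "min a1 (a2 ^ N / (2 * real N ^ h)) * eps ^ b \<le> a1 * eps ^ e"
        using a eps by (intro mult_mono power_decreasing) (auto simp: b_def)
      ultimately show ?thesis by linarith
    next
      assume "\<gamma>2 ^ N / (2 * real N ^ h) \<le> x"
      moreover have "min a1 (a2 ^ N / (2 * real N ^ h)) * eps ^ b \<le> a2 ^ N / (2 * real N ^ h) * eps ^ b"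
        using eps by (intro mult_right_mono) auto
      ultimately show ?thesis using low by linarith
    qed
    have "\<exists>x. (a1 * eps ^ e \<le> x \<or> \<gamma>2 ^ N / (2 * real N ^ h) \<le> x) \<and> x * real n ^ h \<le> real (card ?emb)"
    proof (cases "\<exists>C cl. clustering {0..<n} E (eps / 30) \<gamma>1 C cl")
      case False
      then have "c * (eps / 30) ^ e * real n ^ h \<le> real (card ?emb)"
        using dich[of "eps / 30"] eps unfolding \<gamma>1 by auto
      then show ?thesis unfolding \<gamma>1[symmetric] \<gamma>1_eq by blast
    next
      case True
      then obtain C cl where C: "clustering {0..<n} E (eps / 30) \<gamma>1 C cl" by blast
      show ?thesis
      proof (cases "\<exists>C' cl'. clustering {0..<n} E \<delta>2 \<gamma>2 C' cl'")
        case False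
        then have "\<gamma>2 * real n ^ h \<le> real (card ?emb)"
          using dich[OF \<delta>2_pos \<delta>2_le] unfolding \<gamma>2 by auto
        then show ?thesis using low2 by blast
      next
        case True
        then obtain C' cl' where C': "clustering {0..<n} E \<delta>2 \<gamma>2 C' cl'" by blast
        have "\<gamma>2 ^ N / (2 * real N ^ card {0..<h}) * real (card {0..<n}) ^ card {0..<h} \<le> real (card ?emb)"
        proof (rule embeddings_of_clusterings[OF E(1) V VH(1,2) eps(1) _ E(2) _ \<tau>_def pos(1) \<gamma>1_le C C'[unfolded \<delta>2]])
          show "eps \<le> 1" using eps by simp
          show "N = card {0..<h} * 2 ^ card {0..<h}" by (simp add: N_def)
        qed (use large \<delta>2 in simp_all)
        then show ?thesis by auto
      qed
    qed
    then obtain x where x: "a1 * eps ^ e \<le> x \<or> \<gamma>2 ^ N / (2 * real N ^ h) \<le> x"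
      "x * real n ^ h \<le> real (card ?emb)" by blast
    have hh: "0 < real h ^ h" using assms by simp
    have "real (card ?emb) \<le> real (card (copies {0..<n} E {0..<h} EH)) * real h ^ h"
    proof -
      have "EH \<subseteq> {0..<h} \<times> {0..<h}" using H(1) by (simp add: oriented_graph_def)
      from card_embeddings_le[OF V(1) VH(1) this, of E] show ?thesis
        unfolding VH(3) by (metis of_nat_mono of_nat_mult of_nat_power)
    qed
    moreover have "A * eps ^ b * real h ^ h \<le> x"
      using min_le[OF x(1)] hh by (simp add: A_def)
    then have "A * eps ^ b * real h ^ h * real n ^ h \<le> x * real n ^ h" by (rule mult_right_mono) simp
    ultimately have "A * eps ^ b * real n ^ h * real h ^ h
        \<le> real (card (copies {0..<n} E {0..<h} EH)) * real h ^ h"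
      using x(2) by (simp add: algebra_simps)
    then have "A * eps ^ b * real n ^ h \<le> real (card (copies {0..<n} E {0..<h} EH))"
      using hh by (simp only: mult_le_cancel_right_pos)
    \<comment> \<open>One more factor \<open>eps\<close> absorbs the constant: this is the reason
      for the condition eps < A, hence for the choice of \<open>eps0\<close>.\<close>
    moreover have "eps powr real (Suc b) * real n ^ h \<le> A * eps ^ b * real n ^ h"
    proof (rule mult_right_mono)
      have "eps powr real (Suc b) = eps * eps ^ b" using eps(1) by (simp only: powr_realpow power_Suc)
      also have "\<dots> \<le> A * eps ^ b" using eps by (intro mult_right_mono) auto
      finally show "eps powr real (Suc b) \<le> A * eps ^ b" .
    qed simp
    ultimately show ?thesis by linarith
  qed
  show ?thesis
  proof (rule exI[of _ "min 1 A"], intro conjI exI[of _ "real (Suc b)"] allI impI)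
    show "0 < min 1 A" using A by simp
    fix EH :: "(nat \<times> nat) set" and eps :: real
    assume H: "oriented_graph {0..<h} EH \<and> two_colorable {0..<h} EH" and eps: "0 < eps \<and> eps < min 1 A"
    define \<gamma>1 where "\<gamma>1 = c * (eps / 30) ^ e"
    define \<delta>2 where "\<delta>2 = \<tau> * \<gamma>1 ^ 2 / 16"
    define \<gamma>2 where "\<gamma>2 = c * \<delta>2 ^ e"
    \<comment> \<open>Each summand enforces one of the lower bounds on n in
      \<open>embeddings_of_clusterings\<close>; the final 1 makes the vertex set nonempty.\<close>
    define X where "X = 60 / eps + 2 / \<gamma>1 + 2 / \<delta>2 + 2 * real N ^ 2 / \<gamma>2 + 1"
    show "\<exists>n0. \<forall>n\<ge>n0. \<forall>E :: (nat \<times> nat) set.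
        tournament {0..<n} E \<and> eps_far eps {0..<n} E {0..<h} EH \<longrightarrow>
        eps powr real (Suc b) * real n ^ h \<le> real (card (copies {0..<n} E {0..<h} EH))"
    proof (intro exI[of _ "nat \<lceil>X\<rceil>"] allI impI)
      fix n and E :: "(nat \<times> nat) set"
      assume "nat \<lceil>X\<rceil> \<le> n" and E: "tournament {0..<n} E \<and> eps_far eps {0..<n} E {0..<h} EH"
      then have "X \<le> real n" by linarith
      then show "eps powr real (Suc b) * real n ^ h \<le> real (card (copies {0..<n} E {0..<h} EH))"
        using main[OF conjunct1[OF H] conjunct2[OF H] conjunct1[OF eps] conjunct2[OF eps]
          \<gamma>1_def \<delta>2_def \<gamma>2_def _ conjunct1[OF E] conjunct2[OF E]] unfolding X_def by blast
    qed
  qed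
qed

end
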